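(* Let $(\mathfrak h,s)$ be an effective, orthogonal symmetric Lie algebra with Legendrian structure $\Lambda$, and let $\mathfrak h=\mathfrak g\oplus\mathfrak p$ be its decomposition into $+1$ and $-1$ eigenspaces of $s$. Then there exists a decomposition, unique up to isometry, $$\mathfrak h=\mathfrak h_0\oplus\mathfrak h_+\oplus\mathfrak h_-\ \text{(direct sum of ideals of }\mathfrak h),\quad \mathfrak g=\mathfrak g_0\oplus\mathfrak g_+\oplus\mathfrak g_-\ \text{(direct sum of ideals of }\mathfrak g),\quad \mathfrak p=\mathfrak p_0\oplus\mathfrak p_+\oplus\mathfrak p_-\ \text{(direct sum of subspaces)},$$ with $\mathfrak h_\bullet=\mathfrak g_\bullet\oplus\mathfrak p_\bullet$ for $\bullet\in\{0,+,-\}$, such that, with the symmetric and Legendrian structures on $\mathfrak h_0,\mathfrak h_+,\mathfrak h_-$ induced by restriction, there are isomorphisms of symmetric Lie algebras with Legendrian structure $$\mathfrak h_0\cong\mathfrak g_0\rtimes\mathfrak g_0^*,\qquad \mathfrak h_+\cong\mathfrak g_+\times\mathfrak g_+,\qquad \mathfrak h_-\cong\mathfrak g_-\otimes\mathbb C,$$ where the right-hand sides carry the standard structures described in the context (for suitable invariant inner products on $\mathfrak g_+$ and $\mathfrak g_-$).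
   Context: Lie algebras are real and finite-dimensional. A symmetric Lie algebra $(\mathfrak h,s)$ is a Lie algebra with an involutive automorphism $s$; $\mathfrak g$ is the fixed subalgebra of $s$ and $\mathfrak p$ its $-1$ eigenspace. It is orthogonal if $\mathfrak g$ is compactly embedded in $\mathfrak h$ (i.e. the connected Lie subgroup of $\mathrm{Int}(\mathfrak h)$ with Lie algebra $\mathrm{ad}_{\mathfrak h}(\mathfrak g)$ is compact), and effective if $\mathfrak g\cap\mathfrak z=0$ where $\mathfrak z$ is the center of $\mathfrak h$. A Legendrian structure on $(\mathfrak h,s)$ is a nondegenerate symmetric bilinear form $\Lambda:\mathfrak h\times\mathfrak h\to\mathbb R$ with $\Lambda(s\zeta_1,\zeta_2)=-\Lambda(\zeta_1,s\zeta_2)$ and $\Lambda([\zeta_1,\zeta_2],\zeta_3)=\Lambda(\zeta_1,[\zeta_2,\zeta_3])$. An isomorphism of symmetric Lie algebras with Legendrian structure is a Lie algebra isomorphism intertwining the involutions and the Legendrian forms. "Unique up to isometry" means: any two such decompositions are carried to one another by a Lie algebra automorphism of $\mathfrak h$ commuting with $s$ and preserving $\Lambda$. Standard structures, for a Lie algebra $\mathfrak k$ (in the second and third cases with an invariant inner product $B$): (0) $\mathfrak k\rtimes\mathfrak k^*$ with bracket $[(\xi,\lambda),(\eta,\mu)]=([\xi,\eta],\mathrm{ad}^*_\xi\mu-\mathrm{ad}^*_\eta\lambda)$, involution $(\xi,\lambda)\mapsto(\xi,-\lambda)$, and form $\Lambda_0((\xi_1,\lambda_1),(\xi_2,\lambda_2))=\langle\xi_1,\lambda_2\rangle+\langle\xi_2,\lambda_1\rangle$.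 (+) $\mathfrak k\times\mathfrak k$ with involution $(\xi_1,\xi_2)\mapsto(\xi_2,\xi_1)$ and form $\Lambda_+((\xi_1,\eta_1),(\xi_2,\eta_2))=\frac12(B(\xi_1,\xi_2)-B(\eta_1,\eta_2))$. (−) $\mathfrak k\otimes\mathbb C$ as a real Lie algebra with involution complex conjugation $\xi+\sqrt{-1}\,\eta\mapsto\xi-\sqrt{-1}\,\eta$ and form $\Lambda_-(\zeta_1,\zeta_2)=\mathrm{Im}\,B^{\mathbb C}(\zeta_1,\zeta_2)$, with $B^{\mathbb C}$ the $\mathbb C$-bilinear extension of $B$. *)

theory Defs
  imports "HOL-Analysis.Analysis" "HOL-Library.Function_Algebras"
begin

text \<open>
  Linear functionals are handled as functions, so the type of real-valued functions
  has to be a real vector space (pointwise operations).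
\<close>

instantiation "fun" :: (type, real_vector) real_vector
begin

definition scaleR_fun_def: "scaleR c f = (\<lambda>x. c *\<^sub>R f x)"

instance
  by standard (auto simp: scaleR_fun_def fun_eq_iff scaleR_add_right scaleR_add_left)

end

text \<open>
  All structures live on a carrier \<open>V\<close>, a linear subspace of the ambient type; the behaviour of
  brackets, involutions and forms outside the carrier is irrelevant. The structure induced on an
  ideal by restriction is therefore given by the same operations on the smaller carrier.
\<close>

definition lin_on :: "'a::real_vector set \<Rightarrow> ('a \<Rightarrow> 'b::real_vector) \<Rightarrow> bool" where
  "lin_on V f \<longleftrightarrow> (\<forall>x\<in>V. \<forall>y\<in>V. f (x + y) = f x + f y) \<and> (\<forall>c. \<forall>x\<in>V. f (c *\<^sub>R x) = c *\<^sub>R f x)"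

definition bilin_on :: "'a::real_vector set \<Rightarrow> ('a \<Rightarrow> 'a \<Rightarrow> 'b::real_vector) \<Rightarrow> bool" where
  "bilin_on V b \<longleftrightarrow> (\<forall>x\<in>V. lin_on V (\<lambda>y. b x y)) \<and> (\<forall>y\<in>V. lin_on V (\<lambda>x. b x y))"

locale lie_algebra =
  fixes V :: "'a::real_vector set" and br :: "'a \<Rightarrow> 'a \<Rightarrow> 'a"
  assumes subspace_carrier: "subspace V"
    and finite_dim: "\<exists>S. finite S \<and> span S = V"
    and br_closed: "\<lbrakk>x \<in> V; y \<in> V\<rbrakk> \<Longrightarrow> br x y \<in> V"
    and br_bilinear: "bilin_on V br"
    and br_alternating: "x \<in> V \<Longrightarrow> br x x = 0"
    and jacobi: "\<lbrakk>x \<in> V; y \<in> V; z \<in> V\<rbrakk> \<Longrightarrow> br x (br y z) + br y (br z x) + br z (br x y) = 0"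

locale symmetric_lie_algebra = lie_algebra V br
  for V :: "'a::real_vector set" and br +
  fixes s :: "'a \<Rightarrow> 'a"
  assumes s_closed: "x \<in> V \<Longrightarrow> s x \<in> V"
    and s_linear: "lin_on V s"
    and s_bracket: "\<lbrakk>x \<in> V; y \<in> V\<rbrakk> \<Longrightarrow> s (br x y) = br (s x) (s y)"
    and s_involutive: "x \<in> V \<Longrightarrow> s (s x) = x"

locale legendrian_lie_algebra = symmetric_lie_algebra V br s
  for V :: "'a::real_vector set" and br s +
  fixes \<Lambda> :: "'a \<Rightarrow> 'a \<Rightarrow> real"
  assumes \<Lambda>_bilinear: "bilin_on V \<Lambda>"
    and \<Lambda>_sym: "\<lbrakk>x \<in> V; y \<in> V\<rbrakk> \<Longrightarrow> \<Lambda> x y = \<Lambda> y x"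
    and \<Lambda>_nondegenerate: "\<lbrakk>x \<in> V; \<forall>y\<in>V. \<Lambda> x y = 0\<rbrakk> \<Longrightarrow> x = 0"
    and \<Lambda>_s: "\<lbrakk>x \<in> V; y \<in> V\<rbrakk> \<Longrightarrow> \<Lambda> (s x) y = - \<Lambda> x (s y)"
    and \<Lambda>_invariant: "\<lbrakk>x \<in> V; y \<in> V; z \<in> V\<rbrakk> \<Longrightarrow> \<Lambda> (br x y) z = \<Lambda> x (br y z)"

definition fixed_part :: "'a::real_vector set \<Rightarrow> ('a \<Rightarrow> 'a) \<Rightarrow> 'a set" where
  "fixed_part V s = {x \<in> V. s x = x}"

definition anti_part :: "'a::real_vector set \<Rightarrow> ('a \<Rightarrow> 'a) \<Rightarrow> 'a set" where
  "anti_part V s = {x \<in> V. s x = - x}"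

definition lie_center :: "'a::real_vector set \<Rightarrow> ('a \<Rightarrow> 'a \<Rightarrow> 'a) \<Rightarrow> 'a set" where
  "lie_center V br = {z \<in> V. \<forall>x\<in>V. br z x = 0}"

definition lie_ideal :: "'a::real_vector set \<Rightarrow> ('a \<Rightarrow> 'a \<Rightarrow> 'a) \<Rightarrow> 'a set \<Rightarrow> bool" where
  "lie_ideal V br I \<longleftrightarrow> subspace I \<and> I \<subseteq> V \<and> (\<forall>x\<in>V. \<forall>y\<in>I. br x y \<in> I)"

definition effective :: "'a::real_vector set \<Rightarrow> ('a \<Rightarrow> 'a \<Rightarrow> 'a) \<Rightarrow> ('a \<Rightarrow> 'a) \<Rightarrow> bool" where
  "effective V br s \<longleftrightarrow> fixed_part V s \<inter> lie_center V br = {0}"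

definition exp_ad :: "('a::real_normed_vector \<Rightarrow> 'a \<Rightarrow> 'a) \<Rightarrow> 'a \<Rightarrow> 'a \<Rightarrow> 'a" where
  "exp_ad br x y = (\<Sum>n. ((br x ^^ n) y) /\<^sub>R fact n)"

text \<open>
  For a subalgebra \<open>K\<close> of \<open>V\<close>, the connected Lie subgroup of \<open>Int V\<close> (equivalently, of
  \<open>GL V\<close>) with Lie algebra \<open>ad K\<close> is the group generated by the automorphisms
  \<open>exp (ad x)\<close>, \<open>x \<in> K\<close>. This generating set is closed under inverses, so finite products suffice.
  The elements are endomorphisms of \<open>V\<close>, extended by \<open>undefined\<close> outside \<open>V\<close>.
\<close>

inductive_set adjoint_group ::
    "'a::real_normed_vector set \<Rightarrow> ('a \<Rightarrow> 'a \<Rightarrow> 'a) \<Rightarrow> 'a set \<Rightarrow> ('a \<Rightarrow> 'a) set"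
  for V br K where
  one: "restrict id V \<in> adjoint_group V br K"
| mult: "\<lbrakk>x \<in> K; T \<in> adjoint_group V br K\<rbrakk>
    \<Longrightarrow> restrict (\<lambda>y. exp_ad br x (T y)) V \<in> adjoint_group V br K"

text \<open>
  Compactness refers to the topology of pointwise convergence, which on linear endomorphisms of a
  finite-dimensional space is the usual topology. A connected Lie subgroup is compact in its
  intrinsic Lie group topology iff it is compact as a subset of the endomorphisms.
\<close>

definition compactly_embedded ::
    "'a::real_normed_vector set \<Rightarrow> ('a \<Rightarrow> 'a \<Rightarrow> 'a) \<Rightarrow> 'a set \<Rightarrow> bool" where
  "compactly_embedded V br K \<longleftrightarrow> compact (adjoint_group V br K)"

definition orthogonal_symmetric ::
    "'a::real_normed_vector set \<Rightarrow> ('a \<Rightarrow> 'a \<Rightarrow> 'a) \<Rightarrow> ('a \<Rightarrow> 'a) \<Rightarrow> bool" where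
  "orthogonal_symmetric V br s \<longleftrightarrow>
     symmetric_lie_algebra V br s \<and> compactly_embedded V br (fixed_part V s)"

definition legendrian_isomorphism ::
    "'a::real_vector set \<Rightarrow> ('a \<Rightarrow> 'a \<Rightarrow> 'a) \<Rightarrow> ('a \<Rightarrow> 'a) \<Rightarrow> ('a \<Rightarrow> 'a \<Rightarrow> real) \<Rightarrow>
     'b::real_vector set \<Rightarrow> ('b \<Rightarrow> 'b \<Rightarrow> 'b) \<Rightarrow> ('b \<Rightarrow> 'b) \<Rightarrow> ('b \<Rightarrow> 'b \<Rightarrow> real) \<Rightarrow>
     ('a \<Rightarrow> 'b) \<Rightarrow> bool" where
  "legendrian_isomorphism V br s \<Lambda> V' br' s' \<Lambda>' \<phi> \<longleftrightarrow>
     legendrian_lie_algebra V br s \<Lambda> \<and> legendrian_lie_algebra V' br' s' \<Lambda>' \<and>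
     lin_on V \<phi> \<and> bij_betw \<phi> V V' \<and>
     (\<forall>x\<in>V. \<forall>y\<in>V. \<phi> (br x y) = br' (\<phi> x) (\<phi> y)) \<and>
     (\<forall>x\<in>V. \<phi> (s x) = s' (\<phi> x)) \<and>
     (\<forall>x\<in>V. \<forall>y\<in>V. \<Lambda>' (\<phi> x) (\<phi> y) = \<Lambda> x y)"

definition legendrian_isomorphic ::
    "'a::real_vector set \<Rightarrow> ('a \<Rightarrow> 'a \<Rightarrow> 'a) \<Rightarrow> ('a \<Rightarrow> 'a) \<Rightarrow> ('a \<Rightarrow> 'a \<Rightarrow> real) \<Rightarrow>
     'b::real_vector set \<Rightarrow> ('b \<Rightarrow> 'b \<Rightarrow> 'b) \<Rightarrow> ('b \<Rightarrow> 'b) \<Rightarrow> ('b \<Rightarrow> 'b \<Rightarrow> real) \<Rightarrow> bool" where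
  "legendrian_isomorphic V br s \<Lambda> V' br' s' \<Lambda>' \<longleftrightarrow>
     (\<exists>\<phi>. legendrian_isomorphism V br s \<Lambda> V' br' s' \<Lambda>' \<phi>)"

definition invariant_inner_product ::
    "'a::real_vector set \<Rightarrow> ('a \<Rightarrow> 'a \<Rightarrow> 'a) \<Rightarrow> ('a \<Rightarrow> 'a \<Rightarrow> real) \<Rightarrow> bool" where
  "invariant_inner_product k br B \<longleftrightarrow>
     bilin_on k B \<and> (\<forall>x\<in>k. \<forall>y\<in>k. B x y = B y x) \<and> (\<forall>x\<in>k. x \<noteq> 0 \<longrightarrow> B x x > 0) \<and>
     (\<forall>x\<in>k. \<forall>y\<in>k. \<forall>z\<in>k. B (br x y) z = B x (br y z))"

subsection \<open>The semidirect product with the dual\<close>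

text \<open>Functionals on \<open>k\<close> are extended by \<open>0\<close> outside \<open>k\<close>, which makes the extension unique.\<close>

definition dual :: "'a::real_vector set \<Rightarrow> ('a \<Rightarrow> real) set" where
  "dual k = {l. lin_on k l \<and> (\<forall>x. x \<notin> k \<longrightarrow> l x = 0)}"

definition coad ::
    "'a::real_vector set \<Rightarrow> ('a \<Rightarrow> 'a \<Rightarrow> 'a) \<Rightarrow> 'a \<Rightarrow> ('a \<Rightarrow> real) \<Rightarrow> 'a \<Rightarrow> real" where
  "coad k br \<xi> \<mu> = (\<lambda>\<zeta>. if \<zeta> \<in> k then - \<mu> (br \<xi> \<zeta>) else 0)"

definition bracket0 :: "'a::real_vector set \<Rightarrow> ('a \<Rightarrow> 'a \<Rightarrow> 'a) \<Rightarrow>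
    'a \<times> ('a \<Rightarrow> real) \<Rightarrow> 'a \<times> ('a \<Rightarrow> real) \<Rightarrow> 'a \<times> ('a \<Rightarrow> real)" where
  "bracket0 k br = (\<lambda>(\<xi>, l) (\<eta>, m). (br \<xi> \<eta>, coad k br \<xi> m - coad k br \<eta> l))"

definition invol0 :: "'a::real_vector \<times> ('a \<Rightarrow> real) \<Rightarrow> 'a \<times> ('a \<Rightarrow> real)" where
  "invol0 = (\<lambda>(\<xi>, l). (\<xi>, - l))"

definition form0 :: "'a::real_vector \<times> ('a \<Rightarrow> real) \<Rightarrow> 'a \<times> ('a \<Rightarrow> real) \<Rightarrow> real" where
  "form0 = (\<lambda>(\<xi>1, l1) (\<xi>2, l2). l2 \<xi>1 + l1 \<xi>2)"

subsection \<open>The double\<close>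

definition bracket_pos :: "('a \<Rightarrow> 'a \<Rightarrow> 'a) \<Rightarrow> 'a \<times> 'a \<Rightarrow> 'a \<times> 'a \<Rightarrow> 'a \<times> 'a" where
  "bracket_pos br = (\<lambda>(\<xi>1, \<eta>1) (\<xi>2, \<eta>2). (br \<xi>1 \<xi>2, br \<eta>1 \<eta>2))"

definition invol_pos :: "'a \<times> 'a \<Rightarrow> 'a \<times> 'a" where
  "invol_pos = (\<lambda>(\<xi>, \<eta>). (\<eta>, \<xi>))"

definition form_pos :: "('a \<Rightarrow> 'a \<Rightarrow> real) \<Rightarrow> 'a \<times> 'a \<Rightarrow> 'a \<times> 'a \<Rightarrow> real" where
  "form_pos B = (\<lambda>(\<xi>1, \<eta>1) (\<xi>2, \<eta>2). (B \<xi>1 \<xi>2 - B \<eta>1 \<eta>2) / 2)"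

subsection \<open>The complexification\<close>

text \<open>The pair \<open>(\<xi>, \<eta>)\<close> stands for \<open>\<xi> + \<i> \<eta>\<close>.\<close>

definition bracket_neg ::
    "('a \<Rightarrow> 'a \<Rightarrow> 'a::real_vector) \<Rightarrow> 'a \<times> 'a \<Rightarrow> 'a \<times> 'a \<Rightarrow> 'a \<times> 'a" where
  "bracket_neg br = (\<lambda>(\<xi>1, \<eta>1) (\<xi>2, \<eta>2). (br \<xi>1 \<xi>2 - br \<eta>1 \<eta>2, br \<xi>1 \<eta>2 + br \<eta>1 \<xi>2))"

definition invol_neg :: "'a::real_vector \<times> 'a \<Rightarrow> 'a \<times> 'a" where
  "invol_neg = (\<lambda>(\<xi>, \<eta>). (\<xi>, - \<eta>))"

definition complex_extension ::
    "('a \<Rightarrow> 'a \<Rightarrow> real) \<Rightarrow> 'a \<times> 'a \<Rightarrow> 'a \<times> 'a \<Rightarrow> complex" where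
  "complex_extension B =
     (\<lambda>(\<xi>1, \<eta>1) (\<xi>2, \<eta>2). Complex (B \<xi>1 \<xi>2 - B \<eta>1 \<eta>2) (B \<xi>1 \<eta>2 + B \<eta>1 \<xi>2))"

definition form_neg :: "('a \<Rightarrow> 'a \<Rightarrow> real) \<Rightarrow> 'a \<times> 'a \<Rightarrow> 'a \<times> 'a \<Rightarrow> real" where
  "form_neg B = (\<lambda>\<zeta>1 \<zeta>2. Im (complex_extension B \<zeta>1 \<zeta>2))"

subsection \<open>Decompositions\<close>

datatype part = Null | Pos | Neg

definition direct_sum2 :: "'a::real_vector set \<Rightarrow> 'a set \<Rightarrow> 'a set \<Rightarrow> bool" where
  "direct_sum2 V A B \<longleftrightarrow> subspace A \<and> subspace B \<and> A \<subseteq> V \<and> B \<subseteq> V \<and>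
     (\<forall>x\<in>V. \<exists>!z. z \<in> A \<times> B \<and> x = fst z + snd z)"

definition direct_sum3 :: "'a::real_vector set \<Rightarrow> (part \<Rightarrow> 'a set) \<Rightarrow> bool" where
  "direct_sum3 V A \<longleftrightarrow> (\<forall>i. subspace (A i) \<and> A i \<subseteq> V) \<and>
     (\<forall>x\<in>V. \<exists>!a. (\<forall>i. a i \<in> A i) \<and> x = a Null + a Pos + a Neg)"

text \<open>
  The three components of \<open>\<hh>\<close>, \<open>\<gg>\<close>, \<open>\<pp>\<close> are the families \<open>H\<close>, \<open>G\<close>, \<open>P\<close>
  indexed by \<open>part\<close>.
\<close>

definition standard_decomposition ::
    "'a::real_vector set \<Rightarrow> ('a \<Rightarrow> 'a \<Rightarrow> 'a) \<Rightarrow> ('a \<Rightarrow> 'a) \<Rightarrow> ('a \<Rightarrow> 'a \<Rightarrow> real) \<Rightarrow>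
     (part \<Rightarrow> 'a set) \<Rightarrow> (part \<Rightarrow> 'a set) \<Rightarrow> (part \<Rightarrow> 'a set) \<Rightarrow> bool" where
  "standard_decomposition \<hh> br s \<Lambda> H G P \<longleftrightarrow>
     direct_sum3 \<hh> H \<and> (\<forall>i. lie_ideal \<hh> br (H i)) \<and>
     direct_sum3 (fixed_part \<hh> s) G \<and> (\<forall>i. lie_ideal (fixed_part \<hh> s) br (G i)) \<and>
     direct_sum3 (anti_part \<hh> s) P \<and>
     (\<forall>i. direct_sum2 (H i) (G i) (P i)) \<and>
     legendrian_isomorphic (H Null) br s \<Lambda>
       (G Null \<times> dual (G Null)) (bracket0 (G Null) br) invol0 form0 \<and>
     (\<exists>B. invariant_inner_product (G Pos) br B \<and>
       legendrian_isomorphic (H Pos) br s \<Lambda>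
         (G Pos \<times> G Pos) (bracket_pos br) invol_pos (form_pos B)) \<and>
     (\<exists>B. invariant_inner_product (G Neg) br B \<and>
       legendrian_isomorphic (H Neg) br s \<Lambda>
         (G Neg \<times> G Neg) (bracket_neg br) invol_neg (form_neg B))"

end

theory Submission
  imports Defs
begin

text \<open>
  Averaging over the compact group generated by \<open>ad \<gg>\<close> gives an \<open>ad \<gg>\<close>-invariant inner
  product on \<open>\<gg>\<close>. Together with the pairing \<open>\<Lambda>\<close> of \<open>\<gg>\<close> and \<open>\<pp>\<close> it yields an
  isomorphism \<open>J : \<gg> \<rightarrow> \<pp>\<close> of \<open>\<gg>\<close>-modules. Effectiveness means that \<open>\<gg>\<close> has trivial
  center, so \<open>\<gg>\<close> is perfect, and the Jacobi identity then forces \<open>[J x, J y] = A [x, y]\<close> for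
  a symmetric operator \<open>A\<close> commuting with \<open>ad \<gg>\<close>. Rescaling \<open>J\<close> by \<open>|A|\<close> to the power
  \<open>-1/2\<close> off the kernel of \<open>A\<close> replaces \<open>A\<close> by its sign \<open>\<sigma>\<close>, whose eigenspaces are the three ideals of \<open>\<gg>\<close>.
  Conversely, in any standard decomposition \<open>\<sigma>\<close> is \<open>0\<close>, \<open>1\<close>, \<open>-1\<close> on the three
  summands of \<open>\<gg>\<close>, so the decomposition is unique even as a family of subspaces, and the identity
  is the required isometry.
\<close>

section \<open>Inner products on subspaces\<close>

text \<open>The three cases come from a sign that cannot be scaled away. Since
  \<open>\<Lambda>\<close> is given, \<open>J\<close> and the inner product determine each other:
  composing \<open>J\<close> with an operator \<open>R\<close> turns \<open>B x y\<close> into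
  \<open>B (R x) y\<close>, which is again an inner product only for positive self-adjoint
  \<open>R\<close>, and turns \<open>A\<close> into \<open>A\<close> times the square of
  \<open>R\<close> when \<open>R\<close> commutes with \<open>ad \<gg>\<close>. So the absolute
  values of the eigenvalues of \<open>A\<close> can be normalised, but not their signs. Taking
  \<open>R\<close> as a function of \<open>A\<close> makes it commute with everything that commutes
  with \<open>A\<close>, in particular with \<open>ad \<gg>\<close>. Perfectness serves as an
  induction principle: a linear statement about \<open>\<gg>\<close> is checked on brackets only,
  where invariance and the Jacobi identity apply. The existence and the symmetry of \<open>A\<close>
  are both obtained this way. For uniqueness the obstacle is that another decomposition brings
  isomorphisms and inner products unrelated to \<open>B\<close> and \<open>J\<close>. What can be
  compared is the sign of \<open>B w (\<sigma> w)\<close>.\<close>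

lemma lin_on_add: "lin_on V f \<Longrightarrow> x \<in> V \<Longrightarrow> y \<in> V \<Longrightarrow> f (x + y) = f x + f y"
  and lin_on_scaleR: "lin_on V f \<Longrightarrow> x \<in> V \<Longrightarrow> f (c *\<^sub>R x) = c *\<^sub>R f x"
  by (auto simp: lin_on_def)

lemma lin_on_zero:
  assumes "lin_on V f" "subspace V" shows "f 0 = 0"
  using lin_on_scaleR[OF assms(1), of 0 0] assms(2) by (simp add: subspace_0)

lemma lin_on_uminus: "lin_on V f \<Longrightarrow> x \<in> V \<Longrightarrow> f (- x) = - f x"
  using lin_on_scaleR[of V f x "-1"] by simp

lemma lin_on_diff:
  assumes "lin_on V f" "subspace V" "x \<in> V" "y \<in> V" shows "f (x - y) = f x - f y"
  using lin_on_add[OF assms(1), of x "- y"] assms by (simp add: lin_on_uminus subspace_neg)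

lemma lin_on_sum:
  assumes "lin_on V f" "subspace V" "\<And>i. i \<in> I \<Longrightarrow> g i \<in> V"
  shows "f (\<Sum>i\<in>I. g i) = (\<Sum>i\<in>I. f (g i))"
  using assms(3)
proof (induction I rule: infinite_finite_induct)
  case (insert i I)
  then show ?case
    using lin_on_add[OF assms(1)] by (simp add: subspace_sum[OF assms(2)])
qed (auto simp: lin_on_zero[OF assms(1,2)])

lemma lin_on_subset: "lin_on V f \<Longrightarrow> W \<subseteq> V \<Longrightarrow> lin_on W f"
  by (auto simp: lin_on_def subset_iff)

lemma lin_on_linear: "linear f \<Longrightarrow> lin_on V f"
  by (simp add: lin_on_def linear_add linear_scale)

lemma lin_on_cong: "\<lbrakk>subspace V; \<And>x. x \<in> V \<Longrightarrow> f x = g x\<rbrakk> \<Longrightarrow> lin_on V f \<longleftrightarrow> lin_on V g"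
  by (simp add: lin_on_def subspace_add subspace_scale)

lemma lin_on_compose:
  "\<lbrakk>lin_on V f; lin_on W g; \<And>x. x \<in> V \<Longrightarrow> f x \<in> W\<rbrakk> \<Longrightarrow> lin_on V (\<lambda>x. g (f x))"
  by (simp add: lin_on_def)

lemma lin_on_eq_subspace:
  assumes "subspace V" "lin_on V f" "lin_on V g"
  shows "subspace {x \<in> V. f x = g x}"
  using assms
  by (auto simp: subspace_def lin_on_add lin_on_scaleR lin_on_zero[OF _ assms(1)])

lemma bilin_on_left: "bilin_on V b \<Longrightarrow> y \<in> V \<Longrightarrow> lin_on V (\<lambda>x. b x y)"
  and bilin_on_right: "bilin_on V b \<Longrightarrow> x \<in> V \<Longrightarrow> lin_on V (b x)"
  by (auto simp: bilin_on_def)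

lemma bilin_on_subset: "bilin_on V b \<Longrightarrow> W \<subseteq> V \<Longrightarrow> bilin_on W b"
  unfolding bilin_on_def by (meson lin_on_subset subsetD)

lemma subspace_projection:
  fixes V :: "'a::euclidean_space set"
  assumes "subspace V"
  obtains \<pi> where "linear \<pi>" "\<And>x. \<pi> x \<in> V" "\<And>x. x \<in> V \<Longrightarrow> \<pi> x = x"
proof -
  obtain B where B: "B \<subseteq> V" "pairwise orthogonal B" "\<And>x. x \<in> B \<Longrightarrow> norm x = 1"
      "independent B" "span B = V"
    using orthonormal_basis_subspace[OF assms] by metis
  have fin: "finite B"
    using B(4) independent_imp_finite by blast
  define \<pi> where "\<pi> x = (\<Sum>b\<in>B. (x \<bullet> b) *\<^sub>R b)" for x
  have lin: "linear \<pi>"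
    by (rule linearI)
      (simp_all add: \<pi>_def inner_add_left scaleR_add_left sum.distrib scaleR_sum_right)
  have "\<pi> b = b" if "b \<in> B" for b
  proof -
    have "\<pi> b = (\<Sum>c\<in>B. if c = b then b else 0)"
      unfolding \<pi>_def
    proof (rule sum.cong[OF refl])
      fix c assume "c \<in> B"
      then show "(b \<bullet> c) *\<^sub>R c = (if c = b then b else 0)"
        using B(2,3) that by (auto simp: pairwise_def orthogonal_def norm_eq_1)
    qed
    then show ?thesis
      using fin that by simp
  qed
  then have "\<pi> x = x" if "x \<in> V" for x
    using linear_eq_on[OF lin linear_id, of x B] that B(5) by simp
  moreover have "\<pi> x \<in> V" for x
    unfolding \<pi>_def by (intro subspace_sum subspace_scale assms) (use B(1) in auto)
  ultimately show ?thesis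
    using lin that by blast
qed

text \<open>Structures are linear only on a carrier and arbitrary elsewhere. Composing with a
  projection gives a globally linear map with the same values on the carrier, to which facts about
  continuity and power series apply.\<close>

lemma lin_on_extension:
  fixes V :: "'a::euclidean_space set"
  assumes "subspace V" "lin_on V f"
  obtains g where "linear g" "\<And>x. x \<in> V \<Longrightarrow> g x = f x"
proof -
  obtain \<pi> where \<pi>: "linear \<pi>" "\<And>x. \<pi> x \<in> V" "\<And>x. x \<in> V \<Longrightarrow> \<pi> x = x"
    using subspace_projection[OF assms(1)] by blast
  have "linear (\<lambda>x. f (\<pi> x))"
    using assms(2) \<pi>(1,2)
    by (intro linearI) (simp_all add: linear_add linear_scale lin_on_add lin_on_scaleR)
  then show ?thesis
    using that \<pi>(3) by metis
qed

lemma bilin_on_extension: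
  fixes V :: "'a::euclidean_space set"
  assumes "subspace V" "bilin_on V b"
  obtains b' where "bilinear b'" "\<And>x y. x \<in> V \<Longrightarrow> y \<in> V \<Longrightarrow> b' x y = b x y"
proof -
  obtain \<pi> where \<pi>: "linear \<pi>" "\<And>x. \<pi> x \<in> V" "\<And>x. x \<in> V \<Longrightarrow> \<pi> x = x"
    using subspace_projection[OF assms(1)] by blast
  have "bilinear (\<lambda>x y. b (\<pi> x) (\<pi> y))"
    unfolding bilinear_def
    using assms(2) \<pi>(1,2)
    by (auto intro!: linearI simp: linear_add linear_scale bilin_on_def lin_on_add lin_on_scaleR)
      (simp_all add: lin_on_def)
  then show ?thesis
    using that \<pi>(3) by force
qed

section \<open>Spectral theorem and Riesz representation on a subspace with an inner product\<close>

locale inner_space =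
  fixes W :: "'a::euclidean_space set" and Q :: "'a \<Rightarrow> 'a \<Rightarrow> real"
  assumes subspace_W: "subspace W"
    and bilin: "bilin_on W Q"
    and sym: "\<lbrakk>x \<in> W; y \<in> W\<rbrakk> \<Longrightarrow> Q x y = Q y x"
    and pos: "\<lbrakk>x \<in> W; x \<noteq> 0\<rbrakk> \<Longrightarrow> Q x x > 0"
begin

lemmas mem [simp] = subspace_0[OF subspace_W] subspace_add[OF subspace_W]
  subspace_diff[OF subspace_W] subspace_scale[OF subspace_W] subspace_neg[OF subspace_W]

lemma lin_left: "y \<in> W \<Longrightarrow> lin_on W (\<lambda>x. Q x y)" and lin_right: "x \<in> W \<Longrightarrow> lin_on W (Q x)"
  using bilin by (auto simp: bilin_on_def)

lemma Q_zero [simp]: "y \<in> W \<Longrightarrow> Q 0 y = 0" "y \<in> W \<Longrightarrow> Q y 0 = 0"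
  using lin_on_zero[OF lin_left subspace_W] lin_on_zero[OF lin_right subspace_W] by auto

lemma Q_simps [simp]:
  assumes "x \<in> W" "y \<in> W"
  shows "z \<in> W \<Longrightarrow> Q (x + z) y = Q x y + Q z y" "z \<in> W \<Longrightarrow> Q y (x + z) = Q y x + Q y z"
    "z \<in> W \<Longrightarrow> Q (x - z) y = Q x y - Q z y" "z \<in> W \<Longrightarrow> Q y (x - z) = Q y x - Q y z"
    "Q (c *\<^sub>R x) y = c * Q x y" "Q y (c *\<^sub>R x) = c * Q y x"
    "Q (- x) y = - Q x y" "Q y (- x) = - Q y x"
  using lin_on_add[OF lin_left] lin_on_add[OF lin_right]
    lin_on_diff[OF lin_left subspace_W] lin_on_diff[OF lin_right subspace_W]
    lin_on_scaleR[OF lin_left] lin_on_scaleR[OF lin_right] lin_on_uminus[OF lin_left]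
    lin_on_uminus[OF lin_right] assms
  by auto

lemma eq_0_iff: "x \<in> W \<Longrightarrow> Q x x = 0 \<longleftrightarrow> x = 0"
  using pos[of x] by (cases "x = 0") auto

lemma eqI:
  assumes "x \<in> W" "y \<in> W" "\<And>z. z \<in> W \<Longrightarrow> Q x z = Q y z" shows "x = y"
proof -
  have "Q (x - y) (x - y) = 0"
    using assms(3)[of "x - y"] assms(1,2) by simp
  then show ?thesis
    using eq_0_iff[of "x - y"] assms by simp
qed

lemma inner_space_subset: "subspace S \<Longrightarrow> S \<subseteq> W \<Longrightarrow> inner_space S Q"
  using bilin_on_subset[OF bilin] sym pos by unfold_locales (auto simp: subset_iff)

text \<open>At a maximum \<open>e\<close> of the Rayleigh quotient, with value \<open>m\<close>, the form
  \<open>m Q x y - Q (A x) y\<close> is positive semidefinite and vanishes at \<open>(e, e)\<close>; hence it vanishes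
  at \<open>(e, y)\<close> for all \<open>y\<close>.\<close>

lemma eigenvector_exists:
  assumes A: "lin_on W A" "\<And>x. x \<in> W \<Longrightarrow> A x \<in> W"
    and selfadj: "\<And>x y. x \<in> W \<Longrightarrow> y \<in> W \<Longrightarrow> Q (A x) y = Q x (A y)"
    and "W \<noteq> {0}"
  obtains e m where "e \<in> W" "e \<noteq> 0" "A e = m *\<^sub>R e"
proof -
  obtain A' where A': "linear A'" "\<And>x. x \<in> W \<Longrightarrow> A' x = A x"
    using lin_on_extension[OF subspace_W A(1)] by blast
  obtain Q' where Q': "bilinear Q'" "\<And>x y. x \<in> W \<Longrightarrow> y \<in> W \<Longrightarrow> Q' x y = Q x y"
    using bilin_on_extension[OF subspace_W bilin] by blast
  interpret Q': bounded_bilinear Q'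
    using Q'(1) bilinear_conv_bounded_bilinear by blast
  define K where "K = W \<inter> sphere 0 1"
  have "compact K"
    unfolding K_def by (intro closed_Int_compact closed_subspace subspace_W compact_sphere)
  obtain w where w: "w \<in> W" "w \<noteq> 0"
    using \<open>W \<noteq> {0}\<close> subspace_0[OF subspace_W] by auto
  then have "w /\<^sub>R norm w \<in> K"
    by (simp add: K_def)
  then have "K \<noteq> {}"
    by auto
  have cont: "continuous_on K (\<lambda>x. Q' (A' x) x / Q' x x)"
  proof (intro continuous_intros Q'.continuous_on linear_continuous_on)
    show "bounded_linear A'"
      using A'(1) by (simp add: linear_linear)
    show "\<forall>x\<in>K. Q' x x \<noteq> 0"
      using Q'(2) eq_0_iff by (auto simp: K_def)
  qed
  obtain e where e: "e \<in> K" "\<And>x. x \<in> K \<Longrightarrow> Q' (A' x) x / Q' x x \<le> Q' (A' e) e / Q' e e"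
    using continuous_attains_sup[OF \<open>compact K\<close> \<open>K \<noteq> {}\<close> cont] by auto
  have eW: "e \<in> W" "e \<noteq> 0"
    using e(1) by (auto simp: K_def)
  define m where "m = Q (A e) e / Q e e"
  have le: "Q (A x) x \<le> m * Q x x" if x: "x \<in> W" for x
  proof (cases "x = 0")
    case True
    then show ?thesis using A(2)[OF x] by (simp add: x)
  next
    case False
    define c where "c = inverse (norm x)"
    have c: "c > 0" "c *\<^sub>R x \<in> K"
      using False x by (auto simp: c_def K_def)
    have "Q (A (c *\<^sub>R x)) (c *\<^sub>R x) / Q (c *\<^sub>R x) (c *\<^sub>R x) \<le> m"
      using e(2)[OF c(2)] A'(2) Q'(2) A(2) eW x unfolding m_def by auto
    moreover have "Q (A (c *\<^sub>R x)) (c *\<^sub>R x) / Q (c *\<^sub>R x) (c *\<^sub>R x) = Q (A x) x / Q x x"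
      using x A c(1) by (simp add: lin_on_scaleR[OF A(1)])
    ultimately show ?thesis
      using pos[OF x False] by (simp add: pos_divide_le_eq)
  qed
  define S where "S x y = m * Q x y - Q (A x) y" for x y
  have S0: "S e e = 0"
    using eq_0_iff[OF eW(1)] eW(2) by (simp add: S_def m_def)
  have "S e y = 0" if y: "y \<in> W" for y
  proof (rule ccontr)
    assume "S e y \<noteq> 0"
    have exp: "S (t *\<^sub>R e + y) (t *\<^sub>R e + y) = 2 * t * S e y + S y y" for t
    proof -
      have "S (t *\<^sub>R e + y) (t *\<^sub>R e + y) = t * t * S e e + t * S e y + t * S y e + S y y"
        using eW(1) y A by (simp add: S_def lin_on_add lin_on_scaleR algebra_simps)
      moreover have "S y e = S e y"
        using eW(1) y A(2) by (simp add: S_def selfadj sym[of y e] sym[of y "A e"])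
      ultimately show ?thesis using S0 by simp
    qed
    have "0 \<le> 2 * t * S e y + S y y" for t
      using le[of "t *\<^sub>R e + y"] eW(1) y unfolding exp[symmetric] by (simp add: S_def)
    \<comment> \<open>At this \<open>t\<close> the affine function
      \<open>2 * t * S e y + S y y\<close> takes the value -1.\<close>
    from this[of "- (S y y + 1) / (2 * S e y)"] show False
      using \<open>S e y \<noteq> 0\<close> by (simp add: field_simps)
  qed
  then have "Q (A e) z = Q (m *\<^sub>R e) z" if "z \<in> W" for z
    using that eW(1) by (simp add: S_def)
  then have "A e = m *\<^sub>R e"
    using eqI[of "A e" "m *\<^sub>R e"] eW(1) A(2) by simp
  then show ?thesis
    using that eW by blast
qed

end

lemma (in inner_space) Q_sum_left:
  "\<lbrakk>\<And>i. i \<in> I \<Longrightarrow> g i \<in> W; y \<in> W\<rbrakk> \<Longrightarrow> Q (\<Sum>i\<in>I. g i) y = (\<Sum>i\<in>I. Q (g i) y)"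
  using lin_on_sum[OF lin_left subspace_W] by blast

text \<open>Induction on the dimension: a normalised eigenvector \<open>e\<close> is split off, and
  self-adjointness makes \<open>A\<close> preserve the \<open>Q\<close>-orthogonal complement of
  \<open>e\<close>. That \<open>E\<close> spans \<open>W\<close> is expressed by the expansion
  formula, which is the form used later.\<close>

lemma spectral_theorem:
  assumes "inner_space W Q" "lin_on W A" "\<And>x. x \<in> W \<Longrightarrow> A x \<in> W"
    and "\<And>x y. x \<in> W \<Longrightarrow> y \<in> W \<Longrightarrow> Q (A x) y = Q x (A y)"
  shows "\<exists>E \<mu>. finite E \<and> E \<subseteq> W \<and> (\<forall>e\<in>E. \<forall>f\<in>E. Q e f = (if e = f then 1 else 0)) \<and>
    (\<forall>x\<in>W. (\<Sum>e\<in>E. Q x e *\<^sub>R e) = x) \<and> (\<forall>e\<in>E. A e = \<mu> e *\<^sub>R e)"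
  using assms
proof (induction "dim W" arbitrary: W rule: less_induct)
  case less
  interpret inner_space W Q by (rule less.prems)
  show ?case
  proof (cases "W = {0}")
    case True
    then show ?thesis by (intro exI[of _ "{}"]) auto
  next
    case False
    obtain e' m where e': "e' \<in> W" "e' \<noteq> 0" "A e' = m *\<^sub>R e'"
      using eigenvector_exists[OF less.prems(2-4) False] by blast
    define e where "e = (1 / sqrt (Q e' e')) *\<^sub>R e'"
    have e: "e \<in> W" "Q e e = 1" "A e = m *\<^sub>R e"
      using e' pos[of e'] lin_on_scaleR[OF less.prems(2)]
      by (auto simp: e_def real_sqrt_mult_self)
    define U where "U = {x \<in> W. Q x e = 0}"
    have subU: "subspace U"
      unfolding U_def using e(1) by (auto simp: subspace_def)
    have UW: "U \<subseteq> W" "e \<notin> U"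
      using e by (auto simp: U_def)
    have "dim U < dim W"
      by (rule dim_psubset) (use UW e(1) span_eq_iff subU subspace_W in blast)
    moreover have "lin_on U A"
      by (rule lin_on_subset[OF less.prems(2) UW(1)])
    moreover have "A x \<in> U" if "x \<in> U" for x
      using that e less.prems(3,4) by (simp add: U_def)
    moreover have "Q (A x) y = Q x (A y)" if "x \<in> U" "y \<in> U" for x y
      using that UW(1) less.prems(4) by blast
    ultimately have "\<exists>E \<mu>. finite E \<and> E \<subseteq> U \<and>
        (\<forall>e\<in>E. \<forall>f\<in>E. Q e f = (if e = f then 1 else 0)) \<and>
        (\<forall>x\<in>U. (\<Sum>e\<in>E. Q x e *\<^sub>R e) = x) \<and> (\<forall>e\<in>E. A e = \<mu> e *\<^sub>R e)"
      using less.hyps[of U] inner_space_subset[OF subU UW(1)] by blast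
    then obtain E \<mu> where E: "finite E" "E \<subseteq> U"
      and E': "\<forall>x\<in>E. \<forall>y\<in>E. Q x y = (if x = y then 1 else 0)"
      "\<forall>x\<in>U. (\<Sum>e\<in>E. Q x e *\<^sub>R e) = x" "\<forall>e\<in>E. A e = \<mu> e *\<^sub>R e"
      by (elim exE conjE) (rule that; assumption)
    have eE: "e \<notin> E" "\<And>x. x \<in> E \<Longrightarrow> Q x e = 0"
      using E(2) UW(2) by (auto simp: U_def)
    then have eE': "\<And>x. x \<in> E \<Longrightarrow> Q e x = 0"
      using E(2) UW(1) e(1) sym by (metis subsetD)
    have "(\<Sum>f\<in>insert e E. Q x f *\<^sub>R f) = x" if x: "x \<in> W" for x
    proof -
      define u where "u = x - Q x e *\<^sub>R e"
      have "u \<in> U"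
        using x e by (simp add: U_def u_def)
      have EW: "E \<subseteq> W"
        using E(2) UW(1) by blast
      have "u = (\<Sum>f\<in>E. Q u f *\<^sub>R f)"
        using E'(2) \<open>u \<in> U\<close> by (metis (no_types))
      also have "\<dots> = (\<Sum>f\<in>E. Q x f *\<^sub>R f)"
      proof (rule sum.cong[OF refl])
        fix f assume "f \<in> E"
        then show "Q u f *\<^sub>R f = Q x f *\<^sub>R f"
          using eE' x e(1) EW by (simp add: u_def subset_iff)
      qed
      finally show ?thesis
        using E(1) eE(1) by (simp add: u_def algebra_simps)
    qed
    moreover have "Q x y = (if x = y then 1 else 0)" if "x \<in> insert e E" "y \<in> insert e E" for x y
      using that E'(1) eE eE' e(2) by auto
    moreover have "A f = (\<mu>(e := m)) f *\<^sub>R f" if "f \<in> insert e E" for f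
      using that e(3) E'(3) eE(1) by auto
    moreover have "insert e E \<subseteq> W"
      using E(2) UW(1) e(1) by auto
    ultimately show ?thesis
      using E(1) by (intro exI[of _ "insert e E"] exI[of _ "\<mu>(e := m)"] conjI ballI) blast+
  qed
qed

context inner_space
begin

text \<open>This is the spectral theorem for the identity operator.\<close>

lemma orthonormal_basis:
  obtains E where "finite E" "E \<subseteq> W"
    "\<And>x y. x \<in> E \<Longrightarrow> y \<in> E \<Longrightarrow> Q x y = (if x = y then 1 else 0)"
    "\<And>x. x \<in> W \<Longrightarrow> (\<Sum>e\<in>E. Q x e *\<^sub>R e) = x"
proof -
  have "lin_on W (\<lambda>x. x)"
    by (simp add: lin_on_def)
  from spectral_theorem[OF inner_space_axioms this]
  have "\<exists>E. finite E \<and> E \<subseteq> W \<and> (\<forall>e\<in>E. \<forall>f\<in>E. Q e f = (if e = f then 1 else 0)) \<and>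
    (\<forall>x\<in>W. (\<Sum>e\<in>E. Q x e *\<^sub>R e) = x)"
    by blast
  then obtain E where "finite E" "E \<subseteq> W"
    "\<forall>x\<in>E. \<forall>y\<in>E. Q x y = (if x = y then 1 else 0)"
    "\<forall>x\<in>W. (\<Sum>e\<in>E. Q x e *\<^sub>R e) = x"
    by (elim exE conjE) (rule that; assumption)
  then show ?thesis
    using that by (metis (no_types))
qed

lemma riesz:
  assumes "lin_on W l"
  obtains y where "y \<in> W" "\<And>x. x \<in> W \<Longrightarrow> l x = Q y x"
proof -
  obtain E where E: "finite E" "E \<subseteq> W"
    "\<And>x y. x \<in> E \<Longrightarrow> y \<in> E \<Longrightarrow> Q x y = (if x = y then 1 else 0)"
    "\<And>x. x \<in> W \<Longrightarrow> (\<Sum>e\<in>E. Q x e *\<^sub>R e) = x"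
    using orthonormal_basis by blast
  define y where "y = (\<Sum>e\<in>E. l e *\<^sub>R e)"
  have y: "y \<in> W"
    unfolding y_def using E(2) by (intro subspace_sum subspace_W) auto
  have "l x = Q y x" if x: "x \<in> W" for x
  proof -
    have "l x = l (\<Sum>e\<in>E. Q x e *\<^sub>R e)"
      using E(4)[OF x] by simp
    also have "\<dots> = (\<Sum>e\<in>E. l (Q x e *\<^sub>R e))"
      by (rule lin_on_sum[OF assms subspace_W]) (use E(2) in auto)
    also have "\<dots> = (\<Sum>e\<in>E. Q (l e *\<^sub>R e) x)"
      using E(2) x sym[OF x] by (intro sum.cong) (auto simp: lin_on_scaleR[OF assms] subset_iff)
    also have "\<dots> = Q y x"
      unfolding y_def using E(2) x by (intro Q_sum_left[symmetric]) auto
    finally show ?thesis .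
  qed
  then show ?thesis using that y by blast
qed

text \<open>The functional \<open>Q x\<close> on \<open>S\<close> is represented by some
  \<open>y\<close> in \<open>S\<close>, the orthogonal projection of \<open>x\<close>; then
  \<open>x - y\<close> is orthogonal to \<open>S\<close> and so vanishes.\<close>

lemma subspace_eq_if_no_orthogonal:
  assumes "subspace S" "S \<subseteq> W" "\<And>y. y \<in> W \<Longrightarrow> (\<And>x. x \<in> S \<Longrightarrow> Q y x = 0) \<Longrightarrow> y = 0"
  shows "S = W"
proof -
  interpret S: inner_space S Q
    by (rule inner_space_subset) fact+
  have "x \<in> S" if x: "x \<in> W" for x
  proof -
    have "lin_on S (Q x)"
      using lin_on_subset[OF lin_right assms(2)] x by blast
    then obtain y where y: "y \<in> S" "\<And>z. z \<in> S \<Longrightarrow> Q x z = Q y z"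
      using S.riesz by blast
    then have "x - y = 0"
      using assms(2) x by (intro assms(3)) (auto simp: subset_iff)
    then show ?thesis using y by simp
  qed
  then show ?thesis using assms(2) by auto
qed

end

section \<open>Invariant inner products of bounded groups\<close>

lemma bilin_on_basis_expansion:
  assumes "bilin_on V R" "subspace V" "finite B" "B \<subseteq> V"
    and "x = (\<Sum>b\<in>B. f b *\<^sub>R b)" "y = (\<Sum>b\<in>B. g b *\<^sub>R b)"
  shows "R x y = (\<Sum>b\<in>B. \<Sum>c\<in>B. f b * g c * (R b c :: real))"
proof -
  have yV: "y \<in> V"
    unfolding assms(6) using assms(2,4) by (intro subspace_sum subspace_scale) auto
  have "R x y = (\<Sum>b\<in>B. R (f b *\<^sub>R b) y)"
    unfolding assms(5) using assms(2,4)
    by (intro lin_on_sum[OF bilin_on_left[OF assms(1) yV] assms(2)]) (auto intro: subspace_scale)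
  also have "\<dots> = (\<Sum>b\<in>B. f b * (\<Sum>c\<in>B. R b (g c *\<^sub>R c)))"
  proof (rule sum.cong[OF refl])
    fix b assume "b \<in> B"
    then have b: "b \<in> V" using assms(4) by blast
    have "R (f b *\<^sub>R b) y = f b * R b y"
      using lin_on_scaleR[OF bilin_on_left[OF assms(1) yV] b] by simp
    also have "R b y = (\<Sum>c\<in>B. R b (g c *\<^sub>R c))"
      unfolding assms(6) using assms(2,4)
      by (intro lin_on_sum[OF bilin_on_right[OF assms(1) b] assms(2)]) (auto intro: subspace_scale)
    finally show "R (f b *\<^sub>R b) y = f b * (\<Sum>c\<in>B. R b (g c *\<^sub>R c))" .
  qed
  also have "\<dots> = (\<Sum>b\<in>B. \<Sum>c\<in>B. f b * g c * R b c)"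
    unfolding sum_distrib_left
  proof (intro sum.cong[OF refl])
    fix b c assume "b \<in> B" "c \<in> B"
    then have "b \<in> V" "c \<in> V" using assms(4) by auto
    then show "f b * R b (g c *\<^sub>R c) = f b * g c * R b c"
      using lin_on_scaleR[OF bilin_on_right[OF assms(1)]] by simp
  qed
  finally show ?thesis .
qed

text \<open>The forms \<open>R\<close> whose translates under the group are bounded below by \<open>|x|^2 / M^2\<close> form an
  invariant convex set. On it, the supremum over the group of the squared Hilbert-Schmidt norms of
  the translates of \<open>R\<close> is invariant; by the parallelogram identity it has exactly one minimum
  point, which is therefore invariant too.\<close>

locale bounded_linear_group =
  fixes V :: "'a::euclidean_space set" and \<Gamma> :: "('a \<Rightarrow> 'a) set"
  assumes subspace_V: "subspace V"
    and nonempty: "\<Gamma> \<noteq> {}"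
    and lin: "k \<in> \<Gamma> \<Longrightarrow> lin_on V k"
    and closed: "\<lbrakk>k \<in> \<Gamma>; x \<in> V\<rbrakk> \<Longrightarrow> k x \<in> V"
    and bdd: "x \<in> V \<Longrightarrow> bounded ((\<lambda>k. k x) ` \<Gamma>)"
    and comp: "\<lbrakk>e \<in> \<Gamma>; k \<in> \<Gamma>\<rbrakk> \<Longrightarrow> \<exists>m\<in>\<Gamma>. \<forall>x\<in>V. m x = e (k x)"
    and inv: "k \<in> \<Gamma> \<Longrightarrow> \<exists>l\<in>\<Gamma>. \<forall>x\<in>V. l (k x) = x \<and> k (l x) = x"
begin

definition basis :: "'a set" where
  "basis = (SOME B. B \<subseteq> V \<and> finite B \<and> (\<forall>b\<in>B. norm b = 1) \<and>
    (\<forall>x\<in>V. (\<Sum>b\<in>B. (x \<bullet> b) *\<^sub>R b) = x))"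

lemma basis: "basis \<subseteq> V" "finite basis" "\<And>b. b \<in> basis \<Longrightarrow> norm b = 1"
  "\<And>x. x \<in> V \<Longrightarrow> (\<Sum>b\<in>basis. (x \<bullet> b) *\<^sub>R b) = x"
proof -
  interpret inner_space V "(\<bullet>)"
    by unfold_locales
      (auto simp: subspace_V bilin_on_def lin_on_def inner_commute inner_right_distrib
        inner_left_distrib)
  obtain E where E: "finite E" "E \<subseteq> V" "\<And>x y. x \<in> E \<Longrightarrow> y \<in> E \<Longrightarrow> x \<bullet> y = (if x = y then 1 else 0)"
    "\<And>x. x \<in> V \<Longrightarrow> (\<Sum>e\<in>E. (x \<bullet> e) *\<^sub>R e) = x"
    using orthonormal_basis by blast
  then have "E \<subseteq> V \<and> finite E \<and> (\<forall>b\<in>E. norm b = 1) \<and> (\<forall>x\<in>V. (\<Sum>b\<in>E. (x \<bullet> b) *\<^sub>R b) = x)"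
    by (auto simp: norm_eq_1)
  from someI[of "\<lambda>B. B \<subseteq> V \<and> finite B \<and> (\<forall>b\<in>B. norm b = 1) \<and>
    (\<forall>x\<in>V. (\<Sum>b\<in>B. (x \<bullet> b) *\<^sub>R b) = x)", OF this]
  have *: "basis \<subseteq> V \<and> finite basis \<and> (\<forall>b\<in>basis. norm b = 1) \<and>
    (\<forall>x\<in>V. (\<Sum>b\<in>basis. (x \<bullet> b) *\<^sub>R b) = x)"
    unfolding basis_def .
  show "basis \<subseteq> V" "finite basis" "\<And>b. b \<in> basis \<Longrightarrow> norm b = 1"
    "\<And>x. x \<in> V \<Longrightarrow> (\<Sum>b\<in>basis. (x \<bullet> b) *\<^sub>R b) = x"
    using * by auto
qed

lemma basis_in: "b \<in> basis \<Longrightarrow> b \<in> V"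
  using basis(1) by blast

text \<open>Uniform boundedness in finite dimension: the orbits of the finitely many basis vectors
  are bounded, the coordinates of \<open>x\<close> are at most \<open>norm x\<close>, and so the sum
  of these bounds serves all group elements at once.\<close>

lemma norm_bound: "\<exists>M. M \<ge> 0 \<and> (\<forall>k\<in>\<Gamma>. \<forall>x\<in>V. norm (k x) \<le> M * norm x)"
proof -
  have "\<forall>b\<in>basis. \<exists>M. \<forall>k\<in>\<Gamma>. norm (k b) \<le> M"
    using bdd[OF basis_in] unfolding bounded_iff by auto
  then obtain m where m: "\<And>b k. b \<in> basis \<Longrightarrow> k \<in> \<Gamma> \<Longrightarrow> norm (k b) \<le> m b"
    by metis
  obtain k0 where "k0 \<in> \<Gamma>" using nonempty by blast
  have m0: "m b \<ge> 0" if "b \<in> basis" for b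
    using m[OF that \<open>k0 \<in> \<Gamma>\<close>] norm_ge_zero order_trans by blast
  have "norm (k x) \<le> (\<Sum>b\<in>basis. m b) * norm x" if k: "k \<in> \<Gamma>" and x: "x \<in> V" for k x
  proof -
    have "k x = k (\<Sum>b\<in>basis. (x \<bullet> b) *\<^sub>R b)"
      using basis(4)[OF x] by simp
    also have "\<dots> = (\<Sum>b\<in>basis. (x \<bullet> b) *\<^sub>R k b)"
      using lin_on_sum[OF lin[OF k] subspace_V, of basis "\<lambda>b. (x \<bullet> b) *\<^sub>R b"] basis_in
      by (simp add: subspace_scale[OF subspace_V] lin_on_scaleR[OF lin[OF k]])
    also have "norm \<dots> \<le> (\<Sum>b\<in>basis. m b * norm x)"
    proof (rule sum_norm_le)
      fix b assume b: "b \<in> basis"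
      have "\<bar>x \<bullet> b\<bar> \<le> norm x"
        using Cauchy_Schwarz_ineq2[of x b] basis(3)[OF b] by simp
      then have "\<bar>x \<bullet> b\<bar> * norm (k b) \<le> norm x * m b"
        using m[OF b k] by (intro mult_mono) auto
      then show "norm ((x \<bullet> b) *\<^sub>R k b) \<le> m b * norm x"
        by (simp add: mult.commute)
    qed
    finally show ?thesis by (simp add: sum_distrib_right)
  qed
  then show ?thesis
    using m0 by (intro exI[of _ "\<Sum>b\<in>basis. m b"]) (auto intro: sum_nonneg)
qed

definition M :: real where
  "M = (SOME M. M \<ge> 0 \<and> (\<forall>k\<in>\<Gamma>. \<forall>x\<in>V. norm (k x) \<le> M * norm x))"

lemma M: "M \<ge> 0" "\<lbrakk>k \<in> \<Gamma>; x \<in> V\<rbrakk> \<Longrightarrow> norm (k x) \<le> M * norm x"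
  using someI_ex[OF norm_bound] unfolding M_def by auto

definition hs :: "('a \<Rightarrow> 'a \<Rightarrow> real) \<Rightarrow> real" where
  "hs R = (\<Sum>(b, c)\<in>basis \<times> basis. (R b c)\<^sup>2)"

definition pull :: "('a \<Rightarrow> 'a) \<Rightarrow> ('a \<Rightarrow> 'a \<Rightarrow> real) \<Rightarrow> 'a \<Rightarrow> 'a \<Rightarrow> real" where
  "pull k R x y = R (k x) (k y)"

lemma hs_nonneg: "hs R \<ge> 0"
  by (auto simp: hs_def intro: sum_nonneg)

lemma hs_cong: "(\<And>x y. x \<in> V \<Longrightarrow> y \<in> V \<Longrightarrow> R x y = S x y) \<Longrightarrow> hs R = hs S"
  unfolding hs_def using basis_in by (intro sum.cong) auto

lemma sum_inner_le: "x \<in> V \<Longrightarrow> (\<Sum>b\<in>basis. (x \<bullet> b)\<^sup>2) = (norm x)\<^sup>2"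
proof -
  assume x: "x \<in> V"
  have "(norm x)\<^sup>2 = x \<bullet> (\<Sum>b\<in>basis. (x \<bullet> b) *\<^sub>R b)"
    by (simp only: basis(4)[OF x] power2_norm_eq_inner)
  then show ?thesis
    by (simp add: inner_sum_right power2_eq_square)
qed

text \<open>Cauchy-Schwarz for the double basis expansion of \<open>R x y\<close>. It turns
  estimates of \<open>hs\<close> into estimates of values, both for convergence and for concluding
  that a form with \<open>hs\<close> equal to 0 vanishes.\<close>

lemma form_le_hs:
  assumes "bilin_on V R" "x \<in> V" "y \<in> V"
  shows "(R x y)\<^sup>2 \<le> (norm x)\<^sup>2 * (norm y)\<^sup>2 * hs R"
proof -
  have "R x y = (\<Sum>b\<in>basis. \<Sum>c\<in>basis. (x \<bullet> b) * (y \<bullet> c) * R b c)"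
    by (rule bilin_on_basis_expansion[OF assms(1) subspace_V basis(2,1)])
      (simp_all add: basis(4) assms)
  also have "\<dots> = (\<Sum>p\<in>basis \<times> basis. ((x \<bullet> fst p) * (y \<bullet> snd p)) * R (fst p) (snd p))"
    by (simp add: sum.cartesian_product case_prod_beta)
  finally have "(R x y)\<^sup>2 \<le> (\<Sum>p\<in>basis \<times> basis. ((x \<bullet> fst p) * (y \<bullet> snd p))\<^sup>2) * hs R"
    using Cauchy_Schwarz_ineq_sum unfolding hs_def case_prod_beta by simp
  also have "(\<Sum>p\<in>basis \<times> basis. ((x \<bullet> fst p) * (y \<bullet> snd p))\<^sup>2)
      = (\<Sum>b\<in>basis. \<Sum>c\<in>basis. (x \<bullet> b)\<^sup>2 * (y \<bullet> c)\<^sup>2)"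
    by (simp add: sum.cartesian_product case_prod_beta power_mult_distrib)
  also have "\<dots> = (norm x)\<^sup>2 * (norm y)\<^sup>2"
    by (simp add: sum_inner_le[OF assms(2), symmetric] sum_inner_le[OF assms(3), symmetric] sum_product)
  finally show ?thesis .
qed

lemma bilin_pull: "bilin_on V R \<Longrightarrow> k \<in> \<Gamma> \<Longrightarrow> bilin_on V (pull k R)"
  using lin[of k] closed[of k] unfolding bilin_on_def lin_on_def pull_def by simp

text \<open>The constant by which a group element can distort \<open>hs\<close>: each of the squared
  entries grows by at most \<open>M ^ 4\<close>, one factor \<open>M\<^sup>2\<close> for each
  argument.\<close>

definition D :: real where "D = real (card (basis \<times> basis)) * M ^ 4"

lemma D_nonneg: "D \<ge> 0"
  by (simp add: D_def M)

lemma hs_pull_le: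
  assumes R: "bilin_on V R" and k: "k \<in> \<Gamma>"
  shows "hs (pull k R) \<le> D * hs R"
proof -
  have "hs (pull k R) \<le> (\<Sum>p\<in>basis \<times> basis. M ^ 4 * hs R)"
    unfolding hs_def[of "pull k R"]
  proof (rule sum_mono)
    fix p assume "p \<in> basis \<times> basis"
    then obtain b c where p: "p = (b, c)" "b \<in> basis" "c \<in> basis" by auto
    have bc: "norm (k b) \<le> M" "norm (k c) \<le> M"
      using M(2)[OF k] p basis_in basis(3) by force+
    have "(norm (k b))\<^sup>2 * (norm (k c))\<^sup>2 \<le> M\<^sup>2 * M\<^sup>2"
      using bc by (intro mult_mono power_mono) auto
    then have "(R (k b) (k c))\<^sup>2 \<le> (M\<^sup>2 * M\<^sup>2) * hs R"
      using form_le_hs[OF R closed[OF k basis_in[OF p(2)]] closed[OF k basis_in[OF p(3)]]]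
        hs_nonneg[of R] by (meson mult_right_mono order_trans)
    then show "(case p of (b, c) \<Rightarrow> (pull k R b c)\<^sup>2) \<le> M ^ 4 * hs R"
      by (simp add: p pull_def flip: power_add)
  qed
  then show ?thesis
    by (simp add: D_def)
qed

text \<open>The upper bound \<open>hs_pull_le\<close>, applied to the inverse of
  \<open>k\<close>.\<close>

lemma hs_le_pull:
  assumes R: "bilin_on V R" and k: "k \<in> \<Gamma>"
  shows "hs R \<le> D * hs (pull k R)"
proof -
  obtain l where l: "l \<in> \<Gamma>" "\<And>x. x \<in> V \<Longrightarrow> k (l x) = x"
    using inv[OF k] by blast
  have "hs R = hs (pull l (pull k R))"
    using l by (intro hs_cong) (simp add: pull_def)
  then show ?thesis
    using hs_pull_le[OF bilin_pull[OF R k] l(1)] by simp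
qed

text \<open>The lower bound is uniform over the group and closed under pointwise limits, so a limit
  of such forms cannot lose definiteness. It is multiplied out because \<open>M\<close> may be 0
  when the carrier is trivial.\<close>

definition forms :: "('a \<Rightarrow> 'a \<Rightarrow> real) set" where
  "forms = {R. bilin_on V R \<and> (\<forall>x\<in>V. \<forall>y\<in>V. R x y = R y x) \<and>
    (\<forall>k\<in>\<Gamma>. \<forall>x\<in>V. (norm x)\<^sup>2 \<le> M\<^sup>2 * R (k x) (k x))}"

definition height :: "('a \<Rightarrow> 'a \<Rightarrow> real) \<Rightarrow> real" where
  "height R = (SUP k\<in>\<Gamma>. hs (pull k R))"

lemma bdd_height: "bilin_on V R \<Longrightarrow> bdd_above ((\<lambda>k. hs (pull k R)) ` \<Gamma>)"
  using hs_pull_le unfolding bdd_above_def by blast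

lemma hs_le_height: "bilin_on V R \<Longrightarrow> k \<in> \<Gamma> \<Longrightarrow> hs (pull k R) \<le> height R"
  unfolding height_def by (intro cSUP_upper bdd_height)

lemma height_leI: "(\<And>k. k \<in> \<Gamma> \<Longrightarrow> hs (pull k R) \<le> c) \<Longrightarrow> height R \<le> c"
  unfolding height_def by (intro cSUP_least nonempty)

lemma height_nonneg: "bilin_on V R \<Longrightarrow> height R \<ge> 0"
  using nonempty hs_le_height hs_nonneg order_trans by blast

lemma formsD: "R \<in> forms \<Longrightarrow> bilin_on V R"
  by (simp add: forms_def)

text \<open>The translates of \<open>pull e R\<close> are translates of \<open>R\<close> by products
  \<open>e (k x)\<close>, so the bounds and the supremum for \<open>R\<close> cover them.\<close>

lemma pull_forms:
  assumes R: "R \<in> forms" and e: "e \<in> \<Gamma>"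
  shows "pull e R \<in> forms" "height (pull e R) \<le> height R"
proof -
  have "(norm x)\<^sup>2 \<le> M\<^sup>2 * pull e R (k x) (k x)" if k: "k \<in> \<Gamma>" and x: "x \<in> V" for k x
  proof -
    obtain m where "m \<in> \<Gamma>" "\<And>x. x \<in> V \<Longrightarrow> m x = e (k x)"
      using comp[OF e k] by blast
    then have "pull e R (k x) (k x) = R (m x) (m x)"
      using x by (simp add: pull_def)
    then show ?thesis
      using R \<open>m \<in> \<Gamma>\<close> x by (simp add: forms_def)
  qed
  then show "pull e R \<in> forms"
    using R bilin_pull[OF formsD[OF R] e] closed[OF e] by (simp add: forms_def) (simp add: pull_def)
  show "height (pull e R) \<le> height R"
  proof (rule height_leI)
    fix k assume k: "k \<in> \<Gamma>"
    obtain m where m: "m \<in> \<Gamma>" "\<And>x. x \<in> V \<Longrightarrow> m x = e (k x)"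
      using comp[OF e k] by blast
    then have "hs (pull k (pull e R)) = hs (pull m R)"
      by (intro hs_cong) (simp add: pull_def)
    then show "hs (pull k (pull e R)) \<le> height R"
      using hs_le_height[OF formsD[OF R] m(1)] by simp
  qed
qed

definition least_height :: real where "least_height = (INF R\<in>forms. height R)"

lemma least_height_le: "R \<in> forms \<Longrightarrow> least_height \<le> height R"
  unfolding least_height_def
  by (intro cINF_lower bdd_belowI[of _ 0]) (auto simp: height_nonneg formsD)

lemma forms_nonempty: "forms \<noteq> {}"
proof -
  have "(norm x)\<^sup>2 \<le> M\<^sup>2 * (k x \<bullet> k x)" if k: "k \<in> \<Gamma>" and x: "x \<in> V" for k x
  proof -
    obtain l where l: "l \<in> \<Gamma>" "l (k x) = x"
      using inv[OF k] x by blast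
    \<comment> \<open>The upper bound \<open>M\<close> for the inverse \<open>l\<close> is a lower
      bound for \<open>k\<close>; this explains the constant in \<open>forms\<close>.\<close>
    then have "norm x \<le> M * norm (k x)"
      using M(2)[OF l(1) closed[OF k x]] by simp
    then have "(norm x)\<^sup>2 \<le> (M * norm (k x))\<^sup>2"
      by (intro power_mono) auto
    then show ?thesis
      by (simp add: power_mult_distrib power2_norm_eq_inner)
  qed
  then have "(\<bullet>) \<in> forms"
    by (auto simp: forms_def bilin_on_def lin_on_def inner_commute inner_right_distrib
        inner_left_distrib)
  then show ?thesis by blast
qed

lemma forms_midpoint:
  assumes P: "P \<in> forms" and R: "R \<in> forms"
  shows "(\<lambda>x y. (P x y + R x y) / 2) \<in> forms"
proof -
  have "bilin_on V (\<lambda>x y. (P x y + R x y) / 2)"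
    using formsD[OF P] formsD[OF R] unfolding bilin_on_def lin_on_def by (simp add: algebra_simps add_divide_distrib)
  moreover have "(norm x)\<^sup>2 \<le> M\<^sup>2 * ((P (k x) (k x) + R (k x) (k x)) / 2)"
    if "k \<in> \<Gamma>" "x \<in> V" for k x
  proof -
    have "(norm x)\<^sup>2 \<le> M\<^sup>2 * P (k x) (k x)" "(norm x)\<^sup>2 \<le> M\<^sup>2 * R (k x) (k x)"
      using P R that by (auto simp: forms_def)
    then show ?thesis by (simp add: algebra_simps)
  qed
  ultimately show ?thesis
    using P R by (auto simp: forms_def)
qed

lemma hs_parallelogram:
  "hs (\<lambda>x y. P x y - R x y) + 4 * hs (\<lambda>x y. (P x y + R x y) / 2) = 2 * hs P + 2 * hs R"
  unfolding hs_def sum_distrib_left sum.distrib[symmetric]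
  by (intro sum.cong) (auto simp: power2_eq_square field_simps)

text \<open>Quantitative uniqueness of the minimum: two forms of nearly least height are close to
  each other. The parallelogram identity holds after translation by each \<open>k\<close>, the
  height of the midpoint is at least \<open>least_height\<close>, and the factor \<open>D\<close>
  leads back from the translated difference to the difference itself.\<close>

lemma forms_distance:
  assumes P: "P \<in> forms" and R: "R \<in> forms"
  shows "hs (\<lambda>x y. P x y - R x y) \<le> D * (2 * height P + 2 * height R - 4 * least_height)"
proof -
  let ?S = "\<lambda>x y. P x y - R x y" and ?T = "\<lambda>x y. (P x y + R x y) / 2"
  have S: "bilin_on V ?S"
    using formsD[OF P] formsD[OF R] unfolding bilin_on_def lin_on_def by (simp add: algebra_simps)
  obtain k0 where k0: "k0 \<in> \<Gamma>" using nonempty by blast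
  have key: "hs ?S + 4 * (D * hs (pull k ?T)) \<le> D * (2 * height P + 2 * height R)"
    if k: "k \<in> \<Gamma>" for k
  proof -
    have "hs ?S \<le> D * hs (pull k ?S)"
      by (rule hs_le_pull[OF S k])
    moreover have "hs (pull k ?S) + 4 * hs (pull k ?T) = 2 * hs (pull k P) + 2 * hs (pull k R)"
      using hs_parallelogram[of "pull k P" "pull k R"] by (simp add: pull_def[abs_def])
    moreover have "hs (pull k P) \<le> height P" "hs (pull k R) \<le> height R"
      using hs_le_height k formsD P R by blast+
    ultimately have "hs (pull k ?S) + 4 * hs (pull k ?T) \<le> 2 * height P + 2 * height R"
      "hs ?S \<le> D * hs (pull k ?S)"
      by linarith+
    moreover from this(1) have "D * (hs (pull k ?S) + 4 * hs (pull k ?T))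
        \<le> D * (2 * height P + 2 * height R)"
      using D_nonneg by (rule mult_left_mono)
    moreover have "D * (hs (pull k ?S) + 4 * hs (pull k ?T))
        = D * hs (pull k ?S) + 4 * (D * hs (pull k ?T))"
      by (simp add: algebra_simps)
    ultimately show ?thesis by linarith
  qed
  show ?thesis
  \<comment> \<open>The general case divides by \<open>4 * D\<close>; for \<open>D = 0\<close> the
    estimate \<open>key\<close> already says that \<open>hs ?S\<close> is at most 0.\<close>
  proof (cases "D = 0")
    case True
    then show ?thesis using key[OF k0] by simp
  next
    case False
    then have "D > 0" using D_nonneg by simp
    have "hs (pull k ?T) \<le> (D * (2 * height P + 2 * height R) - hs ?S) / (4 * D)"
      if k: "k \<in> \<Gamma>" for k
      using key[OF k] \<open>D > 0\<close> by (simp add: pos_le_divide_eq algebra_simps)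
    then have "height ?T \<le> (D * (2 * height P + 2 * height R) - hs ?S) / (4 * D)"
      by (rule height_leI)
    then have "least_height \<le> (D * (2 * height P + 2 * height R) - hs ?S) / (4 * D)"
      using least_height_le[OF forms_midpoint[OF P R]] by simp
    then show ?thesis
      using \<open>D > 0\<close> by (simp add: pos_le_divide_eq algebra_simps)
  qed
qed

text \<open>By \<open>forms_distance\<close> a minimising sequence is Cauchy in every value. The
  conditions defining \<open>forms\<close> and the bound on each \<open>hs (pull k _)\<close> pass
  to the pointwise limit.\<close>

lemma minimal_form_exists: "\<exists>Q\<in>forms. height Q \<le> least_height"
proof -
  have "\<exists>R\<in>forms. height R < least_height + 1 / real (Suc n)" for n
    using cINF_less_iff[OF forms_nonempty, of height "least_height + 1 / real (Suc n)"]
      bdd_belowI[of "height ` forms" 0] height_nonneg formsD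
    unfolding least_height_def[symmetric] by force
  then obtain R where R: "\<And>n. R n \<in> forms" "\<And>n. height (R n) < least_height + 1 / real (Suc n)"
    by metis
  have hsR: "hs (\<lambda>x y. R m x y - R n x y) \<le> D * (4 / real (Suc N))" if "m \<ge> N" "n \<ge> N" for m n N
  proof -
    have "1 / real (Suc m) \<le> 1 / real (Suc N)" "1 / real (Suc n) \<le> 1 / real (Suc N)"
      using that by (auto intro!: divide_left_mono)
    then have "2 * height (R m) + 2 * height (R n) - 4 * least_height \<le> 4 / real (Suc N)"
      using R(2)[of m] R(2)[of n] by simp
    then show ?thesis
      using forms_distance[OF R(1) R(1), of m n] D_nonneg by (meson mult_left_mono order_trans)
  qed
  have conv: "convergent (\<lambda>n. R n x y)" if x: "x \<in> V" and y: "y \<in> V" for x y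
  proof -
    \<comment> \<open>Product of the constants in \<open>form_le_hs\<close> and in
      \<open>hsR\<close>, so that the squared difference is at most
      \<open>c / real (Suc N)\<close>.\<close>
    define c where "c = (norm x)\<^sup>2 * (norm y)\<^sup>2 * (D * 4)"
    have c: "c \<ge> 0"
      using D_nonneg by (simp add: c_def)
    have "Cauchy (\<lambda>n. R n x y)"
    proof (rule metric_CauchyI)
      fix \<epsilon> :: real assume "\<epsilon> > 0"
      obtain N where N: "c / \<epsilon>\<^sup>2 < real N"
        using reals_Archimedean2 by blast
      have "dist (R m x y) (R n x y) < \<epsilon>" if mn: "m \<ge> N" "n \<ge> N" for m n
      proof -
        have "bilin_on V (\<lambda>x y. R m x y - R n x y)"
          using formsD[OF R(1)[of m]] formsD[OF R(1)[of n]] unfolding bilin_on_def lin_on_def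
          by (simp add: algebra_simps)
        from form_le_hs[OF this x y]
        have "(R m x y - R n x y)\<^sup>2 \<le> (norm x)\<^sup>2 * (norm y)\<^sup>2 * (D * (4 / real (Suc N)))"
          using hsR[OF mn] by (meson mult_left_mono order_trans zero_le_mult_iff zero_le_power2)
        also have "\<dots> = c / real (Suc N)"
          by (simp add: c_def)
        also have "\<dots> < \<epsilon>\<^sup>2"
        proof -
          have "c < \<epsilon>\<^sup>2 * real N"
            using N \<open>\<epsilon> > 0\<close> by (simp add: pos_divide_less_eq mult.commute)
          also have "\<dots> \<le> \<epsilon>\<^sup>2 * real (Suc N)"
            by (intro mult_left_mono) auto
          finally show ?thesis
            by (simp add: pos_divide_less_eq)
        qed
        finally have "\<bar>R m x y - R n x y\<bar> < \<epsilon>"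
          using \<open>\<epsilon> > 0\<close> by (metis abs_le_square_iff abs_of_pos linorder_not_less)
        then show ?thesis by (simp add: dist_real_def)
      qed
      then show "\<exists>N. \<forall>m\<ge>N. \<forall>n\<ge>N. dist (R m x y) (R n x y) < \<epsilon>" by blast
    qed
    then show ?thesis by (simp add: Cauchy_convergent_iff)
  qed
  define Q where "Q x y = lim (\<lambda>n. R n x y)" for x y
  have lim: "(\<lambda>n. R n x y) \<longlonglongrightarrow> Q x y" if "x \<in> V" "y \<in> V" for x y
    using conv[OF that] unfolding Q_def convergent_LIMSEQ_iff .
  have add: "Q (x + y) z = Q x z + Q y z" if "x \<in> V" "y \<in> V" "z \<in> V" for x y z
  proof (rule LIMSEQ_unique[OF lim])
    have "R n (x + y) z = R n x z + R n y z" for n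
      using lin_on_add[OF bilin_on_left[OF formsD[OF R(1)]]] that by blast
    then show "(\<lambda>n. R n (x + y) z) \<longlonglongrightarrow> Q x z + Q y z"
      using tendsto_add[OF lim lim, of x z y z] that by simp
  qed (use that in \<open>auto intro: subspace_add[OF subspace_V]\<close>)
  have scale: "Q (c *\<^sub>R x) z = c * Q x z" if "x \<in> V" "z \<in> V" for c x z
  proof (rule LIMSEQ_unique[OF lim])
    have "R n (c *\<^sub>R x) z = c * R n x z" for n
      using lin_on_scaleR[OF bilin_on_left[OF formsD[OF R(1)]]] that by fastforce
    then show "(\<lambda>n. R n (c *\<^sub>R x) z) \<longlonglongrightarrow> c * Q x z"
      using tendsto_mult_left[OF lim, of x z c] that by simp
  qed (use that in \<open>auto intro: subspace_scale[OF subspace_V]\<close>)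
  have symQ: "Q x y = Q y x" if "x \<in> V" "y \<in> V" for x y
  proof (rule LIMSEQ_unique[OF lim])
    have "R n x y = R n y x" for n
      using R(1)[of n] that by (simp add: forms_def)
    then show "(\<lambda>n. R n x y) \<longlonglongrightarrow> Q y x"
      using lim[of y x] that by simp
  qed (use that in auto)
  have bil: "bilin_on V Q"
    unfolding bilin_on_def lin_on_def
    using add scale symQ
    by (auto simp: subspace_add[OF subspace_V] subspace_scale[OF subspace_V])
  have "(norm x)\<^sup>2 \<le> M\<^sup>2 * Q (k x) (k x)" if "k \<in> \<Gamma>" "x \<in> V" for k x
  proof (rule LIMSEQ_le_const[OF tendsto_mult_left[OF lim]])
    show "\<exists>N. \<forall>n\<ge>N. (norm x)\<^sup>2 \<le> M\<^sup>2 * R n (k x) (k x)"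
      using R(1) that by (auto simp: forms_def)
  qed (use that closed in auto)
  then have "Q \<in> forms"
    using bil symQ by (simp add: forms_def)
  moreover have "height Q \<le> least_height"
  proof (rule height_leI)
    fix k assume k: "k \<in> \<Gamma>"
    have "(\<lambda>n. hs (pull k (R n))) \<longlonglongrightarrow> hs (pull k Q)"
      unfolding hs_def pull_def
      by (auto intro!: tendsto_sum tendsto_power lim closed[OF k] intro: basis_in simp: case_prod_beta)
    moreover have "(\<lambda>n. least_height + 1 / real (Suc n)) \<longlonglongrightarrow> least_height + 0"
      by (intro tendsto_add tendsto_const LIMSEQ_Suc[OF lim_1_over_n])
    moreover have "hs (pull k (R n)) \<le> least_height + 1 / real (Suc n)" for n
      using hs_le_height[OF formsD[OF R(1)] k, of n] R(2)[of n] by simp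
    ultimately show "hs (pull k Q) \<le> least_height"
      by (metis (no_types, lifting) LIMSEQ_le add.right_neutral)
  qed
  ultimately show ?thesis by blast
qed

text \<open>A minimiser \<open>Q\<close> and its translate \<open>pull k Q\<close> both have least
  height, so \<open>forms_distance\<close> bounds the \<open>hs\<close> of their difference by
  0.\<close>

theorem invariant_inner_space:
  obtains Q where "inner_space V Q"
    "\<And>k x y. \<lbrakk>k \<in> \<Gamma>; x \<in> V; y \<in> V\<rbrakk> \<Longrightarrow> Q (k x) (k y) = Q x y"
proof -
  obtain Q where Q: "Q \<in> forms" "height Q \<le> least_height"
    using minimal_form_exists by blast
  have "Q (k x) (k y) = Q x y" if k: "k \<in> \<Gamma>" and x: "x \<in> V" and y: "y \<in> V" for k x y
  proof -
    let ?S = "\<lambda>x y. pull k Q x y - Q x y"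
    have S: "bilin_on V ?S"
      using formsD[OF Q(1)] bilin_pull[OF formsD[OF Q(1)] k] unfolding bilin_on_def lin_on_def
      by (simp add: algebra_simps)
    have "2 * height (pull k Q) + 2 * height Q - 4 * least_height \<le> 0"
      using pull_forms(2)[OF Q(1) k] Q(2) by simp
    then have "hs ?S \<le> 0"
      using forms_distance[OF pull_forms(1)[OF Q(1) k] Q(1)] D_nonneg
      by (meson mult_nonneg_nonpos order_trans)
    then have "(?S x y)\<^sup>2 \<le> 0"
      using form_le_hs[OF S x y] hs_nonneg[of ?S] by simp
    then show ?thesis by (simp add: pull_def)
  qed
  moreover
  have "Q x x > 0" if x: "x \<in> V" "x \<noteq> 0" for x
  proof -
    obtain k where k: "k \<in> \<Gamma>" using nonempty by blast
    \<comment> \<open>The lower bound in \<open>forms\<close> is evaluated at \<open>l x\<close>,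
      which makes it a statement about \<open>Q x x\<close>.\<close>
    obtain l where l: "l \<in> \<Gamma>" "k (l x) = x"
      using inv[OF k] x by blast
    have "l x \<noteq> 0"
      using l(2) lin_on_zero[OF lin[OF k] subspace_V] x(2) by auto
    moreover have "(norm (l x))\<^sup>2 \<le> M\<^sup>2 * Q x x"
    proof -
      have "\<forall>x\<in>V. (norm x)\<^sup>2 \<le> M\<^sup>2 * Q (k x) (k x)"
        using Q(1) k by (simp add: forms_def)
      from bspec[OF this closed[OF l(1) x(1)]] show ?thesis
        by (simp add: l(2))
    qed
    ultimately have "0 < M\<^sup>2 * Q x x"
      by (smt (verit) zero_less_norm_iff zero_less_power)
    then show ?thesis
      by (simp add: zero_less_mult_iff)
  qed
  then have "inner_space V Q"
    using Q(1) by unfold_locales (simp_all add: forms_def subspace_V)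
  ultimately show ?thesis
    using that by blast
qed

end

section \<open>Compactly embedded subalgebras\<close>

text \<open>The one-parameter group \<open>exp (t D)\<close>. For a globally linear \<open>D\<close>
  it can be differentiated in \<open>t\<close>, and on the carrier it agrees with
  \<open>exp_ad\<close>.\<close>

definition flow :: "('a::euclidean_space \<Rightarrow> 'a) \<Rightarrow> real \<Rightarrow> 'a \<Rightarrow> 'a" where
  "flow D t y = (\<Sum>n. (t ^ n / fact n) *\<^sub>R (D ^^ n) y)"

context
  fixes D :: "'a::euclidean_space \<Rightarrow> 'a"
  assumes linear_D: "linear D"
begin

lemma linear_funpow: "linear (D ^^ n)"
  by (induction n) (use linear_D linear_id linear_compose in \<open>auto simp: o_def id_def\<close>)

lemma funpow_norm_bound: "\<exists>K. \<forall>n y. norm ((D ^^ n) y) \<le> K ^ n * norm y"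
proof -
  obtain K where K: "K > 0" "\<And>y. norm (D y) \<le> K * norm y"
    using linear_bounded_pos[OF linear_D] by blast
  have "norm ((D ^^ n) y) \<le> K ^ n * norm y" for n y
  proof (induction n)
    case (Suc n)
    have "norm ((D ^^ Suc n) y) \<le> K * norm ((D ^^ n) y)"
      using K(2) by simp
    also have "\<dots> \<le> K * (K ^ n * norm y)"
      using Suc K(1) by (intro mult_left_mono) auto
    finally show ?case by (simp add: mult.assoc)
  qed simp
  then show ?thesis by blast
qed

lemma flow_summable: "summable (\<lambda>n. (t ^ n / fact n) *\<^sub>R (D ^^ n) y)"
proof -
  obtain K where K: "\<And>n y. norm ((D ^^ n) y) \<le> K ^ n * norm y"
    using funpow_norm_bound by blast
  have sum: "summable (\<lambda>n. inverse (fact n) * (\<bar>t\<bar> * K) ^ n * norm y)"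
    by (intro summable_mult2 summable_exp)
  have "norm ((t ^ n / fact n) *\<^sub>R (D ^^ n) y) \<le> inverse (fact n) * (\<bar>t\<bar> * K) ^ n * norm y" for n
  proof -
    have "norm ((t ^ n / fact n) *\<^sub>R (D ^^ n) y) = (\<bar>t\<bar> ^ n / fact n) * norm ((D ^^ n) y)"
      by (simp add: power_abs)
    also have "\<dots> \<le> (\<bar>t\<bar> ^ n / fact n) * (K ^ n * norm y)"
      by (intro mult_left_mono K) auto
    finally show ?thesis
      by (simp add: power_mult_distrib field_simps)
  qed
  then show ?thesis
    by (rule summable_comparison_test'[OF sum, of 0])
qed

lemma linear_flow: "linear (flow D t)"
proof (rule linearI)
  fix x y c
  show "flow D t (x + y) = flow D t x + flow D t y"
    unfolding flow_def suminf_add[OF flow_summable flow_summable]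
    by (simp add: linear_add[OF linear_funpow] scaleR_add_right)
  show "flow D t (c *\<^sub>R x) = c *\<^sub>R flow D t x"
    unfolding flow_def suminf_scaleR_right[OF flow_summable]
    by (simp add: linear_scale[OF linear_funpow] mult.commute)
qed

lemma flow_commute: "flow D t (D y) = D (flow D t y)"
proof -
  have "D (flow D t y) = (\<Sum>n. D ((t ^ n / fact n) *\<^sub>R (D ^^ n) y))"
    unfolding flow_def
    by (rule bounded_linear.suminf[OF linear_D[unfolded linear_conv_bounded_linear] flow_summable])
  then show ?thesis
    by (simp add: flow_def linear_scale[OF linear_D] funpow_swap1)
qed

lemma flow_0: "flow D 0 y = y"
  unfolding flow_def by (subst suminf_finite[of "{0}"]) auto

text \<open>Each component is a scalar power series in \<open>t\<close>, hence differentiable term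
  by term; the shift of coefficients made by \<open>diffs\<close> replaces \<open>y\<close> by
  \<open>D y\<close>.\<close>

lemma flow_has_derivative:
  "((\<lambda>t. flow D t y) has_vector_derivative flow D t (D y)) (at t)"
proof -
  have "((\<lambda>t. flow D t y \<bullet> b) has_real_derivative flow D t (D y) \<bullet> b) (at t)" for b
  proof -
    define c where "c n = ((D ^^ n) y \<bullet> b) / fact n" for n
    have c: "(t ^ n / fact n) *\<^sub>R (D ^^ n) y \<bullet> b = c n * t ^ n" for t n
      by (simp add: c_def)
    have "(\<lambda>t. flow D t y \<bullet> b) = (\<lambda>t. \<Sum>n. c n * t ^ n)"
      unfolding flow_def using bounded_linear.suminf[OF bounded_linear_inner_left flow_summable]
      by (simp add: c[symmetric])
    moreover have "flow D t (D y) \<bullet> b = (\<Sum>n. diffs c n * t ^ n)"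
    proof -
      have "flow D t (D y) \<bullet> b = (\<Sum>n. (t ^ n / fact n) *\<^sub>R (D ^^ n) (D y) \<bullet> b)"
        unfolding flow_def using bounded_linear.suminf[OF bounded_linear_inner_left flow_summable] by simp
      also have "\<dots> = (\<Sum>n. diffs c n * t ^ n)"
        by (simp add: diffs_def c_def funpow_swap1 field_simps del: of_nat_Suc)
      finally show ?thesis .
    qed
    moreover have "summable (\<lambda>n. c n * t ^ n)" for t
      using bounded_linear.summable[OF bounded_linear_inner_left flow_summable, of t y b]
      by (simp only: c)
    ultimately show ?thesis
      using termdiffs_strong_converges_everywhere[of c t] by simp
  qed
  then show ?thesis
    unfolding has_vector_derivative_def
    by (subst has_derivative_componentwise_within)
      (auto simp: has_field_derivative_def mult.commute[of _ "_ \<bullet> _"])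
qed

text \<open>The expression \<open>flow D (- r) (flow D r y)\<close> has derivative 0 in
  \<open>r\<close> and the value \<open>y\<close> at 0. Expanding the inner vector in the standard
  basis writes it as a sum of scalar functions times curves, so that the product rule
  applies.\<close>

lemma flow_inverse: "flow D (- t) (flow D t y) = y"
proof -
  have expand: "flow D r z = (\<Sum>b\<in>Basis. (z \<bullet> b) *\<^sub>R flow D r b)" for r z
  proof -
    have "flow D r z = flow D r (\<Sum>b\<in>Basis. (z \<bullet> b) *\<^sub>R b)"
      by (simp add: euclidean_representation)
    then show ?thesis
      by (simp add: linear_sum[OF linear_flow] linear_scale[OF linear_flow])
  qed
  have "((\<lambda>r. flow D (- r) (flow D r y)) has_vector_derivative 0) (at r)" for r
  proof -
    have neg: "((\<lambda>r. flow D (- r) b) has_vector_derivative - flow D (- r) (D b)) (at r)" for b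
    proof -
      have "((\<lambda>r. - r) has_real_derivative - 1) (at r)"
        by (auto intro!: derivative_eq_intros)
      then have "((\<lambda>r. - r) has_vector_derivative - 1) (at r)"
        by (simp add: has_real_derivative_iff_has_vector_derivative)
      from vector_diff_chain_at[OF this flow_has_derivative[of b "- r"]] show ?thesis
        by (simp add: o_def)
    qed
    have inner: "((\<lambda>r. flow D r y \<bullet> b) has_real_derivative flow D r (D y) \<bullet> b) (at r)" for b
      using bounded_linear.has_vector_derivative[OF bounded_linear_inner_left flow_has_derivative]
      by (simp add: has_real_derivative_iff_has_vector_derivative)
    have "((\<lambda>r. \<Sum>b\<in>Basis. (flow D r y \<bullet> b) *\<^sub>R flow D (- r) b) has_vector_derivative
        (\<Sum>b\<in>Basis. (flow D r y \<bullet> b) *\<^sub>R (- flow D (- r) (D b)) + (flow D r (D y) \<bullet> b) *\<^sub>R flow D (- r) b)) (at r)"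
      by (intro has_vector_derivative_sum has_vector_derivative_scaleR inner neg)
    moreover have "(\<Sum>b\<in>Basis. (flow D r y \<bullet> b) *\<^sub>R (- flow D (- r) (D b))
        + (flow D r (D y) \<bullet> b) *\<^sub>R flow D (- r) b) = 0"
    proof -
      have "(\<Sum>b\<in>Basis. (flow D r y \<bullet> b) *\<^sub>R flow D (- r) (D b)) = flow D (- r) (D (flow D r y))"
      proof -
        have "D (flow D r y) = D (\<Sum>b\<in>Basis. (flow D r y \<bullet> b) *\<^sub>R b)"
          by (simp add: euclidean_representation)
        then show ?thesis
          by (simp add: linear_sum[OF linear_D] linear_scale[OF linear_D]
              linear_sum[OF linear_flow] linear_scale[OF linear_flow])
      qed
      then show ?thesis
        using expand[of "- r" "flow D r (D y)"]
        by (simp add: sum_subtractf sum.distrib sum_negf flow_commute)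
    qed
    moreover have "(\<lambda>r. flow D (- r) (flow D r y)) =
        (\<lambda>r. \<Sum>b\<in>Basis. (flow D r y \<bullet> b) *\<^sub>R flow D (- r) b)"
      by (intro ext expand)
    ultimately show ?thesis
      by (simp only:)
  qed
  then obtain c where "\<And>r. flow D (- r) (flow D r y) = c"
    using has_vector_derivative_zero_constant[OF convex_UNIV, of "\<lambda>r. flow D (- r) (flow D r y)"]
    by auto
  from this[of t] this[of 0] show ?thesis
    by (simp add: flow_0)
qed

end

section \<open>Exponentials of inner derivations and the group they generate\<close>

context lie_algebra
begin

lemma br_zero [simp]: "x \<in> V \<Longrightarrow> br x 0 = 0" "x \<in> V \<Longrightarrow> br 0 x = 0"
  using lin_on_zero[OF bilin_on_right[OF br_bilinear] subspace_carrier]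
    lin_on_zero[OF bilin_on_left[OF br_bilinear] subspace_carrier] by auto

lemma br_simps [simp]:
  assumes "x \<in> V" "y \<in> V"
  shows "z \<in> V \<Longrightarrow> br (x + z) y = br x y + br z y" "z \<in> V \<Longrightarrow> br y (x + z) = br y x + br y z"
    "z \<in> V \<Longrightarrow> br (x - z) y = br x y - br z y" "z \<in> V \<Longrightarrow> br y (x - z) = br y x - br y z"
    "br (c *\<^sub>R x) y = c *\<^sub>R br x y" "br y (c *\<^sub>R x) = c *\<^sub>R br y x"
    "br (- x) y = - br x y" "br y (- x) = - br y x"
  using assms lin_on_add[OF bilin_on_left[OF br_bilinear]] lin_on_add[OF bilin_on_right[OF br_bilinear]]
    lin_on_diff[OF bilin_on_left[OF br_bilinear] subspace_carrier]
    lin_on_diff[OF bilin_on_right[OF br_bilinear] subspace_carrier]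
    lin_on_scaleR[OF bilin_on_left[OF br_bilinear]] lin_on_scaleR[OF bilin_on_right[OF br_bilinear]]
    lin_on_uminus[OF bilin_on_left[OF br_bilinear]] lin_on_uminus[OF bilin_on_right[OF br_bilinear]]
  by auto

lemmas carrier_mem [simp] = subspace_0[OF subspace_carrier] subspace_add[OF subspace_carrier]
  subspace_diff[OF subspace_carrier] subspace_scale[OF subspace_carrier]
  subspace_neg[OF subspace_carrier] br_closed

lemma br_anti: "x \<in> V \<Longrightarrow> y \<in> V \<Longrightarrow> br x y = - br y x"
  using br_alternating[of "x + y"] br_alternating[of x] br_alternating[of y]
  by (simp add: eq_neg_iff_add_eq_0 add.commute)

end

locale euclidean_lie_algebra = lie_algebra V br
  for V :: "'a::euclidean_space set" and br
begin

text \<open>On the carrier the iterates of \<open>D\<close> and of \<open>br x\<close> coincide, and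
  a factor \<open>t\<close> in the argument contributes \<open>t ^ n\<close> to the n-th iterate, so
  \<open>exp_ad\<close> along a line is a \<open>flow\<close>.\<close>

lemma ad_extension:
  assumes "x \<in> V"
  obtains D where "linear D" "\<And>y. y \<in> V \<Longrightarrow> D y = br x y"
    "\<And>t y. y \<in> V \<Longrightarrow> exp_ad br (t *\<^sub>R x) y = flow D t y"
proof -
  obtain D where D: "linear D" "\<And>y. y \<in> V \<Longrightarrow> D y = br x y"
    using lin_on_extension[OF subspace_carrier bilin_on_right[OF br_bilinear assms]] by blast
  have V: "(D ^^ n) y \<in> V" if "y \<in> V" for n y
    by (induction n) (use that D(2) assms in auto)
  have "(br (t *\<^sub>R x) ^^ n) y = t ^ n *\<^sub>R (D ^^ n) y" if "y \<in> V" for t n y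
    by (induction n) (use that V assms D(2) in \<open>auto simp: mult.commute\<close>)
  then have "exp_ad br (t *\<^sub>R x) y = flow D t y" if "y \<in> V" for t y
    using that by (simp add: exp_ad_def flow_def field_simps)
  then show ?thesis
    using that D by blast
qed

lemma exp_ad_closed: "exp_ad br x y \<in> V" if xy: "x \<in> V" "y \<in> V"
proof -
  obtain D where D: "linear D" "\<And>y. y \<in> V \<Longrightarrow> D y = br x y"
      "\<And>t y. y \<in> V \<Longrightarrow> exp_ad br (t *\<^sub>R x) y = flow D t y"
    using ad_extension[OF xy(1)] by blast
  have V: "(D ^^ n) y \<in> V" for n
    by (induction n) (use xy D(2) in auto)
  have "flow D 1 y \<in> V"
    unfolding flow_def
  proof (rule Lim_in_closed_set[OF closed_subspace[OF subspace_carrier] _ _ summable_LIMSEQ[OF flow_summable[OF D(1)]]])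
    show "\<forall>\<^sub>F m in sequentially. (\<Sum>n<m. (1 ^ n / fact n) *\<^sub>R (D ^^ n) y) \<in> V"
      using V by (auto intro!: always_eventually subspace_sum[OF subspace_carrier])
  qed simp
  then show ?thesis
    using D(3)[of y 1] xy by simp
qed

lemma lin_exp_ad: "lin_on V (exp_ad br x)" if x: "x \<in> V"
proof -
  obtain D where D: "linear D" "\<And>y. y \<in> V \<Longrightarrow> D y = br x y"
      "\<And>t y. y \<in> V \<Longrightarrow> exp_ad br (t *\<^sub>R x) y = flow D t y"
    using ad_extension[OF x] by blast
  have "lin_on V (flow D 1)"
    by (rule lin_on_linear[OF linear_flow[OF D(1)]])
  then show ?thesis
    using lin_on_cong[OF subspace_carrier, of "exp_ad br x" "flow D 1"] D(3)[of _ 1] by simp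
qed

lemma exp_ad_inverse: "exp_ad br (- x) (exp_ad br x y) = y" if xy: "x \<in> V" "y \<in> V"
proof -
  obtain D where D: "linear D" "\<And>y. y \<in> V \<Longrightarrow> D y = br x y"
      "\<And>t y. y \<in> V \<Longrightarrow> exp_ad br (t *\<^sub>R x) y = flow D t y"
    using ad_extension[OF xy(1)] by blast
  show ?thesis
    using flow_inverse[OF D(1), of 1 y] D(3)[of y 1] D(3)[of "exp_ad br x y" "-1"]
      exp_ad_closed[OF xy] xy by simp
qed

context
  fixes K
  assumes K: "subspace K" "K \<subseteq> V"
begin

abbreviation "Ad_K \<equiv> adjoint_group V br K"

lemma Ad_closed: "T \<in> Ad_K \<Longrightarrow> y \<in> V \<Longrightarrow> T y \<in> V"
  by (induction rule: adjoint_group.induct) (use K exp_ad_closed in auto)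

lemma lin_Ad: "T \<in> Ad_K \<Longrightarrow> lin_on V T"
proof (induction rule: adjoint_group.induct)
  case one
  then show ?case by (simp add: lin_on_def)
next
  case (mult x T)
  have "x \<in> V"
    using mult(1) K(2) by blast
  have "lin_on V (\<lambda>y. exp_ad br x (T y))"
    by (rule lin_on_compose[OF mult(3) lin_exp_ad[OF \<open>x \<in> V\<close>] Ad_closed[OF mult(2)]])
  then show ?case
    by (subst lin_on_cong[OF subspace_carrier, where g = "\<lambda>y. exp_ad br x (T y)"]) simp_all
qed

lemma exp_ad_in_Ad:
  assumes "x \<in> K" obtains T where "T \<in> Ad_K" "\<And>y. y \<in> V \<Longrightarrow> T y = exp_ad br x y"
  using adjoint_group.mult[OF assms adjoint_group.one] that by fastforce

lemma Ad_comp: "S \<in> Ad_K \<Longrightarrow> T \<in> Ad_K \<Longrightarrow> \<exists>R\<in>Ad_K. \<forall>y\<in>V. R y = S (T y)"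
proof (induction rule: adjoint_group.induct)
  case one
  then show ?case using Ad_closed by (intro bexI[of _ T]) auto
next
  case (mult x S)
  then obtain R where R: "R \<in> Ad_K" "\<And>y. y \<in> V \<Longrightarrow> R y = S (T y)" by blast
  show ?case
    by (rule bexI[OF _ adjoint_group.mult[OF mult(1) R(1)]]) (use R(2) Ad_closed mult in auto)
qed

text \<open>The inductive rule adds exponentials on the left, while the inverse of
  \<open>exp (ad x) T\<close> has its new factor on the right; \<open>Ad_comp\<close> supplies that
  product.\<close>

lemma Ad_inverse: "T \<in> Ad_K \<Longrightarrow> \<exists>S\<in>Ad_K. \<forall>y\<in>V. S (T y) = y \<and> T (S y) = y"
proof (induction rule: adjoint_group.induct)
  case one
  then show ?case by (intro bexI[OF _ adjoint_group.one]) auto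
next
  case (mult x T)
  then obtain S where S: "S \<in> Ad_K" "\<And>y. y \<in> V \<Longrightarrow> S (T y) = y \<and> T (S y) = y" by blast
  have x: "x \<in> V" "- x \<in> V" "- x \<in> K"
    using mult(1) K by (auto simp: subspace_neg)
  obtain E where E: "E \<in> Ad_K" "\<And>y. y \<in> V \<Longrightarrow> E y = exp_ad br (- x) y"
    using exp_ad_in_Ad[OF x(3)] by blast
  obtain R where R: "R \<in> Ad_K" "\<And>y. y \<in> V \<Longrightarrow> R y = S (E y)"
    using Ad_comp[OF S(1) E(1)] by blast
  show ?case
  proof (rule bexI[OF _ R(1)], intro ballI conjI)
    fix y assume y: "y \<in> V"
    show "R (restrict (\<lambda>y. exp_ad br x (T y)) V y) = y"
      using y R(2) E(2) S(2) x exp_ad_inverse exp_ad_closed Ad_closed[OF mult(2)] by simp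
    have "exp_ad br (- x) y \<in> V"
      using exp_ad_closed x y by blast
    then show "restrict (\<lambda>y. exp_ad br x (T y)) V (R y) = y"
      using y R(2) E(2) S(2) x exp_ad_inverse[of "- x" y] Ad_closed[OF S(1)] by simp
  qed
qed

text \<open>Evaluation at a vector is continuous for pointwise convergence, so compactness makes the
  orbits bounded and an invariant inner product exists. Differentiating its invariance under
  \<open>exp (t ad x)\<close> at \<open>t = 0\<close> makes \<open>ad x\<close> skew.\<close>

theorem compactly_embedded_invariant_form:
  assumes "compactly_embedded V br K"
  obtains Q where "inner_space V Q"
    "\<And>x y z. \<lbrakk>x \<in> K; y \<in> V; z \<in> V\<rbrakk> \<Longrightarrow> Q (br x y) z = - Q y (br x z)"
proof -
  interpret bounded_linear_group V Ad_K
  proof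
    fix y assume "y \<in> V"
    have "compact ((\<lambda>T. T y) ` Ad_K)"
      by (rule compact_continuous_image)
        (use assms in \<open>auto simp: compactly_embedded_def intro: continuous_on_subset[OF continuous_on_product_coordinates]\<close>)
    then show "bounded ((\<lambda>T. T y) ` Ad_K)"
      by (rule compact_imp_bounded)
  next
    show "Ad_K \<noteq> {}"
      using adjoint_group.one by blast
  qed (use subspace_carrier lin_Ad Ad_closed Ad_comp Ad_inverse in \<open>auto 0 3\<close>)
  obtain Q where Q: "inner_space V Q"
    "\<And>T y z. \<lbrakk>T \<in> Ad_K; y \<in> V; z \<in> V\<rbrakk> \<Longrightarrow> Q (T y) (T z) = Q y z"
    using invariant_inner_space by blast
  interpret Q: inner_space V Q by fact
  \<comment> \<open>The global bilinear extension is bounded, which gives the product rule along the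
    two curves.\<close>
  obtain Q' where Q': "bilinear Q'" "\<And>x y. x \<in> V \<Longrightarrow> y \<in> V \<Longrightarrow> Q' x y = Q x y"
    using bilin_on_extension[OF subspace_carrier Q.bilin] by blast
  interpret Q': bounded_bilinear Q'
    using Q'(1) bilinear_conv_bounded_bilinear by blast
  have "Q (br x y) z = - Q y (br x z)" if x: "x \<in> K" and y: "y \<in> V" and z: "z \<in> V" for x y z
  proof -
    have xV: "x \<in> V" using x K by blast
    obtain D where D: "linear D" "\<And>y. y \<in> V \<Longrightarrow> D y = br x y"
      "\<And>t y. y \<in> V \<Longrightarrow> exp_ad br (t *\<^sub>R x) y = flow D t y"
      using ad_extension[OF xV] by blast
    have "Q' (flow D t y) (flow D t z) = Q y z" for t
    proof -
      have "t *\<^sub>R x \<in> K" using x K subspace_scale by blast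
      then obtain T where T: "T \<in> Ad_K" "\<And>y. y \<in> V \<Longrightarrow> T y = flow D t y"
        using exp_ad_in_Ad D(3) by metis
      then show ?thesis
        using Q(2)[OF T(1) y z] Q'(2) Ad_closed[OF T(1)] y z by metis
    qed
    moreover have "((\<lambda>t. Q' (flow D t y) (flow D t z)) has_vector_derivative
        Q' (flow D 0 y) (flow D 0 (D z)) + Q' (flow D 0 (D y)) (flow D 0 z)) (at 0)"
      by (intro Q'.has_vector_derivative flow_has_derivative D(1))
    ultimately have "((\<lambda>t. Q y z) has_vector_derivative
        Q' y (D z) + Q' (D y) z) (at 0)"
      by (simp add: flow_0[OF D(1)])
    then have "Q' y (D z) + Q' (D y) z = 0"
      using vector_derivative_unique_at[OF _ has_vector_derivative_const] by blast
    then show ?thesis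
      using D(2) Q'(2) y z xV by simp
  qed
  then show ?thesis
    using that Q(1) by blast
qed

end

end

section \<open>Normal form of the bracket\<close>

context inner_space
begin

text \<open>\<open>R\<close> is \<open>r(A)\<close> for a positive function \<open>r\<close> of the
  eigenvalues, chosen so that \<open>A R R\<close> is the sign of \<open>A\<close>. The last clause
  says that this sign operator equals its own cube, without naming it.\<close>

lemma functional_calculus:
  assumes A: "lin_on W A" "\<And>x. x \<in> W \<Longrightarrow> A x \<in> W"
    and selfadj: "\<And>x y. x \<in> W \<Longrightarrow> y \<in> W \<Longrightarrow> Q (A x) y = Q x (A y)"
  shows "\<exists>R. lin_on W R \<and> (\<forall>x\<in>W. R x \<in> W) \<and> (\<forall>x\<in>W. \<forall>y\<in>W. Q (R x) y = Q x (R y)) \<and>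
    (\<forall>x\<in>W. x \<noteq> 0 \<longrightarrow> Q (R x) x > 0) \<and>
    (\<forall>D. lin_on W D \<longrightarrow> (\<forall>x\<in>W. D x \<in> W) \<longrightarrow> (\<forall>x\<in>W. A (D x) = D (A x)) \<longrightarrow>
      (\<forall>x\<in>W. R (D x) = D (R x))) \<and>
    (\<forall>x\<in>W. A (R (R (A (R (R (A (R (R x)))))))) = A (R (R x)))"
proof -
  have "\<exists>E \<mu>. finite E \<and> E \<subseteq> W \<and> (\<forall>e\<in>E. \<forall>f\<in>E. Q e f = (if e = f then 1 else 0)) \<and>
    (\<forall>x\<in>W. (\<Sum>e\<in>E. Q x e *\<^sub>R e) = x) \<and> (\<forall>e\<in>E. A e = \<mu> e *\<^sub>R e)"
    by (rule spectral_theorem[OF inner_space_axioms A(1)]) (use A selfadj in auto)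
  then obtain E \<mu> where E: "finite E" "E \<subseteq> W"
    and E': "\<forall>e\<in>E. \<forall>f\<in>E. Q e f = (if e = f then 1 else 0)"
    "\<forall>x\<in>W. (\<Sum>e\<in>E. Q x e *\<^sub>R e) = x" "\<forall>e\<in>E. A e = \<mu> e *\<^sub>R e"
    by (elim exE conjE) (rule that; assumption)
  have EW: "e \<in> W" if "e \<in> E" for e using that E(2) by blast
  have ext: "f x = g x" if "lin_on W f" "lin_on W g" "\<And>e. e \<in> E \<Longrightarrow> f e = g e" "x \<in> W"
    for f g :: "'a \<Rightarrow> 'a" and x
  proof -
    have x: "(\<Sum>e\<in>E. Q x e *\<^sub>R e) = x"
      using E'(2) that(4) by blast
    have "h x = (\<Sum>e\<in>E. Q x e *\<^sub>R h e)" if h: "lin_on W h" for h :: "'a \<Rightarrow> 'a"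
    proof -
      have "h x = h (\<Sum>e\<in>E. Q x e *\<^sub>R e)"
        by (simp only: x)
      also have "\<dots> = (\<Sum>e\<in>E. h (Q x e *\<^sub>R e))"
        by (rule lin_on_sum[OF h subspace_W]) (simp add: EW)
      finally show ?thesis
        by (simp add: lin_on_scaleR[OF h] EW)
    qed
    from this[OF that(1)] this[OF that(2)] show ?thesis
      using that(3) by simp
  qed
  \<comment> \<open>The value 1 at 0 is a convention that keeps \<open>R\<close> positive on the
    kernel of \<open>A\<close>; there \<open>m * (r m * r m)\<close> is 0 anyway.\<close>
  define r :: "real \<Rightarrow> real" where "r m = (if m = 0 then 1 else 1 / sqrt \<bar>m\<bar>)" for m
  have r: "r m > 0" "m * (r m * r m) = sgn m" for m
    by (auto simp: r_def sgn_if)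
  define R where "R x = (\<Sum>e\<in>E. (r (\<mu> e) * Q x e) *\<^sub>R e)" for x
  have linR: "lin_on W R"
    unfolding lin_on_def R_def
    by (simp add: EW algebra_simps sum.distrib scaleR_sum_right)
  have RW: "R x \<in> W" if "x \<in> W" for x
    unfolding R_def using EW by (intro subspace_sum[OF subspace_W]) simp
  have QR: "Q (R x) y = (\<Sum>e\<in>E. r (\<mu> e) * Q x e * Q y e)" if "x \<in> W" "y \<in> W" for x y
  proof -
    have "Q (R x) y = (\<Sum>e\<in>E. Q ((r (\<mu> e) * Q x e) *\<^sub>R e) y)"
      unfolding R_def by (rule Q_sum_left) (use EW that in auto)
    also have "\<dots> = (\<Sum>e\<in>E. r (\<mu> e) * Q x e * Q y e)"
    proof (rule sum.cong[OF refl])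
      fix e assume "e \<in> E"
      then show "Q ((r (\<mu> e) * Q x e) *\<^sub>R e) y = r (\<mu> e) * Q x e * Q y e"
        using that EW sym[of e y] by simp
    qed
    finally show ?thesis .
  qed
  have symR: "Q (R x) y = Q x (R y)" if "x \<in> W" "y \<in> W" for x y
    using QR[OF that] QR[OF that(2,1)] sym[OF that(1) RW[OF that(2)]]
    by (simp add: mult.commute mult.left_commute)
  have posR: "Q (R x) x > 0" if x: "x \<in> W" "x \<noteq> 0" for x
  proof -
    have "\<exists>e\<in>E. Q x e \<noteq> 0"
    proof (rule ccontr)
      assume "\<not> (\<exists>e\<in>E. Q x e \<noteq> 0)"
      then have "(\<Sum>e\<in>E. Q x e *\<^sub>R e) = 0" by simp
      then show False using E'(2) x by simp
    qed
    then obtain e where e: "e \<in> E" "Q x e \<noteq> 0" by blast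
    have "0 < (\<Sum>e\<in>E. r (\<mu> e) * Q x e * Q x e)"
    proof (rule sum_pos2[OF E(1) e(1)])
      show "0 < r (\<mu> e) * Q x e * Q x e"
        using r(1) e(2) by (simp add: mult.assoc zero_less_mult_iff) argo
      show "0 \<le> r (\<mu> e) * Q x e * Q x e" for e
        using r(1)[of "\<mu> e"] by (simp add: mult.assoc)
    qed
    then show ?thesis using QR[OF x(1,1)] by simp
  qed
  \<comment> \<open>This covers every eigenvector of \<open>A\<close>, not only those in
    \<open>E\<close>: the coefficient of \<open>v\<close> along \<open>e\<close> vanishes unless
    \<open>\<mu> e = m\<close>. An operator commuting with \<open>A\<close> maps each
    \<open>e\<close> to such a vector, and therefore commutes with \<open>R\<close>.\<close>
  have eig: "R v = r m *\<^sub>R v" if v: "v \<in> W" "A v = m *\<^sub>R v" for v m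
  proof -
    have "r (\<mu> e) * Q v e = r m * Q v e" if e: "e \<in> E" for e
    proof -
      have "m * Q v e = \<mu> e * Q v e"
        using selfadj[OF v(1) EW[OF e]] E'(3) e v EW by simp
      then show ?thesis by auto
    qed
    then have "R v = (\<Sum>e\<in>E. r m *\<^sub>R (Q v e *\<^sub>R e))"
      unfolding R_def scaleR_scaleR by (intro sum.cong refl) (simp only:)
    also have "\<dots> = r m *\<^sub>R (\<Sum>e\<in>E. Q v e *\<^sub>R e)"
      by (simp only: scaleR_sum_right)
    finally show ?thesis
      using E'(2) v(1) by simp
  qed
  have Re: "R e = r (\<mu> e) *\<^sub>R e" "A e = \<mu> e *\<^sub>R e" if "e \<in> E" for e
    using eig[of e "\<mu> e"] E'(3) EW that by auto
  have commute: "R (D x) = D (R x)"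
    if D: "lin_on W D" "\<And>x. x \<in> W \<Longrightarrow> D x \<in> W" "\<And>x. x \<in> W \<Longrightarrow> A (D x) = D (A x)" and x: "x \<in> W"
    for D x
  proof (rule ext[OF _ _ _ x])
    show "lin_on W (\<lambda>x. R (D x))"
      by (rule lin_on_compose[OF D(1) linR D(2)])
    show "lin_on W (\<lambda>x. D (R x))"
      by (rule lin_on_compose[OF linR D(1) RW])
    fix e assume e: "e \<in> E"
    have "A (D e) = \<mu> e *\<^sub>R D e"
      using D(3)[OF EW[OF e]] Re(2)[OF e] lin_on_scaleR[OF D(1) EW[OF e]] by simp
    then show "R (D e) = D (R e)"
      using eig[OF D(2)[OF EW[OF e]]] Re(1)[OF e] lin_on_scaleR[OF D(1) EW[OF e]] by simp
  qed
  define \<sigma> where "\<sigma> x = A (R (R x))" for x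
  have \<sigma>: "lin_on W \<sigma>" "\<And>x. x \<in> W \<Longrightarrow> \<sigma> x \<in> W"
    unfolding \<sigma>_def
    using lin_on_compose[OF linR lin_on_compose[OF linR A(1) RW] RW] A(2) RW by auto
  have \<sigma>e: "\<sigma> e = sgn (\<mu> e) *\<^sub>R e" if "e \<in> E" for e
    using Re[OF that] EW[OF that] r(2)[of "\<mu> e"]
    by (simp add: \<sigma>_def lin_on_scaleR[OF linR] lin_on_scaleR[OF A(1)] mult.commute mult.left_commute)
  have "\<sigma> (\<sigma> (\<sigma> x)) = \<sigma> x" if "x \<in> W" for x
  proof (rule ext[OF _ \<sigma>(1) _ that])
    show "lin_on W (\<lambda>x. \<sigma> (\<sigma> (\<sigma> x)))"
      by (rule lin_on_compose[OF \<sigma>(1) lin_on_compose[OF \<sigma>(1,1,2)] \<sigma>(2)])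
    fix e assume e: "e \<in> E"
    show "\<sigma> (\<sigma> (\<sigma> e)) = \<sigma> e"
      using EW[OF e] by (simp add: \<sigma>e[OF e] lin_on_scaleR[OF \<sigma>(1)] sgn_if)
  qed
  then have "\<forall>x\<in>W. A (R (R (A (R (R (A (R (R x)))))))) = A (R (R x))"
    by (simp add: \<sigma>_def)
  then show ?thesis
    using linR RW symR posR commute by (intro exI[of _ R] conjI) simp_all
qed

end

section \<open>Eigenspaces of the involution and their pairing\<close>

context symmetric_lie_algebra
begin

abbreviation "\<gg> \<equiv> fixed_part V s"
abbreviation "\<pp> \<equiv> anti_part V s"

lemma fixedD: "x \<in> \<gg> \<Longrightarrow> x \<in> V" "x \<in> \<gg> \<Longrightarrow> s x = x"
  and antiD: "x \<in> \<pp> \<Longrightarrow> x \<in> V" "x \<in> \<pp> \<Longrightarrow> s x = - x"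
  by (auto simp: fixed_part_def anti_part_def)

lemma s_simps:
  assumes "x \<in> V" "y \<in> V"
  shows "s (x + y) = s x + s y" "s (x - y) = s x - s y" "s (c *\<^sub>R x) = c *\<^sub>R s x" "s (- x) = - s x"
  using assms lin_on_add[OF s_linear] lin_on_diff[OF s_linear subspace_carrier]
    lin_on_scaleR[OF s_linear] lin_on_uminus[OF s_linear] by auto

lemma subspace_fixed: "subspace \<gg>" and subspace_anti: "subspace \<pp>"
  using lin_on_zero[OF s_linear subspace_carrier]
  by (auto simp: subspace_def fixed_part_def anti_part_def s_simps)

lemma br_fixed: "x \<in> \<gg> \<Longrightarrow> y \<in> \<gg> \<Longrightarrow> br x y \<in> \<gg>"
  and br_anti_fixed: "x \<in> \<pp> \<Longrightarrow> y \<in> \<gg> \<Longrightarrow> br x y \<in> \<pp>"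
  and br_anti_anti: "x \<in> \<pp> \<Longrightarrow> y \<in> \<pp> \<Longrightarrow> br x y \<in> \<gg>"
  by (auto simp: fixed_part_def anti_part_def s_bracket)

lemma split_parts:
  assumes "x \<in> V"
  shows "(1/2) *\<^sub>R (x + s x) \<in> \<gg>" "(1/2) *\<^sub>R (x - s x) \<in> \<pp>"
    "x = (1/2) *\<^sub>R (x + s x) + (1/2) *\<^sub>R (x - s x)"
  using assms s_closed[OF assms]
  by (auto simp: fixed_part_def anti_part_def s_simps s_involutive algebra_simps
      simp flip: scaleR_add_left)

lemma fixed_anti_zero: "x \<in> \<gg> \<Longrightarrow> x \<in> \<pp> \<Longrightarrow> x = 0"
proof -
  assume "x \<in> \<gg>" "x \<in> \<pp>"
  then have "2 *\<^sub>R x = 0"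
    using fixedD(2)[of x] antiD(2)[of x] by (metis add.right_inverse scaleR_2)
  then show ?thesis by simp
qed

end

context legendrian_lie_algebra
begin

lemma \<Lambda>_zero [simp]: "x \<in> V \<Longrightarrow> \<Lambda> x 0 = 0" "x \<in> V \<Longrightarrow> \<Lambda> 0 x = 0"
  using lin_on_zero[OF bilin_on_right[OF \<Lambda>_bilinear] subspace_carrier]
    lin_on_zero[OF bilin_on_left[OF \<Lambda>_bilinear] subspace_carrier] by auto

lemma \<Lambda>_simps [simp]:
  assumes "x \<in> V" "y \<in> V"
  shows "z \<in> V \<Longrightarrow> \<Lambda> (x + z) y = \<Lambda> x y + \<Lambda> z y" "z \<in> V \<Longrightarrow> \<Lambda> y (x + z) = \<Lambda> y x + \<Lambda> y z"
    "z \<in> V \<Longrightarrow> \<Lambda> (x - z) y = \<Lambda> x y - \<Lambda> z y" "z \<in> V \<Longrightarrow> \<Lambda> y (x - z) = \<Lambda> y x - \<Lambda> y z"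
    "\<Lambda> (c *\<^sub>R x) y = c * \<Lambda> x y" "\<Lambda> y (c *\<^sub>R x) = c * \<Lambda> y x"
    "\<Lambda> (- x) y = - \<Lambda> x y" "\<Lambda> y (- x) = - \<Lambda> y x"
  using assms lin_on_add[OF bilin_on_left[OF \<Lambda>_bilinear]] lin_on_add[OF bilin_on_right[OF \<Lambda>_bilinear]]
    lin_on_diff[OF bilin_on_left[OF \<Lambda>_bilinear] subspace_carrier]
    lin_on_diff[OF bilin_on_right[OF \<Lambda>_bilinear] subspace_carrier]
    lin_on_scaleR[OF bilin_on_left[OF \<Lambda>_bilinear]] lin_on_scaleR[OF bilin_on_right[OF \<Lambda>_bilinear]]
    lin_on_uminus[OF bilin_on_left[OF \<Lambda>_bilinear]] lin_on_uminus[OF bilin_on_right[OF \<Lambda>_bilinear]]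
  by auto

lemma isotropic_fixed: "x \<in> \<gg> \<Longrightarrow> y \<in> \<gg> \<Longrightarrow> \<Lambda> x y = 0"
  and isotropic_anti: "x \<in> \<pp> \<Longrightarrow> y \<in> \<pp> \<Longrightarrow> \<Lambda> x y = 0"
  using \<Lambda>_s[of x y] by (auto simp: fixed_part_def anti_part_def)

text \<open>\<open>\<pp>\<close> is isotropic and \<open>\<Lambda>\<close> nondegenerate, so an
  element of \<open>\<pp>\<close> is determined by its pairing with \<open>\<gg>\<close>. Identities
  between elements of \<open>\<pp>\<close> are proved by this test.\<close>

lemma anti_eqI:
  assumes "u \<in> \<pp>" "v \<in> \<pp>" "\<And>y. y \<in> \<gg> \<Longrightarrow> \<Lambda> u y = \<Lambda> v y" shows "u = v"
proof -
  have V: "u - v \<in> V" "u - v \<in> \<pp>"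
    using assms subspace_diff[OF subspace_anti] antiD(1) by auto
  have "\<Lambda> (u - v) z = 0" if z: "z \<in> V" for z
  proof -
    obtain y w where "y \<in> \<gg>" "w \<in> \<pp>" "z = y + w"
      using split_parts[OF z] by blast
    then show ?thesis
      using assms(3)[of y] isotropic_anti[OF V(2), of w] V(1) assms(1,2)
      by (auto dest!: fixedD(1) antiD(1))
  qed
  then show ?thesis
    using \<Lambda>_nondegenerate[OF V(1)] by simp
qed

lemma fixed_zeroI:
  assumes "x \<in> \<gg>" "\<And>u. u \<in> \<pp> \<Longrightarrow> \<Lambda> u x = 0" shows "x = 0"
proof (rule \<Lambda>_nondegenerate)
  show "\<forall>z\<in>V. \<Lambda> x z = 0"
  proof
    fix z assume z: "z \<in> V"
    obtain y w where "y \<in> \<gg>" "w \<in> \<pp>" "z = y + w"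
      using split_parts[OF z] by blast
    then show "\<Lambda> x z = 0"
      using assms isotropic_fixed[OF assms(1), of y] \<Lambda>_sym[of x w]
      by (auto dest!: fixedD(1) antiD(1))
  qed
qed (use assms fixedD in auto)

end

locale euclidean_legendrian = legendrian_lie_algebra V br s \<Lambda>
  for V :: "'a::euclidean_space set" and br s \<Lambda>

text \<open>\<open>\<Lambda>_J\<close> characterises \<open>J\<close> as the composite of the
  isomorphism of \<open>\<gg>\<close> with its dual given by \<open>B\<close> and the one from the
  dual to \<open>\<pp>\<close> given by \<open>\<Lambda>\<close>.\<close>

locale framed_legendrian = euclidean_legendrian V br s \<Lambda> + B: inner_space "fixed_part V s" B
  for V :: "'a::euclidean_space set" and br s \<Lambda> B +
  fixes J :: "'a \<Rightarrow> 'a"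
  assumes eff: "effective V br s"
    and B_invariant: "\<lbrakk>x \<in> \<gg>; y \<in> \<gg>; z \<in> \<gg>\<rbrakk> \<Longrightarrow> B (br x y) z = B x (br y z)"
    and J_lin: "lin_on \<gg> J"
    and J_anti: "x \<in> \<gg> \<Longrightarrow> J x \<in> \<pp>"
    and \<Lambda>_J: "\<lbrakk>x \<in> \<gg>; y \<in> \<gg>\<rbrakk> \<Longrightarrow> \<Lambda> (J x) y = B x y"

text \<open>\<open>S\<close> collects the elements for which a value of \<open>J\<close> is
  available. Every \<open>u\<close> in \<open>\<pp>\<close> comes from some element of
  \<open>S\<close> by Riesz representation, so a vector orthogonal to \<open>S\<close> pairs to 0
  with \<open>\<pp>\<close> and vanishes; hence \<open>S\<close> is all of
  \<open>\<gg>\<close>.\<close>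

lemma (in euclidean_legendrian) framed_exists:
  assumes "inner_space \<gg> B" "effective V br s"
    and inv: "\<And>x y z. \<lbrakk>x \<in> \<gg>; y \<in> \<gg>; z \<in> \<gg>\<rbrakk> \<Longrightarrow> B (br x y) z = B x (br y z)"
  obtains J where "framed_legendrian V br s \<Lambda> B J"
proof -
  interpret B: inner_space \<gg> B by fact
  define S where "S = {x \<in> \<gg>. \<exists>u\<in>\<pp>. \<forall>y\<in>\<gg>. \<Lambda> u y = B x y}"
  have "subspace S"
    unfolding subspace_def S_def
  proof (intro conjI ballI allI)
    show "0 \<in> {x \<in> \<gg>. \<exists>u\<in>\<pp>. \<forall>y\<in>\<gg>. \<Lambda> u y = B x y}"
      using subspace_0[OF subspace_anti] by (auto intro!: bexI[of _ 0] dest: fixedD(1))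
  next
    fix x y assume "x \<in> {x \<in> \<gg>. \<exists>u\<in>\<pp>. \<forall>y\<in>\<gg>. \<Lambda> u y = B x y}"
      "y \<in> {x \<in> \<gg>. \<exists>u\<in>\<pp>. \<forall>y\<in>\<gg>. \<Lambda> u y = B x y}"
    then obtain u v where "x \<in> \<gg>" "y \<in> \<gg>" "u \<in> \<pp>" "v \<in> \<pp>" "\<And>z. z \<in> \<gg> \<Longrightarrow> \<Lambda> u z = B x z"
      "\<And>z. z \<in> \<gg> \<Longrightarrow> \<Lambda> v z = B y z" by auto
    then show "x + y \<in> {x \<in> \<gg>. \<exists>u\<in>\<pp>. \<forall>y\<in>\<gg>. \<Lambda> u y = B x y}"
      by (auto intro!: bexI[of _ "u + v"] subspace_add[OF subspace_anti] simp: fixedD(1) antiD(1))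
  next
    fix c x assume "x \<in> {x \<in> \<gg>. \<exists>u\<in>\<pp>. \<forall>y\<in>\<gg>. \<Lambda> u y = B x y}"
    then obtain u where "x \<in> \<gg>" "u \<in> \<pp>" "\<And>z. z \<in> \<gg> \<Longrightarrow> \<Lambda> u z = B x z" by auto
    then show "c *\<^sub>R x \<in> {x \<in> \<gg>. \<exists>u\<in>\<pp>. \<forall>y\<in>\<gg>. \<Lambda> u y = B x y}"
      by (auto intro!: bexI[of _ "c *\<^sub>R u"] subspace_scale[OF subspace_anti] simp: fixedD(1) antiD(1))
  qed
  moreover have "S \<subseteq> \<gg>" by (auto simp: S_def)
  moreover have "y = 0" if y: "y \<in> \<gg>" "\<And>x. x \<in> S \<Longrightarrow> B y x = 0" for y
  proof (rule fixed_zeroI[OF y(1)])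
    fix u assume u: "u \<in> \<pp>"
    have "lin_on \<gg> (\<Lambda> u)"
      by (rule lin_on_subset[OF bilin_on_right[OF \<Lambda>_bilinear antiD(1)[OF u]]]) (auto simp: fixedD)
    then obtain x where x: "x \<in> \<gg>" "\<And>y. y \<in> \<gg> \<Longrightarrow> \<Lambda> u y = B x y"
      using B.riesz by blast
    then have "x \<in> S" using u by (auto simp: S_def)
    then show "\<Lambda> u y = 0"
      using y x B.sym[of x y] by simp
  qed
  ultimately have "S = \<gg>"
    by (rule B.subspace_eq_if_no_orthogonal)
  then have "\<forall>x\<in>\<gg>. \<exists>u. u \<in> \<pp> \<and> (\<forall>y\<in>\<gg>. \<Lambda> u y = B x y)"
    unfolding S_def by blast
  then obtain J where J: "\<And>x. x \<in> \<gg> \<Longrightarrow> J x \<in> \<pp>" "\<And>x y. x \<in> \<gg> \<Longrightarrow> y \<in> \<gg> \<Longrightarrow> \<Lambda> (J x) y = B x y"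
    by metis
  have "J (x + y) = J x + J y" if "x \<in> \<gg>" "y \<in> \<gg>" for x y
    using that J by (intro anti_eqI subspace_add[OF subspace_anti]) (simp_all add: fixedD(1) antiD(1))
  moreover have "J (c *\<^sub>R x) = c *\<^sub>R J x" if "x \<in> \<gg>" for c x
    using that J by (intro anti_eqI subspace_scale[OF subspace_anti]) (simp_all add: fixedD(1) antiD(1))
  ultimately have "framed_legendrian V br s \<Lambda> B J"
    using assms J by unfold_locales (auto simp: lin_on_def)
  then show ?thesis by (rule that)
qed

context framed_legendrian
begin

lemma fixed_in_carrier [simp]: "x \<in> \<gg> \<Longrightarrow> x \<in> V"
  by (rule fixedD(1))

lemma J_in_carrier [simp]: "x \<in> \<gg> \<Longrightarrow> J x \<in> V"
  using J_anti antiD(1) by blast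

declare br_fixed [simp]

lemma J_simps [simp]:
  assumes "x \<in> \<gg>"
  shows "y \<in> \<gg> \<Longrightarrow> J (x + y) = J x + J y" "y \<in> \<gg> \<Longrightarrow> J (x - y) = J x - J y"
    "J (c *\<^sub>R x) = c *\<^sub>R J x" "J (- x) = - J x"
  using assms lin_on_add[OF J_lin] lin_on_diff[OF J_lin subspace_fixed]
    lin_on_scaleR[OF J_lin] lin_on_uminus[OF J_lin] by auto

lemma J_zero [simp]: "J 0 = 0"
  by (rule lin_on_zero[OF J_lin subspace_fixed])

lemma J_inj: "x \<in> \<gg> \<Longrightarrow> y \<in> \<gg> \<Longrightarrow> J x = J y \<Longrightarrow> x = y"
  by (rule B.eqI) (simp_all flip: \<Lambda>_J)

lemma J_surj:
  assumes "u \<in> \<pp>" obtains x where "x \<in> \<gg>" "u = J x"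
proof -
  have "lin_on \<gg> (\<Lambda> u)"
    by (rule lin_on_subset[OF bilin_on_right[OF \<Lambda>_bilinear antiD(1)[OF assms]]]) auto
  then obtain x where x: "x \<in> \<gg>" "\<And>y. y \<in> \<gg> \<Longrightarrow> \<Lambda> u y = B x y"
    using B.riesz by blast
  then have "u = J x"
    using assms by (intro anti_eqI J_anti) (simp_all add: \<Lambda>_J)
  then show ?thesis using that x(1) by blast
qed

text \<open>Both sides lie in \<open>\<pp>\<close>, and their pairings with \<open>\<gg>\<close>
  agree because \<open>\<Lambda>\<close> and \<open>B\<close> are invariant in the same
  sense.\<close>

lemma br_J_left: "x \<in> \<gg> \<Longrightarrow> z \<in> \<gg> \<Longrightarrow> br (J x) z = J (br x z)"
  by (rule anti_eqI) (simp_all add: J_anti br_anti_fixed \<Lambda>_J \<Lambda>_invariant B_invariant)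

lemma br_J_right: "x \<in> \<gg> \<Longrightarrow> z \<in> \<gg> \<Longrightarrow> br x (J z) = J (br x z)"
  using br_anti[of x "J z"] br_J_left[of z x] br_anti[of x z] by simp

text \<open>As \<open>\<pp>\<close> is the image of \<open>J\<close> and \<open>J\<close> commutes
  with \<open>ad \<gg>\<close>, an element central in \<open>\<gg>\<close> also commutes with
  \<open>\<pp>\<close>; effectiveness then kills it.\<close>

lemma fixed_center:
  assumes "x \<in> \<gg>" "\<And>y. y \<in> \<gg> \<Longrightarrow> br x y = 0" shows "x = 0"
proof -
  have "br x z = 0" if z: "z \<in> V" for z
  proof -
    obtain y w where yw: "y \<in> \<gg>" "w \<in> \<pp>" "z = y + w"
      using split_parts[OF z] by blast
    obtain v where v: "v \<in> \<gg>" "w = J v" using J_surj[OF yw(2)] by blast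
    show ?thesis
      using assms yw v by (simp add: br_J_right)
  qed
  then have "x \<in> \<gg> \<inter> lie_center V br"
    using assms(1) by (simp add: lie_center_def)
  then show ?thesis
    using eff unfolding effective_def by blast
qed

lemma center_eqI:
  assumes "a \<in> \<gg>" "b \<in> \<gg>" "\<And>y. y \<in> \<gg> \<Longrightarrow> br a y = br b y" shows "a = b"
  using fixed_center[of "a - b"] assms by simp

text \<open>If \<open>y\<close> is orthogonal to all brackets of \<open>W\<close>, then
  \<open>B (br y x) (br y x) = B y (br x (br y x)) = 0\<close>, so \<open>y\<close> is central in
  \<open>W\<close>. The formulation with an arbitrary subspace \<open>S\<close> is an induction
  principle for linear statements; it is used for \<open>\<gg>\<close> and for the summands of a
  decomposition.\<close>

lemma perfect:
  assumes W: "subspace W" "W \<subseteq> \<gg>" "\<And>x y. x \<in> W \<Longrightarrow> y \<in> W \<Longrightarrow> br x y \<in> W"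
    and center: "\<And>x. x \<in> W \<Longrightarrow> (\<And>y. y \<in> W \<Longrightarrow> br x y = 0) \<Longrightarrow> x = 0"
    and S: "subspace S" "\<And>x y. x \<in> W \<Longrightarrow> y \<in> W \<Longrightarrow> br x y \<in> S"
  shows "W \<subseteq> S"
proof -
  interpret W: inner_space W B
    by (rule B.inner_space_subset[OF W(1,2)])
  have "W \<inter> S = W"
  proof (rule W.subspace_eq_if_no_orthogonal)
    show "subspace (W \<inter> S)" by (rule subspace_inter[OF W(1) S(1)])
    fix y assume y: "y \<in> W" "\<And>x. x \<in> W \<inter> S \<Longrightarrow> B y x = 0"
    show "y = 0"
    proof (rule center[OF y(1)])
      fix x assume x: "x \<in> W"
      have "B (br y x) (br y x) = B y (br x (br y x))"
        by (rule B_invariant) (use x y W in \<open>auto simp: subset_iff\<close>)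
      also have "\<dots> = 0"
        using y(2)[of "br x (br y x)"] x y(1) W(3) S(2) by simp
      finally show "br y x = 0"
        using W.eq_0_iff[of "br y x"] W(3) x y(1) by simp
    qed
  qed simp
  then show ?thesis by blast
qed

lemma fixed_perfect: "subspace S \<Longrightarrow> (\<And>x y. x \<in> \<gg> \<Longrightarrow> y \<in> \<gg> \<Longrightarrow> br x y \<in> S) \<Longrightarrow> \<gg> \<subseteq> S"
  by (rule perfect) (auto intro: subspace_fixed fixed_center)

text \<open>Acting by \<open>ad\<close> on \<open>\<pp>\<close>, this element is up to sign the
  curvature operator of the associated symmetric space, with arguments read in \<open>\<gg>\<close>
  through \<open>J\<close>.\<close>

definition curv :: "'a \<Rightarrow> 'a \<Rightarrow> 'a" where "curv x y = br (J x) (J y)"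

lemma curv_fixed [simp]: "x \<in> \<gg> \<Longrightarrow> y \<in> \<gg> \<Longrightarrow> curv x y \<in> \<gg>"
  by (simp add: curv_def br_anti_anti J_anti)

lemma curv_anti: "x \<in> \<gg> \<Longrightarrow> y \<in> \<gg> \<Longrightarrow> curv x y = - curv y x"
  unfolding curv_def by (rule br_anti) auto

lemma curv_simps:
  assumes "x \<in> \<gg>" "y \<in> \<gg>"
  shows "z \<in> \<gg> \<Longrightarrow> curv (x + z) y = curv x y + curv z y"
    "curv (c *\<^sub>R x) y = c *\<^sub>R curv x y" "curv (- x) y = - curv x y" "curv x (- y) = - curv x y"
  using assms by (simp_all add: curv_def)

lemma curv_equivariant:
  assumes "w \<in> \<gg>" "y \<in> \<gg>" "z \<in> \<gg>"
  shows "br w (curv y z) = curv (br w y) z + curv y (br w z)"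
proof -
  have "br w (curv y z) + br (J y) (br (J z) w) + br (J z) (br w (J y)) = 0"
    using jacobi[of w "J y" "J z"] assms by (simp add: curv_def)
  then have "br w (curv y z) + curv y (br z w) + curv z (br w y) = 0"
    using assms by (simp add: br_J_left br_J_right curv_def)
  moreover have "curv y (br z w) = - curv y (br w z)"
    using assms br_anti[of z w] curv_simps(4) by simp
  moreover have "curv z (br w y) = - curv (br w y) z"
    using assms by (intro curv_anti) auto
  ultimately show ?thesis by (simp add: algebra_simps)
qed

text \<open>The Jacobi identity for \<open>J x\<close>, \<open>J y\<close>, \<open>J z\<close>
  becomes, after removing \<open>J\<close>, the vanishing of the cyclic sum of
  \<open>br x (curv y z)\<close>. Equivariance splits each term in two, and the six terms add up to
  twice the cyclic sum of \<open>curv (br y z) x\<close>. That sum therefore vanishes, and two of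
  its terms recombine to \<open>br x (curv y z)\<close>.\<close>

lemma curv_br_eq_br_curv:
  assumes x: "x \<in> \<gg>" and y: "y \<in> \<gg>" and z: "z \<in> \<gg>"
  shows "curv (br y z) x = br (curv y z) x"
proof -
  have "br (J x) (curv y z) + br (J y) (curv z x) + br (J z) (curv x y) = 0"
    using jacobi[of "J x" "J y" "J z"] assms by (simp add: curv_def)
  then have "J (br x (curv y z) + br y (curv z x) + br z (curv x y)) = J 0"
    using assms by (simp add: br_J_left)
  then have cyc: "br x (curv y z) + br y (curv z x) + br z (curv x y) = 0"
    by (rule J_inj[rotated 2]) (use assms in auto)
  have *: "br u (curv v w) = curv (br u v) w + curv (br w u) v"
    if "u \<in> \<gg>" "v \<in> \<gg>" "w \<in> \<gg>" for u v w
  proof -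
    have "curv v (br u w) = - curv (br u w) v"
      using that by (intro curv_anti) auto
    also have "\<dots> = curv (br w u) v"
      using that br_anti[of u w] curv_simps(3)[of "br w u" v] by simp
    finally show ?thesis
      using curv_equivariant[OF that] by simp
  qed
  have "2 *\<^sub>R (curv (br x y) z + curv (br y z) x + curv (br z x) y) = 0"
    using cyc *[OF x y z] *[OF y z x] *[OF z x y] by (simp add: scaleR_2 algebra_simps)
  then have "curv (br x y) z + curv (br y z) x + curv (br z x) y = 0"
    unfolding scaleR_eq_0_iff by simp
  then have "curv (br y z) x = - (curv (br x y) z + curv (br z x) y)"
    by (simp add: eq_neg_iff_add_eq_0 algebra_simps)
  also have "\<dots> = - br x (curv y z)"
    by (simp add: *[OF x y z])
  also have "\<dots> = br (curv y z) x"
    using assms br_anti[of "curv y z" x] by simp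
  finally show ?thesis .
qed

text \<open>By the previous lemma \<open>curv w\<close> is inner for every bracket \<open>w\<close>, hence for every
  \<open>w\<close>, since \<open>\<gg>\<close> is perfect.\<close>

lemma curvature_operator:
  "\<exists>A. lin_on \<gg> A \<and> (\<forall>x\<in>\<gg>. A x \<in> \<gg>) \<and> (\<forall>x\<in>\<gg>. \<forall>y\<in>\<gg>. A (br x y) = br (A x) y) \<and>
    (\<forall>x\<in>\<gg>. \<forall>y\<in>\<gg>. br (J x) (J y) = br (A x) y) \<and> (\<forall>x\<in>\<gg>. \<forall>y\<in>\<gg>. B (A x) y = B x (A y))"
proof -
  define S where "S = {w \<in> \<gg>. \<exists>a\<in>\<gg>. \<forall>x\<in>\<gg>. curv w x = br a x}"
  have "subspace S"
    unfolding subspace_def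
  proof (intro conjI ballI allI)
    show "0 \<in> S"
      using subspace_0[OF subspace_fixed] by (auto simp: S_def curv_def intro!: bexI[of _ 0])
  next
    fix v w assume "v \<in> S" "w \<in> S"
    then obtain a b where "v \<in> \<gg>" "w \<in> \<gg>" "a \<in> \<gg>" "b \<in> \<gg>" "\<And>x. x \<in> \<gg> \<Longrightarrow> curv v x = br a x"
      "\<And>x. x \<in> \<gg> \<Longrightarrow> curv w x = br b x" by (auto simp: S_def)
    then show "v + w \<in> S"
      by (auto simp: S_def curv_simps intro!: bexI[of _ "a + b"])
  next
    fix c w assume "w \<in> S"
    then obtain a where "w \<in> \<gg>" "a \<in> \<gg>" "\<And>x. x \<in> \<gg> \<Longrightarrow> curv w x = br a x"
      by (auto simp: S_def)
    then show "c *\<^sub>R w \<in> S"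
      by (auto simp: S_def curv_simps intro!: bexI[of _ "c *\<^sub>R a"])
  qed
  moreover have "br y z \<in> S" if "y \<in> \<gg>" "z \<in> \<gg>" for y z
    using that curv_br_eq_br_curv by (auto simp: S_def intro!: bexI[of _ "curv y z"])
  ultimately have "\<gg> \<subseteq> S"
    by (rule fixed_perfect)
  then have "\<forall>w\<in>\<gg>. \<exists>a. a \<in> \<gg> \<and> (\<forall>x\<in>\<gg>. curv w x = br a x)"
    by (auto simp: S_def)
  from bchoice[OF this] obtain A where "\<forall>w\<in>\<gg>. A w \<in> \<gg> \<and> (\<forall>x\<in>\<gg>. curv w x = br (A w) x)" ..
  then have A: "\<And>w. w \<in> \<gg> \<Longrightarrow> A w \<in> \<gg>" "\<And>w x. w \<in> \<gg> \<Longrightarrow> x \<in> \<gg> \<Longrightarrow> curv w x = br (A w) x"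
    by blast+
  \<comment> \<open>\<open>A\<close> was obtained by choice, but \<open>A x\<close> is determined by
    its brackets because \<open>\<gg>\<close> has no center; this forces linearity.\<close>
  have "A (x + y) = A x + A y" if "x \<in> \<gg>" "y \<in> \<gg>" for x y
    by (rule center_eqI) (use that A(1) in \<open>simp_all add: A(2)[symmetric] curv_simps\<close>)
  moreover have "A (c *\<^sub>R x) = c *\<^sub>R A x" if "x \<in> \<gg>" for c x
    by (rule center_eqI) (use that A(1) in \<open>simp_all add: A(2)[symmetric] curv_simps\<close>)
  ultimately have lin: "lin_on \<gg> A"
    by (simp add: lin_on_def)
  have A_br: "A (br x y) = curv x y" if "x \<in> \<gg>" "y \<in> \<gg>" for x y
    by (rule center_eqI) (use that A(1) in \<open>simp_all add: A(2)[symmetric] curv_br_eq_br_curv\<close>)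
  have selfadj: "B (A x) y = B x (A y)" if xy: "x \<in> \<gg>" "y \<in> \<gg>" for x y
  proof -
    have "subspace {x \<in> \<gg>. B (A x) y = B x (A y)}"
      using xy(2) A(1) B.lin_left
      by (intro lin_on_eq_subspace[OF subspace_fixed] lin_on_compose[OF lin]) auto
    moreover have "B (A (br a b)) y = B (br a b) (A y)" if ab: "a \<in> \<gg>" "b \<in> \<gg>" for a b
    proof -
      \<comment> \<open>On a bracket the value of \<open>A\<close> is a bracket of two elements of
        \<open>\<pp>\<close>, so invariance of \<open>\<Lambda>\<close> can move \<open>J a\<close>
        over to \<open>J y\<close>, where \<open>A y\<close> appears.\<close>
      have "B (A (br a b)) y = \<Lambda> (J y) (curv a b)"
        using ab xy(2) \<Lambda>_J[of y "curv a b"] B.sym[of "curv a b" y] by (simp add: A_br)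
      also have "\<dots> = \<Lambda> (br (J y) (J a)) (J b)"
        using ab xy(2) by (simp add: \<Lambda>_invariant curv_def)
      also have "\<dots> = B b (br (A y) a)"
        using ab xy(2) A \<Lambda>_sym[of "br (J y) (J a)" "J b"] \<Lambda>_J[of b "curv y a"]
        by (simp add: curv_def[symmetric])
      also have "\<dots> = B (br a b) (A y)"
        using ab xy(2) A(1) B_invariant[of "A y" a b] B.sym[of b "br (A y) a"] B.sym[of "A y" "br a b"]
        by simp
      finally show ?thesis .
    qed
    ultimately have "\<gg> \<subseteq> {x \<in> \<gg>. B (A x) y = B x (A y)}"
      by (intro fixed_perfect) auto
    then show ?thesis using xy(1) by blast
  qed
  show ?thesis
    using lin A(1) selfadj
    by (intro exI[of _ A] conjI) (simp_all add: A_br A(2)[symmetric], simp add: curv_def)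
qed

end

text \<open>\<open>\<sigma>_cube\<close> says that the polynomial \<open>t^3 - t\<close> annihilates
  \<open>\<sigma>\<close>; the projections onto its eigenspaces are then polynomials in
  \<open>\<sigma>\<close>.\<close>

locale normal_form = framed_legendrian V br s \<Lambda> B J
  for V :: "'a::euclidean_space set" and br s \<Lambda> B J +
  fixes \<sigma> :: "'a \<Rightarrow> 'a"
  assumes \<sigma>_lin: "lin_on \<gg> \<sigma>"
    and \<sigma>_fixed [simp]: "x \<in> \<gg> \<Longrightarrow> \<sigma> x \<in> \<gg>"
    and \<sigma>_cube: "x \<in> \<gg> \<Longrightarrow> \<sigma> (\<sigma> (\<sigma> x)) = \<sigma> x"
    and \<sigma>_br: "\<lbrakk>x \<in> \<gg>; y \<in> \<gg>\<rbrakk> \<Longrightarrow> \<sigma> (br x y) = br (\<sigma> x) y"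
    and br_J_J: "\<lbrakk>x \<in> \<gg>; y \<in> \<gg>\<rbrakk> \<Longrightarrow> br (J x) (J y) = \<sigma> (br x y)"

text \<open>With \<open>J' = J R\<close> and \<open>B' x y = B (R x) y\<close>, the relation between
  \<open>J\<close> and \<open>B\<close> is kept. As \<open>R\<close> commutes with brackets and with
  \<open>A\<close>, the bracket of \<open>J' x\<close> and \<open>J' y\<close> is
  \<open>A R R\<close> applied to \<open>br x y\<close>.\<close>

lemma (in framed_legendrian) normal_form_exists:
  obtains B' J' \<sigma> where "normal_form V br s \<Lambda> B' J' \<sigma>"
proof -
  obtain A where A: "lin_on \<gg> A" "\<And>x. x \<in> \<gg> \<Longrightarrow> A x \<in> \<gg>"
    "\<And>x y. x \<in> \<gg> \<Longrightarrow> y \<in> \<gg> \<Longrightarrow> A (br x y) = br (A x) y"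
    "\<And>x y. x \<in> \<gg> \<Longrightarrow> y \<in> \<gg> \<Longrightarrow> br (J x) (J y) = br (A x) y"
    "\<And>x y. x \<in> \<gg> \<Longrightarrow> y \<in> \<gg> \<Longrightarrow> B (A x) y = B x (A y)"
  proof -
    obtain A where "lin_on \<gg> A" "\<forall>x\<in>\<gg>. A x \<in> \<gg>" "\<forall>x\<in>\<gg>. \<forall>y\<in>\<gg>. A (br x y) = br (A x) y"
      "\<forall>x\<in>\<gg>. \<forall>y\<in>\<gg>. br (J x) (J y) = br (A x) y" "\<forall>x\<in>\<gg>. \<forall>y\<in>\<gg>. B (A x) y = B x (A y)"
      using curvature_operator by (elim exE conjE) (rule that; assumption)
    then show ?thesis
      by - (rule that[of A]; blast)
  qed
  obtain R where R: "lin_on \<gg> R" "\<And>x. x \<in> \<gg> \<Longrightarrow> R x \<in> \<gg>"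
    "\<And>x y. x \<in> \<gg> \<Longrightarrow> y \<in> \<gg> \<Longrightarrow> B (R x) y = B x (R y)"
    "\<And>x. x \<in> \<gg> \<Longrightarrow> x \<noteq> 0 \<Longrightarrow> B (R x) x > 0"
    "\<And>D x. \<lbrakk>lin_on \<gg> D; \<And>x. x \<in> \<gg> \<Longrightarrow> D x \<in> \<gg>; \<And>x. x \<in> \<gg> \<Longrightarrow> A (D x) = D (A x); x \<in> \<gg>\<rbrakk>
      \<Longrightarrow> R (D x) = D (R x)"
    "\<And>x. x \<in> \<gg> \<Longrightarrow> A (R (R (A (R (R (A (R (R x)))))))) = A (R (R x))"
  proof -
    have "\<exists>R. lin_on \<gg> R \<and> (\<forall>x\<in>\<gg>. R x \<in> \<gg>) \<and> (\<forall>x\<in>\<gg>. \<forall>y\<in>\<gg>. B (R x) y = B x (R y)) \<and>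
      (\<forall>x\<in>\<gg>. x \<noteq> 0 \<longrightarrow> B (R x) x > 0) \<and>
      (\<forall>D. lin_on \<gg> D \<longrightarrow> (\<forall>x\<in>\<gg>. D x \<in> \<gg>) \<longrightarrow> (\<forall>x\<in>\<gg>. A (D x) = D (A x)) \<longrightarrow>
        (\<forall>x\<in>\<gg>. R (D x) = D (R x))) \<and>
      (\<forall>x\<in>\<gg>. A (R (R (A (R (R (A (R (R x)))))))) = A (R (R x)))"
      by (rule B.functional_calculus[OF A(1)]) (use A in auto)
    then obtain R where "lin_on \<gg> R" "\<forall>x\<in>\<gg>. R x \<in> \<gg>" "\<forall>x\<in>\<gg>. \<forall>y\<in>\<gg>. B (R x) y = B x (R y)"
      "\<forall>x\<in>\<gg>. x \<noteq> 0 \<longrightarrow> B (R x) x > 0"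
      "\<forall>D. lin_on \<gg> D \<longrightarrow> (\<forall>x\<in>\<gg>. D x \<in> \<gg>) \<longrightarrow> (\<forall>x\<in>\<gg>. A (D x) = D (A x)) \<longrightarrow>
        (\<forall>x\<in>\<gg>. R (D x) = D (R x))"
      "\<forall>x\<in>\<gg>. A (R (R (A (R (R (A (R (R x)))))))) = A (R (R x))"
      by (elim exE conjE) (rule that; assumption)
    then show ?thesis
      by - (rule that[of R]; blast)
  qed
  have RA: "R (A x) = A (R x)" if "x \<in> \<gg>" for x
    by (rule R(5)) (use A that in auto)
  \<comment> \<open>Here \<open>D\<close> is the bracket with the fixed element \<open>y\<close>,
    which commutes with \<open>A\<close>.\<close>
  have Rbr: "R (br x y) = br (R x) y" if xy: "x \<in> \<gg>" "y \<in> \<gg>" for x y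
  proof (rule R(5)[OF _ _ _ xy(1)])
    show "lin_on \<gg> (\<lambda>x. br x y)"
      by (rule lin_on_subset[OF bilin_on_left[OF br_bilinear]]) (use xy in auto)
  qed (use xy A in auto)
  have Rbr': "br x (R y) = R (br x y)" if xy: "x \<in> \<gg>" "y \<in> \<gg>" for x y
    using xy R(2) br_anti[of x "R y"] br_anti[of x y] Rbr[of y x]
    by (simp add: lin_on_uminus[OF R(1)])
  define \<sigma> where "\<sigma> x = A (R (R x))" for x
  define B' where "B' x y = B (R x) y" for x y
  define J' where "J' x = J (R x)" for x
  have lin_\<sigma>: "lin_on \<gg> \<sigma>"
    unfolding \<sigma>_def
    by (rule lin_on_compose[OF R(1) lin_on_compose[OF R(1) A(1) R(2)] R(2)])
  have bil: "bilin_on \<gg> B'"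
    unfolding bilin_on_def B'_def
  proof (intro conjI ballI)
    fix x assume x: "x \<in> \<gg>"
    show "lin_on \<gg> (\<lambda>y. B (R x) y)"
      by (rule B.lin_right[OF R(2)[OF x]])
    show "lin_on \<gg> (\<lambda>y. B (R y) x)"
      by (rule lin_on_compose[OF R(1) B.lin_left[OF x] R(2)])
  qed
  have linJ: "lin_on \<gg> J'"
    unfolding J'_def by (rule lin_on_compose[OF R(1) J_lin R(2)])
  have "normal_form V br s \<Lambda> B' J' \<sigma>"
  proof (unfold_locales)
    show "bilin_on \<gg> B'" "lin_on \<gg> J'" "lin_on \<gg> \<sigma>" "subspace \<gg>" "effective V br s"
      by (rule bil linJ lin_\<sigma> subspace_fixed eff)+
    fix x y assume xy: "x \<in> \<gg>" "y \<in> \<gg>"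
    show "B' x y = B' y x"
      using xy R(2,3) B.sym[of x "R y"] by (simp add: B'_def)
    show "J' x \<in> \<pp>"
      using xy R(2) by (simp add: J'_def J_anti)
    show "\<Lambda> (J' x) y = B' x y"
      using xy R(2) by (simp add: J'_def B'_def \<Lambda>_J)
    show "\<sigma> x \<in> \<gg>"
      using xy A(2) R(2) by (simp add: \<sigma>_def)
    show "\<sigma> (\<sigma> (\<sigma> x)) = \<sigma> x"
      using R(6)[OF xy(1)] by (simp add: \<sigma>_def)
    show "\<sigma> (br x y) = br (\<sigma> x) y"
      using xy A R(2) by (simp add: \<sigma>_def Rbr)
    show "br (J' x) (J' y) = \<sigma> (br x y)"
      using xy A R(2) by (simp add: \<sigma>_def J'_def Rbr Rbr' RA)
    fix z assume z: "z \<in> \<gg>"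
    show "B' (br x y) z = B' x (br y z)"
      using xy z R(2) by (simp add: B'_def Rbr B_invariant)
  next
    fix x assume "x \<in> \<gg>" "x \<noteq> 0"
    then show "0 < B' x x" using R(4) by (simp add: B'_def)
  qed
  then show ?thesis by (rule that)
qed

section \<open>Existence of the decomposition\<close>

lemma sum_diff_eqD:
  fixes x y u v :: "'a::real_vector"
  assumes "x + y = u + v" "x - y = u - v" shows "x = u \<and> y = v"
proof -
  have "2 *\<^sub>R x = (x + y) + (x - y)" "2 *\<^sub>R u = (u + v) + (u - v)"
    by (simp_all add: scaleR_2)
  then have "2 *\<^sub>R x = 2 *\<^sub>R u"
    by (simp only: assms)
  then show ?thesis using assms(1) by simp
qed

lemma subspace_lin_on_image:
  assumes "subspace V" "lin_on V f" shows "subspace (f ` V)"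
  unfolding subspace_def
proof (intro conjI allI ballI)
  show "0 \<in> f ` V"
    using lin_on_zero[OF assms(2,1)] subspace_0[OF assms(1)] by (metis image_eqI)
  fix u v c assume "u \<in> f ` V" "v \<in> f ` V"
  then obtain x y where "x \<in> V" "y \<in> V" "u = f x" "v = f y" by blast
  then have "u + v = f (x + y)" "c *\<^sub>R u = f (c *\<^sub>R x)" "x + y \<in> V" "c *\<^sub>R x \<in> V"
    using assms by (simp_all add: lin_on_add lin_on_scaleR subspace_add subspace_scale)
  then show "u + v \<in> f ` V" "c *\<^sub>R u \<in> f ` V" by blast+
qed

lemma direct_sum3I:
  assumes "\<And>i. subspace (A i)" "\<And>i. A i \<subseteq> V"
    and ex: "\<And>x. x \<in> V \<Longrightarrow> \<exists>a. (\<forall>i. a i \<in> A i) \<and> x = a Null + a Pos + a Neg"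
    and indep: "\<And>a i. \<lbrakk>\<And>i. a i \<in> A i; a Null + a Pos + a Neg = 0\<rbrakk> \<Longrightarrow> a i = 0"
  shows "direct_sum3 V A"
  unfolding direct_sum3_def
proof (intro conjI allI ballI)
  fix x assume "x \<in> V"
  then obtain a where a: "\<forall>i. a i \<in> A i" "x = a Null + a Pos + a Neg"
    using ex by blast
  show "\<exists>!a. (\<forall>i. a i \<in> A i) \<and> x = a Null + a Pos + a Neg"
  proof (rule ex1I)
    show "(\<forall>i. a i \<in> A i) \<and> x = a Null + a Pos + a Neg" using a by blast
    fix b assume b: "(\<forall>i. b i \<in> A i) \<and> x = b Null + b Pos + b Neg"
    have "b i - a i = 0" for i
    proof (rule indep[of "\<lambda>i. b i - a i"])
      show "b i - a i \<in> A i" for i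
        using a b assms(1) subspace_diff by blast
      have "a Null + a Pos + a Neg = b Null + b Pos + b Neg"
        using a b by simp
      then show "(b Null - a Null) + (b Pos - a Pos) + (b Neg - a Neg) = 0"
        by (simp add: algebra_simps)
    qed
    then show "b = a" by (simp add: fun_eq_iff)
  qed
qed (use assms in auto)

lemma direct_sum3_ex:
  assumes "direct_sum3 V A" "x \<in> V"
  obtains a where "\<And>i. a i \<in> A i" "x = a Null + a Pos + a Neg"
  using assms unfolding direct_sum3_def by blast

lemma direct_sum3_single:
  assumes "direct_sum3 V A" "\<And>j. a j \<in> A j" "x = a Null + a Pos + a Neg" "x \<in> A i"
  shows "a i = x"
proof -
  have sub: "subspace (A j)" "A j \<subseteq> V" for j
    using assms(1) by (auto simp: direct_sum3_def)
  define b where "b j = (if j = i then x else 0)" for j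
  have "b j \<in> A j" for j
    using assms(4) subspace_0[OF sub(1)] by (simp add: b_def)
  moreover have "x = b Null + b Pos + b Neg"
    by (cases i) (auto simp: b_def)
  moreover have "x \<in> V" using assms(4) sub(2) by blast
  ultimately have "a = b"
    using assms unfolding direct_sum3_def by blast
  then show ?thesis by (simp add: b_def)
qed

lemma direct_sum3_disjoint:
  assumes "direct_sum3 V A" "i \<noteq> j" "x \<in> A i" "x \<in> A j"
  shows "x = 0"
proof -
  have sub: "subspace (A j)" for j
    using assms(1) by (auto simp: direct_sum3_def)
  define b where "b k = (if k = i then x else 0)" for k
  have "b j = x"
  proof (rule direct_sum3_single[OF assms(1) _ _ assms(4)])
    show "b k \<in> A k" for k
      using assms(3) subspace_0[OF sub] by (simp add: b_def)
    show "x = b Null + b Pos + b Neg"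
      by (cases i) (auto simp: b_def)
  qed
  then show ?thesis using assms(2) by (simp add: b_def split: if_splits)
qed

text \<open>An isomorphism requires its target to satisfy all axioms. Pushing them forward along
  \<open>\<phi>\<close> verifies them for the three models in one argument.\<close>

lemma legendrian_transport:
  fixes V :: "'a::euclidean_space set" and \<phi> :: "'a \<Rightarrow> 'b::real_vector"
  assumes V: "legendrian_lie_algebra V br s \<Lambda>"
    and lin: "lin_on V \<phi>" and inj: "inj_on \<phi> V"
    and br: "\<And>x y. x \<in> V \<Longrightarrow> y \<in> V \<Longrightarrow> \<phi> (br x y) = br' (\<phi> x) (\<phi> y)"
    and s: "\<And>x. x \<in> V \<Longrightarrow> \<phi> (s x) = s' (\<phi> x)"
    and \<Lambda>: "\<And>x y. x \<in> V \<Longrightarrow> y \<in> V \<Longrightarrow> \<Lambda>' (\<phi> x) (\<phi> y) = \<Lambda> x y"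
  shows "legendrian_isomorphism V br s \<Lambda> (\<phi> ` V) br' s' \<Lambda>' \<phi>"
proof -
  interpret legendrian_lie_algebra V br s \<Lambda> by (rule V)
  have add: "\<phi> x + \<phi> y = \<phi> (x + y)" if "x \<in> V" "y \<in> V" for x y
    using lin_on_add[OF lin that] by simp
  have scale: "c *\<^sub>R \<phi> x = \<phi> (c *\<^sub>R x)" if "x \<in> V" for x c
    using lin_on_scaleR[OF lin that] by simp
  have zero: "\<phi> 0 = 0"
    by (rule lin_on_zero[OF lin subspace_carrier])
  note [simp] = br[symmetric] s[symmetric] \<Lambda> add scale s_closed s_simps
  have sub: "subspace (\<phi> ` V)"
    by (rule subspace_lin_on_image[OF subspace_carrier lin])
  have fin: "\<exists>S. finite S \<and> span S = \<phi> ` V"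
  proof -
    obtain S where S: "finite S" "span S = V" using finite_dim by blast
    obtain g where g: "linear g" "\<And>x. x \<in> V \<Longrightarrow> g x = \<phi> x"
      using lin_on_extension[OF subspace_carrier lin] by blast
    have "span (g ` S) = \<phi> ` V"
      unfolding linear_span_image[OF g(1)] S(2) using g(2) by (rule image_cong[OF refl])
    then show ?thesis using S(1) by blast
  qed
  have "legendrian_lie_algebra (\<phi> ` V) br' s' \<Lambda>'"
  proof (unfold_locales)
    show "bilin_on (\<phi> ` V) br'" "bilin_on (\<phi> ` V) \<Lambda>'" "lin_on (\<phi> ` V) s'"
      by (auto simp: bilin_on_def lin_on_def)
  next
    fix u v w assume "u \<in> \<phi> ` V" "v \<in> \<phi> ` V" "w \<in> \<phi> ` V"
    then obtain x y z where xyz: "x \<in> V" "y \<in> V" "z \<in> V" "u = \<phi> x" "v = \<phi> y" "w = \<phi> z"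
      by blast
    show "br' u (br' v w) + br' v (br' w u) + br' w (br' u v) = 0"
      using xyz jacobi[of x y z] zero by simp
    show "\<Lambda>' (br' u v) w = \<Lambda>' u (br' v w)"
      using xyz \<Lambda>_invariant[of x y z] by simp
  next
    fix u v assume "u \<in> \<phi> ` V" "v \<in> \<phi> ` V"
    then obtain x y where xy: "x \<in> V" "y \<in> V" "u = \<phi> x" "v = \<phi> y"
      by blast
    show "br' u v \<in> \<phi> ` V"
      using xy by simp
    show "s' (br' u v) = br' (s' u) (s' v)"
      using xy by (simp add: s_bracket)
    show "\<Lambda>' u v = \<Lambda>' v u"
      using xy \<Lambda>_sym[of x y] by simp
    show "\<Lambda>' (s' u) v = - \<Lambda>' u (s' v)"
      using xy \<Lambda>_s[of x y] by simp
  next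
    fix u assume "u \<in> \<phi> ` V"
    then obtain x where x: "x \<in> V" "u = \<phi> x"
      by blast
    show "br' u u = 0"
      using x zero by (simp add: br_alternating)
    show "s' u \<in> \<phi> ` V" "s' (s' u) = u"
      using x by (simp_all add: s_involutive)
    assume "\<forall>v\<in>\<phi> ` V. \<Lambda>' u v = 0"
    then show "u = 0"
      using x zero \<Lambda>_nondegenerate[of x] by simp
  qed (fact sub fin)+
  then show ?thesis
    using V lin inj br s \<Lambda> by (auto simp: legendrian_isomorphism_def bij_betw_def)
qed

text \<open>The eigenvalue of \<open>\<sigma>\<close> belonging to each part.\<close>

primrec eps :: "part \<Rightarrow> real" where
  "eps Null = 0" | "eps Pos = 1" | "eps Neg = - 1"

context normal_form
begin

declare \<sigma>_br [simp]

lemma \<sigma>_simps [simp]: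
  assumes "x \<in> \<gg>"
  shows "y \<in> \<gg> \<Longrightarrow> \<sigma> (x + y) = \<sigma> x + \<sigma> y" "y \<in> \<gg> \<Longrightarrow> \<sigma> (x - y) = \<sigma> x - \<sigma> y"
    "\<sigma> (c *\<^sub>R x) = c *\<^sub>R \<sigma> x" "\<sigma> (- x) = - \<sigma> x"
  using assms lin_on_add[OF \<sigma>_lin] lin_on_diff[OF \<sigma>_lin subspace_fixed]
    lin_on_scaleR[OF \<sigma>_lin] lin_on_uminus[OF \<sigma>_lin] by auto

definition gpart :: "part \<Rightarrow> 'a set" where "gpart i = {x \<in> \<gg>. \<sigma> x = eps i *\<^sub>R x}"

definition ppart :: "part \<Rightarrow> 'a set" where "ppart i = J ` gpart i"

definition hpart :: "part \<Rightarrow> 'a set" where "hpart i = {x + J y | x y. x \<in> gpart i \<and> y \<in> gpart i}"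

lemma gpart_fixed [simp]: "x \<in> gpart i \<Longrightarrow> x \<in> \<gg>"
  by (simp add: gpart_def)

lemma \<sigma>_gpart: "x \<in> gpart i \<Longrightarrow> \<sigma> x = eps i *\<^sub>R x"
  unfolding gpart_def by blast

lemma subspace_gpart: "subspace (gpart i)"
  unfolding gpart_def
  by (rule lin_on_eq_subspace[OF subspace_fixed \<sigma>_lin lin_on_linear[OF linear_scaleR]])

lemmas gpart_mem [simp] = subspace_add[OF subspace_gpart] subspace_diff[OF subspace_gpart]
  subspace_scale[OF subspace_gpart] subspace_neg[OF subspace_gpart] subspace_0[OF subspace_gpart]

lemma gpart_ideal [simp]:
  assumes "x \<in> \<gg>" "y \<in> gpart i"
  shows "br y x \<in> gpart i" "br x y \<in> gpart i"
proof -
  have "y \<in> \<gg>" "\<sigma> y = eps i *\<^sub>R y"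
    using assms(2) \<sigma>_gpart by auto
  then show *: "br y x \<in> gpart i"
    using assms(1) by (simp add: gpart_def del: gpart_fixed)
  show "br x y \<in> gpart i"
    using subspace_neg[OF subspace_gpart *] br_anti[of x y] assms by simp
qed

lemma \<sigma>_in_gpart [simp]: "x \<in> gpart i \<Longrightarrow> \<sigma> x \<in> gpart i"
  by (simp add: \<sigma>_gpart)

lemma gpart_decomposition: "direct_sum3 \<gg> gpart"
proof (rule direct_sum3I)
  fix x assume x: "x \<in> \<gg>"
  \<comment> \<open>The Lagrange interpolation polynomials at 0, 1 and -1, evaluated at
    \<open>\<sigma>\<close>: \<open>1 - t^2\<close>, \<open>(t^2 + t)/2\<close> and
    \<open>(t^2 - t)/2\<close>.\<close>
  define a where "a i = (case i of Null \<Rightarrow> x - \<sigma> (\<sigma> x)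
    | Pos \<Rightarrow> (1/2) *\<^sub>R (\<sigma> (\<sigma> x) + \<sigma> x) | Neg \<Rightarrow> (1/2) *\<^sub>R (\<sigma> (\<sigma> x) - \<sigma> x))" for i
  have "a i \<in> gpart i" for i
    using x by (cases i) (simp_all add: a_def gpart_def \<sigma>_cube algebra_simps del: gpart_fixed)
  moreover have "x = a Null + a Pos + a Neg"
    by (simp add: a_def algebra_simps flip: scaleR_add_left)
  ultimately show "\<exists>a. (\<forall>i. a i \<in> gpart i) \<and> x = a Null + a Pos + a Neg"
    by blast
next
  fix a i assume a: "\<And>i. a i \<in> gpart i" "a Null + a Pos + a Neg = 0"
  have g: "a j \<in> \<gg>" for j by (rule gpart_fixed[OF a(1)])
  have "\<sigma> (a Null + a Pos + a Neg) = a Pos - a Neg"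
    using g \<sigma>_gpart[OF a(1)] by simp
  then have 1: "a Pos = a Neg"
    using a(2) lin_on_zero[OF \<sigma>_lin subspace_fixed] by simp
  have "a Pos \<in> gpart Pos" "a Pos \<in> gpart Neg"
    using a(1) 1 by (auto, metis)
  then have "a Pos = - a Pos"
    using \<sigma>_gpart by (metis eps.simps(2,3) scaleR_minus1_left scaleR_one)
  then have "2 *\<^sub>R a Pos = 0"
    by (metis add.right_inverse scaleR_2)
  then show "a i = 0"
    using a(2) 1 by (cases i) auto
qed (use subspace_gpart in auto)

lemma coords_ex:
  assumes "v \<in> V" obtains x y where "x \<in> \<gg>" "y \<in> \<gg>" "v = x + J y"
  using split_parts[OF assms] J_surj by metis

lemma coords_unique:
  assumes "x \<in> \<gg>" "y \<in> \<gg>" "x' \<in> \<gg>" "y' \<in> \<gg>" "x + J y = x' + J y'"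
  shows "x = x'" "y = y'"
proof -
  have "x - x' = J (y' - y)"
    using assms by (simp add: algebra_simps)
  moreover have "x - x' \<in> \<gg>" "J (y' - y) \<in> \<pp>"
    using assms(1-4) J_anti[of "y' - y"] by (simp_all del: J_simps)
  ultimately have "x - x' = 0"
    using fixed_anti_zero by metis
  then show "x = x'" by simp
  then show "y = y'"
    using assms J_inj by simp
qed

text \<open>The bracket is that of \<open>\<gg>\<close> with an adjoined unit \<open>j\<close>,
  represented by \<open>J\<close>, whose square acts as \<open>\<sigma>\<close>. For
  \<open>\<sigma>\<close> equal to 0, 1 or -1 the scalars are the dual, split-complex or complex
  numbers, and these give the three models.\<close>

lemma coords_simps:
  assumes "a \<in> \<gg>" "b \<in> \<gg>" "x \<in> \<gg>" "y \<in> \<gg>"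
  shows "br (a + J b) (x + J y) = (br a x + \<sigma> (br b y)) + J (br a y + br b x)"
    "\<Lambda> (a + J b) (x + J y) = B a y + B b x"
    "(a + J b) + (x + J y) = (a + x) + J (b + y)"
  using assms isotropic_fixed isotropic_anti[OF J_anti J_anti] \<Lambda>_sym[of a "J y"] B.sym[of a y]
  by (simp_all add: br_J_left br_J_right br_J_J \<Lambda>_J algebra_simps)

lemma coords_s: "a \<in> \<gg> \<Longrightarrow> b \<in> \<gg> \<Longrightarrow> s (a + J b) = a + J (- b)"
  and coords_scaleR: "a \<in> \<gg> \<Longrightarrow> b \<in> \<gg> \<Longrightarrow> c *\<^sub>R (a + J b) = c *\<^sub>R a + J (c *\<^sub>R b)"
  using antiD(2)[OF J_anti, of b] fixedD(2)[of a]
  by (simp_all add: s_simps scaleR_add_right)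

lemma hpartE:
  assumes "v \<in> hpart i" obtains x y where "x \<in> gpart i" "y \<in> gpart i" "v = x + J y"
  using assms by (auto simp: hpart_def)

lemma hpartI: "x \<in> gpart i \<Longrightarrow> y \<in> gpart i \<Longrightarrow> x + J y \<in> hpart i"
  by (auto simp: hpart_def)

lemma subspace_hpart: "subspace (hpart i)"
  unfolding subspace_def
proof (intro conjI ballI allI)
  show "0 \<in> hpart i"
    using hpartI[of 0 i 0] by simp
  fix v w c assume "v \<in> hpart i" "w \<in> hpart i"
  then obtain x y a b where "x \<in> gpart i" "y \<in> gpart i" "v = x + J y" "a \<in> gpart i" "b \<in> gpart i" "w = a + J b"
    by (elim hpartE)
  then show "v + w \<in> hpart i" "c *\<^sub>R v \<in> hpart i"
    using hpartI[of "x + a" i "y + b"] hpartI[of "c *\<^sub>R x" i "c *\<^sub>R y"]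
    by (simp_all add: algebra_simps)
qed

lemma hpart_subset: "hpart i \<subseteq> V"
  by (auto simp: hpart_def)

lemma hpart_ideal: "lie_ideal V br (hpart i)"
  unfolding lie_ideal_def
proof (intro conjI ballI subspace_hpart hpart_subset)
  fix v w assume v: "v \<in> V" and w: "w \<in> hpart i"
  obtain a b where ab: "a \<in> \<gg>" "b \<in> \<gg>" "v = a + J b"
    using coords_ex[OF v] .
  obtain x y where xy: "x \<in> gpart i" "y \<in> gpart i" "w = x + J y"
    using hpartE[OF w] .
  have "br v w = (br a x + \<sigma> (br b y)) + J (br a y + br b x)"
    unfolding ab(3) xy(3) by (rule coords_simps(1)) (use ab xy in auto)
  moreover have "\<dots> \<in> hpart i"
    using ab xy by (intro hpartI gpart_mem(1) \<sigma>_in_gpart gpart_ideal(2))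
  ultimately show "br v w \<in> hpart i" by simp
qed

lemma hpart_decomposition: "direct_sum3 V hpart"
proof (rule direct_sum3I)
  fix v assume "v \<in> V"
  then obtain x y where xy: "x \<in> \<gg>" "y \<in> \<gg>" "v = x + J y"
    by (rule coords_ex)
  obtain a where a: "\<And>i. a i \<in> gpart i" "x = a Null + a Pos + a Neg"
    using direct_sum3_ex[OF gpart_decomposition xy(1)] by blast
  obtain b where b: "\<And>i. b i \<in> gpart i" "y = b Null + b Pos + b Neg"
    using direct_sum3_ex[OF gpart_decomposition xy(2)] by blast
  have "a j \<in> \<gg>" "b j \<in> \<gg>" for j by (rule gpart_fixed[OF a(1)] gpart_fixed[OF b(1)])+
  then have "v = (a Null + J (b Null)) + (a Pos + J (b Pos)) + (a Neg + J (b Neg))"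
    using xy(3) a(2) b(2) by simp
  then show "\<exists>c. (\<forall>i. c i \<in> hpart i) \<and> v = c Null + c Pos + c Neg"
    using a(1) b(1) hpartI by (intro exI[of _ "\<lambda>i. a i + J (b i)"]) blast
next
  fix c i assume c: "\<And>i. c i \<in> hpart i" "c Null + c Pos + c Neg = 0"
  have "\<forall>i. \<exists>x y. x \<in> gpart i \<and> y \<in> gpart i \<and> c i = x + J y"
    using c(1) hpartE by metis
  then obtain a b where ab: "\<And>i. a i \<in> gpart i" "\<And>i. b i \<in> gpart i" "\<And>i. c i = a i + J (b i)"
    by metis
  have g: "a j \<in> \<gg>" "b j \<in> \<gg>" for j by (rule gpart_fixed[OF ab(1)] gpart_fixed[OF ab(2)])+
  have "(a Null + a Pos + a Neg) + J (b Null + b Pos + b Neg) = 0 + J 0"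
    using c(2) g by (simp add: ab(3) algebra_simps)
  from coords_unique[OF _ _ _ _ this]
  have 0: "a Null + a Pos + a Neg = 0" "b Null + b Pos + b Neg = 0"
    using g by auto
  have "a i = 0" "b i = 0"
    using direct_sum3_single[OF gpart_decomposition ab(1) 0(1)[symmetric] gpart_mem(5)]
      direct_sum3_single[OF gpart_decomposition ab(2) 0(2)[symmetric] gpart_mem(5)] by auto
  then show "c i = 0" by (simp add: ab(3))
qed (use subspace_hpart hpart_subset in auto)

lemma subspace_ppart: "subspace (ppart i)"
  unfolding ppart_def
  by (rule subspace_lin_on_image[OF subspace_gpart lin_on_subset[OF J_lin]]) auto

lemma ppart_decomposition: "direct_sum3 \<pp> ppart"
proof (rule direct_sum3I)
  fix v assume "v \<in> \<pp>"
  then obtain y where y: "y \<in> \<gg>" "v = J y"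
    by (rule J_surj)
  obtain b where b: "\<And>i. b i \<in> gpart i" "y = b Null + b Pos + b Neg"
    using direct_sum3_ex[OF gpart_decomposition y(1)] by blast
  have "b j \<in> \<gg>" for j by (rule gpart_fixed[OF b(1)])
  then have "v = J (b Null) + J (b Pos) + J (b Neg)"
    using y(2) b(2) by simp
  then show "\<exists>c. (\<forall>i. c i \<in> ppart i) \<and> v = c Null + c Pos + c Neg"
    using b(1) by (intro exI[of _ "\<lambda>i. J (b i)"]) (auto simp: ppart_def)
next
  fix c i assume c: "\<And>i. c i \<in> ppart i" "c Null + c Pos + c Neg = 0"
  have "c j \<in> hpart j" for j
    using c(1)[of j] hpartI[of 0 j] by (auto simp: ppart_def)
  then show "c i = 0"
    using direct_sum3_single[OF hpart_decomposition _ c(2)[symmetric] subspace_0[OF subspace_hpart]]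
    by blast
qed (use subspace_ppart J_anti in \<open>auto simp: ppart_def\<close>)

lemma hpart_split: "direct_sum2 (hpart i) (gpart i) (ppart i)"
  unfolding direct_sum2_def
proof (intro conjI ballI subspace_gpart subspace_ppart)
  show "gpart i \<subseteq> hpart i"
    using hpartI[of _ i 0] by auto
  show "ppart i \<subseteq> hpart i"
    using hpartI[of 0 i] by (auto simp: ppart_def)
  fix v assume "v \<in> hpart i"
  then obtain x y where xy: "x \<in> gpart i" "y \<in> gpart i" "v = x + J y"
    by (rule hpartE)
  show "\<exists>!z. z \<in> gpart i \<times> ppart i \<and> v = fst z + snd z"
  proof (rule ex1I[of _ "(x, J y)"])
    fix z assume "z \<in> gpart i \<times> ppart i \<and> v = fst z + snd z"
    then obtain a b where z: "a \<in> gpart i" "b \<in> gpart i" "z = (a, J b)" "v = a + J b"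
      by (auto simp: ppart_def)
    have "a = x" "b = y"
      using coords_unique[OF _ _ _ _ z(4)[unfolded xy(3), symmetric]] z(1,2) xy(1,2) by auto
    then show "z = (x, J y)"
      using z(3) by simp
  qed (use xy in \<open>auto simp: ppart_def\<close>)
qed

lemma hpart_legendrian: "legendrian_lie_algebra (hpart i) br s \<Lambda>"
proof unfold_locales
  show "subspace (hpart i)" by (rule subspace_hpart)
  show "\<exists>S. finite S \<and> span S = hpart i"
    using basis_exists[of "hpart i"] subspace_hpart span_subspace independent_imp_finite by metis
  show "bilin_on (hpart i) br" "bilin_on (hpart i) \<Lambda>" "lin_on (hpart i) s"
    using bilin_on_subset[OF br_bilinear hpart_subset] bilin_on_subset[OF \<Lambda>_bilinear hpart_subset]
      lin_on_subset[OF s_linear hpart_subset] by auto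
  have sub: "x \<in> V" if "x \<in> hpart i" for x using that hpart_subset by blast
  fix v assume v: "v \<in> hpart i"
  show "br v v = 0" "s (s v) = v"
    using br_alternating s_involutive sub[OF v] by auto
  obtain x y where xy: "x \<in> gpart i" "y \<in> gpart i" "v = x + J y"
    using v by (rule hpartE)
  show "s v \<in> hpart i"
    using xy hpartI[of x i "- y"] by (simp add: coords_s)
  {
    assume 0: "\<forall>w\<in>hpart i. \<Lambda> v w = 0"
    \<comment> \<open>Nondegeneracy need not pass to a subspace; here the test vectors
      \<open>J x\<close> and \<open>y\<close> stay in the same part and pair with \<open>v\<close>
      to \<open>B x x\<close> and \<open>B y y\<close>.\<close>
    have "\<Lambda> v (0 + J x) = 0" "\<Lambda> v (y + J 0) = 0"
      by (rule bspec[OF 0 hpartI]; use xy in simp)+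
    then have "B x x = 0" "B y y = 0"
      using coords_simps(2)[of x y 0 x] coords_simps(2)[of x y y 0] xy by simp_all
    then show "v = 0"
      using xy B.eq_0_iff by simp
  }
  fix w assume w: "w \<in> hpart i"
  show "br v w \<in> hpart i"
    using hpart_ideal[of i] sub[OF v] w by (simp add: lie_ideal_def)
  show "s (br v w) = br (s v) (s w)" "\<Lambda> v w = \<Lambda> w v" "\<Lambda> (s v) w = - \<Lambda> v (s w)"
    by (rule s_bracket \<Lambda>_sym \<Lambda>_s, rule sub[OF v], rule sub[OF w])+
  fix u assume u: "u \<in> hpart i"
  show "br v (br w u) + br w (br u v) + br u (br v w) = 0" "\<Lambda> (br v w) u = \<Lambda> v (br w u)"
    by (rule jacobi \<Lambda>_invariant, rule sub[OF v], rule sub[OF w], rule sub[OF u])+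
qed

section \<open>Isomorphisms with the three models\<close>

definition coords :: "'a \<Rightarrow> 'a \<times> 'a" where
  "coords v = (THE p. fst p \<in> \<gg> \<and> snd p \<in> \<gg> \<and> v = fst p + J (snd p))"

lemma coords_eq:
  assumes "x \<in> \<gg>" "y \<in> \<gg>" shows "coords (x + J y) = (x, y)"
  unfolding coords_def
proof (rule the_equality)
  show "fst (x, y) \<in> \<gg> \<and> snd (x, y) \<in> \<gg> \<and> x + J y = fst (x, y) + J (snd (x, y))"
    using assms by simp
  fix p assume p: "fst p \<in> \<gg> \<and> snd p \<in> \<gg> \<and> x + J y = fst p + J (snd p)"
  then have eq: "x + J y = fst p + J (snd p)" by blast
  have "x = fst p" "y = snd p"
    using coords_unique[OF assms _ _ eq] p by auto
  then show "p = (x, y)" by simp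
qed

text \<open>\<open>f x y\<close> is the intended image of \<open>x + J y\<close>. In these
  coordinates \<open>\<sigma>\<close> acts on \<open>gpart i\<close> as the scalar
  \<open>eps i\<close>, so each model reduces to identities inside \<open>gpart i\<close>.\<close>

lemma isomorphic_model:
  fixes f :: "'a \<Rightarrow> 'a \<Rightarrow> 'b::real_vector"
  assumes add: "\<And>x y u v. \<lbrakk>x \<in> gpart i; y \<in> gpart i; u \<in> gpart i; v \<in> gpart i\<rbrakk> \<Longrightarrow>
      f (x + u) (y + v) = f x y + f u v"
    and scale: "\<And>x y c. \<lbrakk>x \<in> gpart i; y \<in> gpart i\<rbrakk> \<Longrightarrow> f (c *\<^sub>R x) (c *\<^sub>R y) = c *\<^sub>R f x y"
    and inj: "\<And>x y u v. \<lbrakk>x \<in> gpart i; y \<in> gpart i; u \<in> gpart i; v \<in> gpart i; f x y = f u v\<rbrakk> \<Longrightarrow>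
      x = u \<and> y = v"
    and br: "\<And>x y u v. \<lbrakk>x \<in> gpart i; y \<in> gpart i; u \<in> gpart i; v \<in> gpart i\<rbrakk> \<Longrightarrow>
      br' (f x y) (f u v) = f (br x u + eps i *\<^sub>R br y v) (br x v + br y u)"
    and s: "\<And>x y. \<lbrakk>x \<in> gpart i; y \<in> gpart i\<rbrakk> \<Longrightarrow> s' (f x y) = f x (- y)"
    and \<Lambda>: "\<And>x y u v. \<lbrakk>x \<in> gpart i; y \<in> gpart i; u \<in> gpart i; v \<in> gpart i\<rbrakk> \<Longrightarrow>
      \<Lambda>' (f x y) (f u v) = B x v + B y u"
    and V': "V' = {f x y | x y. x \<in> gpart i \<and> y \<in> gpart i}"
  shows "legendrian_isomorphic (hpart i) br s \<Lambda> V' br' s' \<Lambda>'"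
proof -
  define \<phi> where "\<phi> v = (case coords v of (x, y) \<Rightarrow> f x y)" for v
  have \<phi>: "\<phi> (x + J y) = f x y" if "x \<in> gpart i" "y \<in> gpart i" for x y
    using that by (simp add: \<phi>_def coords_eq)
  have "legendrian_isomorphism (hpart i) br s \<Lambda> (\<phi> ` hpart i) br' s' \<Lambda>' \<phi>"
  proof (rule legendrian_transport[OF hpart_legendrian])
    show "inj_on \<phi> (hpart i)"
    proof (rule inj_onI)
      fix v w assume "v \<in> hpart i" "w \<in> hpart i" and eq: "\<phi> v = \<phi> w"
      then obtain x y a b where xy: "x \<in> gpart i" "y \<in> gpart i" "v = x + J y"
        and ab: "a \<in> gpart i" "b \<in> gpart i" "w = a + J b"
        by (elim hpartE)
      have "f x y = f a b"
        using eq \<phi> xy ab by metis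
      then show "v = w"
        using inj[OF xy(1,2) ab(1,2)] xy(3) ab(3) by blast
    qed
    have "\<phi> (v + w) = \<phi> v + \<phi> w \<and> \<phi> (c *\<^sub>R v) = c *\<^sub>R \<phi> v \<and> \<phi> (br v w) = br' (\<phi> v) (\<phi> w) \<and>
        \<phi> (s v) = s' (\<phi> v) \<and> \<Lambda>' (\<phi> v) (\<phi> w) = \<Lambda> v w"
      if v: "v \<in> hpart i" and w: "w \<in> hpart i" for v w c
    proof -
      obtain x y where xy: "x \<in> gpart i" "y \<in> gpart i" "v = x + J y"
        using v by (rule hpartE)
      obtain a b where ab: "a \<in> gpart i" "b \<in> gpart i" "w = a + J b"
        using w by (rule hpartE)
      have "\<sigma> (br y b) = eps i *\<^sub>R br y b"
        using xy ab by (intro \<sigma>_gpart) simp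
      then have eqs: "br v w = (br x a + eps i *\<^sub>R br y b) + J (br x b + br y a)"
        "v + w = (x + a) + J (y + b)" "c *\<^sub>R v = c *\<^sub>R x + J (c *\<^sub>R y)" "s v = x + J (- y)"
        "\<Lambda> v w = B x b + B y a"
        unfolding xy(3) ab(3) using xy(1,2) ab(1,2)
        by (simp_all only: coords_simps coords_s coords_scaleR gpart_fixed)
      have "\<phi> (br v w) = f (br x a + eps i *\<^sub>R br y b) (br x b + br y a)"
        "\<phi> (v + w) = f (x + a) (y + b)" "\<phi> (c *\<^sub>R v) = f (c *\<^sub>R x) (c *\<^sub>R y)"
        "\<phi> (s v) = f x (- y)" "\<phi> v = f x y" "\<phi> w = f a b"
        unfolding eqs unfolding xy(3) ab(3) by (rule \<phi>; use xy(1,2) ab(1,2) in simp)+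
      then show ?thesis
        using xy(1,2) ab(1,2) by (simp only: add scale br s \<Lambda> eqs)
    qed
    then show "lin_on (hpart i) \<phi>" "\<And>v w. v \<in> hpart i \<Longrightarrow> w \<in> hpart i \<Longrightarrow> \<phi> (br v w) = br' (\<phi> v) (\<phi> w)"
      "\<And>v. v \<in> hpart i \<Longrightarrow> \<phi> (s v) = s' (\<phi> v)"
      "\<And>v w. v \<in> hpart i \<Longrightarrow> w \<in> hpart i \<Longrightarrow> \<Lambda>' (\<phi> v) (\<phi> w) = \<Lambda> v w"
      unfolding lin_on_def by blast+
  qed
  moreover have "\<phi> ` hpart i = V'"
  proof
    show "\<phi> ` hpart i \<subseteq> V'"
    proof
      fix z assume "z \<in> \<phi> ` hpart i"
      then obtain x y where xy: "x \<in> gpart i" "y \<in> gpart i" "z = \<phi> (x + J y)"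
        by (auto elim: hpartE)
      then have "z = f x y"
        using \<phi> by simp
      then show "z \<in> V'"
        unfolding V' using xy(1,2) by blast
    qed
    show "V' \<subseteq> \<phi> ` hpart i"
    proof
      fix z assume "z \<in> V'"
      then obtain x y where "x \<in> gpart i" "y \<in> gpart i" "z = f x y"
        unfolding V' by blast
      then show "z \<in> \<phi> ` hpart i"
        using \<phi> hpartI by (intro image_eqI[of _ _ "x + J y"]) auto
    qed
  qed
  ultimately show ?thesis
    unfolding legendrian_isomorphic_def by blast
qed

lemma gpart_inner_product: "invariant_inner_product (gpart i) br B"
  unfolding invariant_inner_product_def
  using bilin_on_subset[OF B.bilin] B.sym B.pos B_invariant by (auto simp: subset_iff)

lemma hpart_Null:
  "legendrian_isomorphic (hpart Null) br s \<Lambda>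
    (gpart Null \<times> dual (gpart Null)) (bracket0 (gpart Null) br) invol0 form0"
proof (rule isomorphic_model)
  let ?G = "gpart Null"
  \<comment> \<open>\<open>B\<close> identifies the fixed part with its dual; the value 0 outside is
    the one required by \<open>dual\<close>.\<close>
  let ?f = "\<lambda>x y. (x, \<lambda>z. if z \<in> ?G then B y z else 0)"
  fix x y u v c assume xy: "x \<in> ?G" "y \<in> ?G"
  show "?f (c *\<^sub>R x) (c *\<^sub>R y) = c *\<^sub>R ?f x y" "invol0 (?f x y) = ?f x (- y)"
    using xy by (auto simp: fun_eq_iff scaleR_fun_def invol0_def)
  assume uv: "u \<in> ?G" "v \<in> ?G"
  show "?f (x + u) (y + v) = ?f x y + ?f u v" "form0 (?f x y) (?f u v) = B x v + B y u"
    using xy uv B.sym[of x v] by (auto simp: fun_eq_iff form0_def)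
  \<comment> \<open>Invariance of \<open>B\<close> turns the coadjoint action on \<open>B v\<close>
    into the bracket: \<open>- B v (br x z) = B (br x v) z\<close>.\<close>
  have "B (br x v + br y u) z = - B v (br x z) + B y (br u z)" if "z \<in> ?G" for z
    using that xy uv B_invariant[of v x z] B_invariant[of y u z] br_anti[of x v] by simp
  then show "bracket0 ?G br (?f x y) (?f u v) = ?f (br x u + eps Null *\<^sub>R br y v) (br x v + br y u)"
    using xy uv by (auto simp: fun_eq_iff bracket0_def coad_def)
  assume eq: "?f x y = ?f u v"
  then have "B y z = B v z" if "z \<in> ?G" for z
    using that by (auto simp: fun_eq_iff split: if_splits)
  from this[of "y - v"] have "B (y - v) (y - v) = 0"
    using xy uv by simp
  then show "x = u \<and> y = v"
    using eq xy uv B.eq_0_iff[of "y - v"] by simp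
next
  let ?G = "gpart Null"
  let ?f = "\<lambda>x y. (x, \<lambda>z. if z \<in> ?G then B y z else 0)"
  interpret G: inner_space ?G B
    by (rule B.inner_space_subset[OF subspace_gpart]) auto
  show "?G \<times> dual ?G = {?f x y |x y. x \<in> ?G \<and> y \<in> ?G}"
  proof (intro equalityI subsetI)
    fix p assume "p \<in> ?G \<times> dual ?G"
    then obtain x l where p: "p = (x, l)" "x \<in> ?G" "lin_on ?G l" "\<And>z. z \<notin> ?G \<Longrightarrow> l z = 0"
      by (auto simp: dual_def)
    obtain y where "y \<in> ?G" "\<And>z. z \<in> ?G \<Longrightarrow> l z = B y z"
      using G.riesz[OF p(3)] by blast
    then have "p = ?f x y"
      using p by auto
    then show "p \<in> {?f x y |x y. x \<in> ?G \<and> y \<in> ?G}"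
      using \<open>y \<in> ?G\<close> p(2) by blast
  next
    fix p assume "p \<in> {?f x y |x y. x \<in> ?G \<and> y \<in> ?G}"
    then obtain x y where p: "p = ?f x y" "x \<in> ?G" "y \<in> ?G" by blast
    then show "p \<in> ?G \<times> dual ?G"
      by (auto simp: dual_def lin_on_def)
  qed
qed

lemma hpart_Pos:
  "legendrian_isomorphic (hpart Pos) br s \<Lambda>
    (gpart Pos \<times> gpart Pos) (bracket_pos br) invol_pos (form_pos B)"
proof (rule isomorphic_model)
  let ?G = "gpart Pos"
  \<comment> \<open>Coordinates along the idempotents \<open>(1 + j)/2\<close> and
    \<open>(1 - j)/2\<close> of the split-complex numbers. Polarisation gives twice
    \<open>B x v + B y u\<close>, which the factor 1/2 in \<open>form_pos\<close> corrects.\<close>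
  let ?f = "\<lambda>x y. (x + y, x - y)"
  fix x y u v c assume xy: "x \<in> ?G" "y \<in> ?G"
  show "?f (c *\<^sub>R x) (c *\<^sub>R y) = c *\<^sub>R ?f x y" "invol_pos (?f x y) = ?f x (- y)"
    by (auto simp: invol_pos_def algebra_simps)
  assume uv: "u \<in> ?G" "v \<in> ?G"
  show "?f (x + u) (y + v) = ?f x y + ?f u v"
    by simp
  show "form_pos B (?f x y) (?f u v) = B x v + B y u"
    using xy uv by (simp add: form_pos_def)
  show "bracket_pos br (?f x y) (?f u v) = ?f (br x u + eps Pos *\<^sub>R br y v) (br x v + br y u)"
    using xy uv by (simp add: bracket_pos_def)
  assume "?f x y = ?f u v"
  then show "x = u \<and> y = v"
    using sum_diff_eqD[of x y u v] by (simp only: prod.inject)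
next
  let ?G = "gpart Pos"
  show "?G \<times> ?G = {(x + y, x - y) |x y. x \<in> ?G \<and> y \<in> ?G}"
  proof (intro equalityI subsetI)
    fix z assume "z \<in> ?G \<times> ?G"
    then obtain p q where z: "z = (p, q)" "p \<in> ?G" "q \<in> ?G" by blast
    then have "z = ((1/2) *\<^sub>R (p + q) + (1/2) *\<^sub>R (p - q), (1/2) *\<^sub>R (p + q) - (1/2) *\<^sub>R (p - q))"
      by (simp add: algebra_simps flip: scaleR_add_left)
    moreover have "(1/2) *\<^sub>R (p + q) \<in> ?G" "(1/2) *\<^sub>R (p - q) \<in> ?G"
      using z by simp_all
    ultimately show "z \<in> {(x + y, x - y) |x y. x \<in> ?G \<and> y \<in> ?G}"
      by blast
  qed auto
qed

text \<open>\<open>J\<close> already plays the role of multiplication by the imaginary unit, so the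
  pair of coordinates is the isomorphism.\<close>

lemma hpart_Neg:
  "legendrian_isomorphic (hpart Neg) br s \<Lambda>
    (gpart Neg \<times> gpart Neg) (bracket_neg br) invol_neg (form_neg B)"
  by (rule isomorphic_model[where f = Pair])
    (auto simp: invol_neg_def form_neg_def complex_extension_def bracket_neg_def)

theorem standard_decomposition_exists: "standard_decomposition V br s \<Lambda> hpart gpart ppart"
  unfolding standard_decomposition_def
  by (intro conjI allI exI[of _ B] hpart_decomposition hpart_ideal gpart_decomposition
      ppart_decomposition hpart_split hpart_Null hpart_Pos hpart_Neg gpart_inner_product)
    (auto simp: lie_ideal_def subspace_gpart)

end

section \<open>Uniqueness of the decomposition\<close>

context normal_form
begin

text \<open>The isomorphism \<open>\<psi>\<close> maps \<open>x\<close> to \<open>\<iota>\<^sub>0 (\<alpha> x)\<close> and \<open>J x\<close> to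
  \<open>\<iota>\<^sub>1 (\<beta> x)\<close>. If \<open>\<alpha> u = \<beta> w\<close>, then \<open>\<alpha> (\<sigma> w) = e *\<^sub>R \<beta> u\<close>, and therefore
  \<open>e * B w (\<sigma> w) = B u u > 0\<close>; as \<open>\<sigma>\<close> has eigenvalues in \<open>{0, 1, -1}\<close>, it equals \<open>e\<close>.\<close>

lemma sign_of_model:
  fixes \<iota>\<^sub>0 \<iota>\<^sub>1 :: "'a \<Rightarrow> 'b::real_vector"
  assumes iso: "legendrian_isomorphism H br s \<Lambda> V' br' s' \<Lambda>' \<psi>"
    and U: "subspace U" "U \<subseteq> \<gg>" "\<And>x y. x \<in> U \<Longrightarrow> y \<in> U \<Longrightarrow> br x y \<in> U"
    and perf: "\<And>S. subspace S \<Longrightarrow> (\<And>x y. x \<in> U \<Longrightarrow> y \<in> U \<Longrightarrow> br x y \<in> S) \<Longrightarrow> U \<subseteq> S"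
    and \<sigma>U: "\<And>x. x \<in> U \<Longrightarrow> \<sigma> x \<in> U"
    and UH: "\<And>x. x \<in> U \<Longrightarrow> x \<in> H" "\<And>x. x \<in> U \<Longrightarrow> J x \<in> H" "\<And>x. x \<in> H \<Longrightarrow> s x = x \<Longrightarrow> x \<in> U"
    and lin: "linear \<iota>\<^sub>0" "linear \<iota>\<^sub>1" "inj \<iota>\<^sub>0" "inj \<iota>\<^sub>1"
    and fixed: "\<And>z. z \<in> V' \<Longrightarrow> s' z = z \<Longrightarrow> \<exists>a\<in>U. z = \<iota>\<^sub>0 a"
    and anti: "\<And>z. z \<in> V' \<Longrightarrow> s' z = - z \<Longrightarrow> \<exists>a\<in>U. z = \<iota>\<^sub>1 a"
    and \<iota>\<^sub>0: "\<And>a. a \<in> U \<Longrightarrow> \<iota>\<^sub>0 a \<in> V'" "\<And>a. a \<in> U \<Longrightarrow> s' (\<iota>\<^sub>0 a) = \<iota>\<^sub>0 a"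
    and br': "\<And>a b. a \<in> U \<Longrightarrow> b \<in> U \<Longrightarrow> br' (\<iota>\<^sub>0 a) (\<iota>\<^sub>0 b) = \<iota>\<^sub>0 (br a b)"
      "\<And>a b. a \<in> U \<Longrightarrow> b \<in> U \<Longrightarrow> br' (\<iota>\<^sub>0 a) (\<iota>\<^sub>1 b) = \<iota>\<^sub>1 (br a b)"
      "\<And>a b. a \<in> U \<Longrightarrow> b \<in> U \<Longrightarrow> br' (\<iota>\<^sub>1 a) (\<iota>\<^sub>0 b) = \<iota>\<^sub>1 (br a b)"
      "\<And>a b. a \<in> U \<Longrightarrow> b \<in> U \<Longrightarrow> br' (\<iota>\<^sub>1 a) (\<iota>\<^sub>1 b) = \<iota>\<^sub>0 (e *\<^sub>R br a b)"
    and \<Lambda>': "\<And>a b. a \<in> U \<Longrightarrow> b \<in> U \<Longrightarrow> \<Lambda>' (\<iota>\<^sub>1 a) (\<iota>\<^sub>0 b) = C a b"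
    and C: "bilin_on U C" "\<And>a b. a \<in> U \<Longrightarrow> b \<in> U \<Longrightarrow> C a b = C b a"
    and e: "e * e = 1"
    and x: "x \<in> U"
  shows "\<sigma> x = e *\<^sub>R x"
proof -
  have \<psi>: "lin_on H \<psi>" "bij_betw \<psi> H V'" "\<And>x y. x \<in> H \<Longrightarrow> y \<in> H \<Longrightarrow> \<psi> (br x y) = br' (\<psi> x) (\<psi> y)"
    "\<And>x. x \<in> H \<Longrightarrow> \<psi> (s x) = s' (\<psi> x)" "\<And>x y. x \<in> H \<Longrightarrow> y \<in> H \<Longrightarrow> \<Lambda>' (\<psi> x) (\<psi> y) = \<Lambda> x y"
    and H: "legendrian_lie_algebra H br s \<Lambda>"
    using iso by (auto simp: legendrian_isomorphism_def)
  interpret H: legendrian_lie_algebra H br s \<Lambda> by (rule H)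
  have Ug: "x \<in> \<gg>" if "x \<in> U" for x using that U(2) by blast
  note U_mem = subspace_0[OF U(1)] subspace_add[OF U(1)] subspace_diff[OF U(1)] subspace_scale[OF U(1)]
  have "\<exists>a. a \<in> U \<and> \<psi> x = \<iota>\<^sub>0 a" if "x \<in> U" for x
  proof -
    have "s' (\<psi> x) = \<psi> x"
      using \<psi>(4)[OF UH(1)[OF that]] fixedD(2)[OF Ug[OF that]] by simp
    then show ?thesis
      using fixed[OF bij_betwE[OF \<psi>(2), rule_format, OF UH(1)[OF that]]] by blast
  qed
  then obtain \<alpha> where \<alpha>: "\<And>x. x \<in> U \<Longrightarrow> \<alpha> x \<in> U" "\<And>x. x \<in> U \<Longrightarrow> \<psi> x = \<iota>\<^sub>0 (\<alpha> x)"
    by metis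
  have "\<exists>b. b \<in> U \<and> \<psi> (J x) = \<iota>\<^sub>1 b" if "x \<in> U" for x
  proof -
    have "s' (\<psi> (J x)) = - \<psi> (J x)"
      using \<psi>(4)[OF UH(2)[OF that]] antiD(2)[OF J_anti[OF Ug[OF that]]]
        lin_on_uminus[OF \<psi>(1) UH(2)[OF that]] by simp
    then show ?thesis
      using anti[OF bij_betwE[OF \<psi>(2), rule_format, OF UH(2)[OF that]]] by blast
  qed
  then obtain \<beta> where \<beta>: "\<And>x. x \<in> U \<Longrightarrow> \<beta> x \<in> U" "\<And>x. x \<in> U \<Longrightarrow> \<psi> (J x) = \<iota>\<^sub>1 (\<beta> x)"
    by metis
  have \<alpha>_add: "\<alpha> (x + y) = \<alpha> x + \<alpha> y" and \<beta>_add: "\<beta> (x + y) = \<beta> x + \<beta> y"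
    if xy: "x \<in> U" "y \<in> U" for x y
  proof -
    have "\<iota>\<^sub>0 (\<alpha> (x + y)) = \<psi> x + \<psi> y"
      using xy U_mem(2) \<alpha>(2) lin_on_add[OF \<psi>(1) UH(1) UH(1)] by simp
    then show "\<alpha> (x + y) = \<alpha> x + \<alpha> y"
      using xy \<alpha>(2) by (intro injD[OF lin(3)]) (simp add: linear_add[OF lin(1)])
    have "\<iota>\<^sub>1 (\<beta> (x + y)) = \<psi> (J x) + \<psi> (J y)"
      using xy U_mem(2) \<beta>(2)[of "x + y"] lin_on_add[OF \<psi>(1) UH(2) UH(2)] Ug by simp
    then show "\<beta> (x + y) = \<beta> x + \<beta> y"
      using xy \<beta>(2) by (intro injD[OF lin(4)]) (simp add: linear_add[OF lin(2)])
  qed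
  have \<alpha>_scale: "\<alpha> (c *\<^sub>R x) = c *\<^sub>R \<alpha> x" and \<beta>_scale: "\<beta> (c *\<^sub>R x) = c *\<^sub>R \<beta> x"
    if x: "x \<in> U" for x c
  proof -
    have "\<iota>\<^sub>0 (\<alpha> (c *\<^sub>R x)) = c *\<^sub>R \<psi> x"
      using x U_mem(4) \<alpha>(2) lin_on_scaleR[OF \<psi>(1) UH(1)] by simp
    then show "\<alpha> (c *\<^sub>R x) = c *\<^sub>R \<alpha> x"
      using x \<alpha>(2) by (intro injD[OF lin(3)]) (simp add: linear_scale[OF lin(1)])
    have "\<iota>\<^sub>1 (\<beta> (c *\<^sub>R x)) = c *\<^sub>R \<psi> (J x)"
      using x U_mem(4) \<beta>(2)[of "c *\<^sub>R x"] lin_on_scaleR[OF \<psi>(1) UH(2)] Ug by simp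
    then show "\<beta> (c *\<^sub>R x) = c *\<^sub>R \<beta> x"
      using x \<beta>(2) by (intro injD[OF lin(4)]) (simp add: linear_scale[OF lin(2)])
  qed
  have \<beta>_zero: "x = 0" if x: "x \<in> U" "\<beta> x = 0" for x
  proof -
    have "\<psi> (J x) = \<psi> 0"
      using x \<beta>(2) linear_0[OF lin(2)] lin_on_zero[OF \<psi>(1) H.subspace_carrier] by simp
    then have "J x = 0"
      using bij_betw_imp_inj_on[OF \<psi>(2)] UH(2)[OF x(1)] subspace_0[OF H.subspace_carrier]
      by (auto dest: inj_onD)
    then show ?thesis
      using J_inj[of x 0] Ug[OF x(1)] by simp
  qed
  \<comment> \<open>The preimage of a fixed vector of the model is fixed by \<open>s\<close> because
    \<open>\<psi>\<close> is injective, so it lies in \<open>U\<close>.\<close>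
  have \<alpha>_surj: "\<exists>u\<in>U. \<alpha> u = v" if v: "v \<in> U" for v
  proof -
    obtain h where h: "h \<in> H" "\<psi> h = \<iota>\<^sub>0 v"
      using \<iota>\<^sub>0(1)[OF v] bij_betw_imp_surj_on[OF \<psi>(2)] by (metis imageE)
    have "\<psi> (s h) = \<psi> h"
      using \<psi>(4)[OF h(1)] h(2) \<iota>\<^sub>0(2)[OF v] by simp
    then have "s h = h"
      using bij_betw_imp_inj_on[OF \<psi>(2)] h(1) H.s_closed by (metis inj_onD)
    then have "h \<in> U" using UH(3) h(1) by blast
    then have "\<iota>\<^sub>0 (\<alpha> h) = \<iota>\<^sub>0 v" using \<alpha>(2) h(2) by simp
    then show ?thesis using injD[OF lin(3)] \<open>h \<in> U\<close> by blast
  qed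
  have \<alpha>_br: "\<alpha> (br x y) = br (\<alpha> x) (\<alpha> y)" and \<beta>_br: "\<beta> (br x y) = br (\<alpha> x) (\<beta> y)"
    and \<beta>_br': "\<beta> (br x y) = br (\<beta> x) (\<alpha> y)" and \<alpha>_\<sigma>: "\<alpha> (\<sigma> (br x y)) = e *\<^sub>R br (\<beta> x) (\<beta> y)"
    if xy: "x \<in> U" "y \<in> U" for x y
  proof -
    have "\<iota>\<^sub>0 (\<alpha> (br x y)) = \<iota>\<^sub>0 (br (\<alpha> x) (\<alpha> y))"
      using \<psi>(3)[OF UH(1)[OF xy(1)] UH(1)[OF xy(2)]] \<alpha> br'(1) U(3) xy by simp
    then show "\<alpha> (br x y) = br (\<alpha> x) (\<alpha> y)" by (rule injD[OF lin(3)])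
    have "\<iota>\<^sub>1 (\<beta> (br x y)) = \<iota>\<^sub>1 (br (\<alpha> x) (\<beta> y))"
      using \<psi>(3)[OF UH(1)[OF xy(1)] UH(2)[OF xy(2)]] \<alpha> \<beta> br'(2) U(3) xy br_J_right Ug by simp
    then show "\<beta> (br x y) = br (\<alpha> x) (\<beta> y)" by (rule injD[OF lin(4)])
    have "\<iota>\<^sub>1 (\<beta> (br x y)) = \<iota>\<^sub>1 (br (\<beta> x) (\<alpha> y))"
      using \<psi>(3)[OF UH(2)[OF xy(1)] UH(1)[OF xy(2)]] \<alpha> \<beta> br'(3) U(3) xy br_J_left Ug by simp
    then show "\<beta> (br x y) = br (\<beta> x) (\<alpha> y)" by (rule injD[OF lin(4)])
    have "\<iota>\<^sub>0 (\<alpha> (\<sigma> (br x y))) = \<iota>\<^sub>0 (e *\<^sub>R br (\<beta> x) (\<beta> y))"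
      using \<psi>(3)[OF UH(2)[OF xy(1)] UH(2)[OF xy(2)]] \<alpha>(2)[OF \<sigma>U[OF U(3)[OF xy]]] \<beta> br'(4) xy
        br_J_J[OF Ug[OF xy(1)] Ug[OF xy(2)]] by (simp del: \<sigma>_br)
    then show "\<alpha> (\<sigma> (br x y)) = e *\<^sub>R br (\<beta> x) (\<beta> y)" by (rule injD[OF lin(3)])
  qed
  have form: "B x y = C (\<beta> x) (\<alpha> y)" if "x \<in> U" "y \<in> U" for x y
    using \<psi>(5)[OF UH(2)[OF that(1)] UH(1)[OF that(2)]] \<Lambda>' \<alpha> \<beta> that \<Lambda>_J Ug by simp
  \<comment> \<open>The conditions on \<open>w\<close> define a subspace, so \<open>perf\<close>
    reduces the existence of \<open>u\<close> to the case that \<open>w\<close> is a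
    bracket.\<close>
  have "U \<subseteq> {w \<in> U. \<exists>u\<in>U. \<alpha> u = \<beta> w \<and> \<alpha> (\<sigma> w) = e *\<^sub>R \<beta> u}" (is "_ \<subseteq> ?S")
  proof (rule perf)
    show "subspace ?S"
      unfolding subspace_def
    proof (intro conjI ballI allI)
      have "\<alpha> 0 = 0" "\<beta> 0 = 0"
        using \<alpha>_scale[OF U_mem(1), of 0] \<beta>_scale[OF U_mem(1), of 0] by simp_all
      then show "0 \<in> ?S"
        using U_mem(1) lin_on_zero[OF \<sigma>_lin subspace_fixed] by (auto intro!: bexI[of _ 0])
    next
      fix v w assume "v \<in> ?S" "w \<in> ?S"
      then obtain a b where "v \<in> U" "w \<in> U" "a \<in> U" "b \<in> U" "\<alpha> a = \<beta> v" "\<alpha> b = \<beta> w"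
        "\<alpha> (\<sigma> v) = e *\<^sub>R \<beta> a" "\<alpha> (\<sigma> w) = e *\<^sub>R \<beta> b" by blast
      then show "v + w \<in> ?S"
        using Ug \<sigma>U U_mem(2) by (auto simp: \<alpha>_add \<beta>_add scaleR_add_right intro!: bexI[of _ "a + b"])
    next
      fix c w assume "w \<in> ?S"
      then obtain b where "w \<in> U" "b \<in> U" "\<alpha> b = \<beta> w" "\<alpha> (\<sigma> w) = e *\<^sub>R \<beta> b" by blast
      then show "c *\<^sub>R w \<in> ?S"
        using Ug \<sigma>U U_mem(4) by (auto simp: \<alpha>_scale \<beta>_scale intro!: bexI[of _ "c *\<^sub>R b"])
    qed
    fix x y assume xy: "x \<in> U" "y \<in> U"
    obtain u where u: "u \<in> U" "\<alpha> u = \<beta> x"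
      using \<alpha>_surj[OF \<beta>(1)[OF xy(1)]] by blast
    \<comment> \<open>For the bracket \<open>br x y\<close> the witness is \<open>br u y\<close>,
      where \<open>u\<close> solves \<open>\<alpha> u = \<beta> x\<close>.\<close>
    have "\<alpha> (br u y) = \<beta> (br x y)" "\<alpha> (\<sigma> (br x y)) = e *\<^sub>R \<beta> (br u y)"
      using u xy by (simp_all only: \<alpha>_br \<beta>_br'[OF xy] \<beta>_br[OF u(1) xy(2)] \<alpha>_\<sigma>)
    then show "br x y \<in> ?S"
      using U(3) u(1) xy by blast
  qed
  then have *: "\<exists>u\<in>U. \<alpha> u = \<beta> w \<and> \<alpha> (\<sigma> w) = e *\<^sub>R \<beta> u" if "w \<in> U" for w
    using that by blast
  have pos: "e * B w (\<sigma> w) > 0" if w: "w \<in> U" "w \<noteq> 0" for w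
  proof -
    obtain u where u: "u \<in> U" "\<alpha> u = \<beta> w" "\<alpha> (\<sigma> w) = e *\<^sub>R \<beta> u"
      using *[OF w(1)] by blast
    have "B w (\<sigma> w) = C (\<alpha> u) (e *\<^sub>R \<beta> u)"
      using form[OF w(1) \<sigma>U[OF w(1)]] u(2,3) by simp
    also have "\<dots> = e * C (\<alpha> u) (\<beta> u)"
      using lin_on_scaleR[OF bilin_on_right[OF C(1)]] \<alpha>(1) \<beta>(1) u(1) by simp
    also have "C (\<alpha> u) (\<beta> u) = B u u"
      using form[OF u(1) u(1)] C(2) \<alpha>(1) \<beta>(1) u(1) by simp
    finally have "e * B w (\<sigma> w) = B u u"
      using e by (simp add: mult.assoc[symmetric])
    moreover have "u \<noteq> 0"
      using \<alpha>_scale[OF U_mem(1), of 0] u(2) \<beta>_zero w by auto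
    ultimately show ?thesis
      using B.pos Ug u(1) by simp
  qed
  \<comment> \<open>A failure would give a nonzero \<open>z\<close> with
    \<open>\<sigma> z = 0\<close>, against \<open>pos\<close>.\<close>
  have \<sigma>_sq: "\<sigma> (\<sigma> x) = x"
  proof (rule ccontr)
    define z where "z = \<sigma> (\<sigma> x) - x"
    assume "\<sigma> (\<sigma> x) \<noteq> x"
    then have "z \<in> U" "z \<noteq> 0"
      using x \<sigma>U U_mem(3) by (auto simp: z_def)
    moreover have "\<sigma> z = 0"
      using Ug[OF x] by (simp add: z_def \<sigma>_cube)
    ultimately show False
      using pos[of z] Ug[of z] by simp
  qed
  show ?thesis
  proof (rule ccontr)
    \<comment> \<open>Once the square of \<open>\<sigma>\<close> is the identity at
      \<open>x\<close>, this \<open>y\<close> satisfies \<open>\<sigma> y = - e *\<^sub>R y\<close>,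
      the eigenvalue with the wrong sign for \<open>pos\<close>.\<close>
    define y where "y = \<sigma> x - e *\<^sub>R x"
    assume "\<sigma> x \<noteq> e *\<^sub>R x"
    then have y: "y \<in> U" "y \<noteq> 0"
      using x \<sigma>U U_mem(3,4) by (auto simp: y_def)
    have "\<sigma> y = x - e *\<^sub>R \<sigma> x"
      using Ug[OF x] by (simp add: y_def \<sigma>_sq)
    also have "\<dots> = - e *\<^sub>R y"
      using e by (simp add: y_def algebra_simps)
    finally have "e * B y (\<sigma> y) = - B y y"
      using Ug[OF y(1)] e by (simp add: mult.assoc[symmetric])
    then show False
      using pos[OF y] B.pos[OF Ug[OF y(1)] y(2)] by simp
  qed
qed

section \<open>Comparison of an arbitrary standard decomposition with the eigenspaces of
  \<sigma>\<close>

context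
  fixes H G P
  assumes std: "standard_decomposition V br s \<Lambda> H G P"
begin

lemma ds: "direct_sum3 V H" "direct_sum3 \<gg> G" "direct_sum3 \<pp> P" "direct_sum2 (H i) (G i) (P i)"
  "lie_ideal V br (H i)" "lie_ideal \<gg> br (G i)"
  using std by (auto simp: standard_decomposition_def)

lemma sub: "subspace (H i)" "subspace (G i)" "subspace (P i)" "H i \<subseteq> V" "G i \<subseteq> \<gg>" "P i \<subseteq> \<pp>"
  "G i \<subseteq> H i" "P i \<subseteq> H i"
  using ds(1,2,3) ds(4)[of i] by (auto simp: direct_sum3_def direct_sum2_def)

lemma G_fixed: "x \<in> G i \<Longrightarrow> x \<in> \<gg>"
  using sub(5) by blast

lemma H_cases:
  assumes "v \<in> H i" obtains a b where "a \<in> G i" "b \<in> P i" "v = a + b"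
proof -
  have "\<exists>z. z \<in> G i \<times> P i \<and> v = fst z + snd z"
    using ds(4)[of i] assms unfolding direct_sum2_def by blast
  then obtain z where "z \<in> G i \<times> P i" "v = fst z + snd z" by blast
  then show ?thesis
    by (intro that[of "fst z" "snd z"]) auto
qed

lemma H_fixed: "x \<in> H i \<Longrightarrow> x \<in> \<gg> \<Longrightarrow> x \<in> G i"
  and H_anti: "x \<in> H i \<Longrightarrow> x \<in> \<pp> \<Longrightarrow> x \<in> P i"
proof -
  assume "x \<in> H i"
  then obtain a b where ab: "a \<in> G i" "b \<in> P i" "x = a + b"
    by (rule H_cases)
  have *: "a \<in> \<gg>" "b \<in> \<pp>" using ab sub(5,6) by auto
  show "x \<in> G i" if "x \<in> \<gg>"
  proof -
    have "b \<in> \<gg>" using subspace_diff[OF subspace_fixed that *(1)] ab(3) by simp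
    then have "b = 0" by (rule fixed_anti_zero[OF _ *(2)])
    then show ?thesis using ab by simp
  qed
  show "x \<in> P i" if "x \<in> \<pp>"
  proof -
    have "a \<in> \<pp>" using subspace_diff[OF subspace_anti that *(2)] ab(3) by simp
    then have "a = 0" by (rule fixed_anti_zero[OF *(1)])
    then show ?thesis using ab by simp
  qed
qed

lemma H_ideal: "v \<in> V \<Longrightarrow> w \<in> H i \<Longrightarrow> br v w \<in> H i"
  using ds(5)[of i] by (simp add: lie_ideal_def)

lemma G_ideal: "x \<in> \<gg> \<Longrightarrow> y \<in> G i \<Longrightarrow> br x y \<in> G i" "x \<in> \<gg> \<Longrightarrow> y \<in> G i \<Longrightarrow> br y x \<in> G i"
proof -
  assume xy: "x \<in> \<gg>" "y \<in> G i"
  show *: "br x y \<in> G i"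
    using ds(6)[of i] xy by (auto simp: lie_ideal_def)
  show "br y x \<in> G i"
    using subspace_neg[OF sub(2) *] br_anti[of y x] xy G_fixed[of y i] by simp
qed

text \<open>A bracket of elements of different summands lies in both ideals and vanishes, so an
  element central in \<open>G i\<close> is central in \<open>\<gg>\<close> and hence 0;
  \<open>perfect\<close> then applies.\<close>

lemma G_perfect:
  assumes "subspace S" "\<And>x y. x \<in> G i \<Longrightarrow> y \<in> G i \<Longrightarrow> br x y \<in> S"
  shows "G i \<subseteq> S"
proof (rule perfect[OF sub(2,5) _ _ assms])
  fix x assume x: "x \<in> G i" and center: "\<And>y. y \<in> G i \<Longrightarrow> br x y = 0"
  show "x = 0"
  proof (rule fixed_center[OF G_fixed[OF x]])
    fix y assume "y \<in> \<gg>"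
    then obtain a where a: "\<And>j. a j \<in> G j" "y = a Null + a Pos + a Neg"
      using direct_sum3_ex[OF ds(2)] by blast
    have "br x (a j) = 0" for j
    proof (cases "j = i")
      case True
      then show ?thesis using center a(1) by blast
    next
      case False
      then show ?thesis
        using direct_sum3_disjoint[OF ds(2) False G_ideal(1)[OF G_fixed[OF x] a(1)]
            G_ideal(2)[OF G_fixed[OF a(1)] x]] by blast
    qed
    moreover have "a j \<in> V" for j using G_fixed[OF a(1)] by simp
    ultimately show "br x y = 0"
      using a(2) G_fixed[OF x] by simp
  qed
qed (use G_ideal G_fixed in auto)

text \<open>On brackets \<open>J (br x y) = br (J x) y\<close>, which lies in the ideal
  \<open>H i\<close> because \<open>y\<close> does; \<open>G_perfect\<close> extends this to all of
  \<open>G i\<close>.\<close>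

lemma J_G: "x \<in> G i \<Longrightarrow> J x \<in> P i"
proof -
  have "subspace {x \<in> \<gg>. J x \<in> H i}"
    using sub(1)[of i] by (auto simp: subspace_def)
  moreover have "br x y \<in> {x \<in> \<gg>. J x \<in> H i}" if "x \<in> G i" "y \<in> G i" for x y
  proof -
    have "br (J x) y \<in> H i"
      using H_ideal[OF J_in_carrier[OF G_fixed[OF that(1)]]] that(2) sub(7) by blast
    then show ?thesis
      using G_fixed that by (simp add: br_J_left)
  qed
  ultimately have "G i \<subseteq> {x \<in> \<gg>. J x \<in> H i}"
    by (rule G_perfect)
  then show "x \<in> G i \<Longrightarrow> J x \<in> P i"
    using H_anti J_anti by blast
qed

lemma P_eq: "P i = J ` G i"
proof (intro equalityI subsetI)
  fix u assume u: "u \<in> P i"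
  then obtain x where x: "x \<in> \<gg>" "u = J x"
    using J_surj sub(6) by blast
  obtain a where a: "\<And>j. a j \<in> G j" "x = a Null + a Pos + a Neg"
    using direct_sum3_ex[OF ds(2) x(1)] by blast
  have "u = J (a Null) + J (a Pos) + J (a Neg)"
    using x(2) a(2) G_fixed[OF a(1)] by simp
  then have "J (a i) = u"
    using direct_sum3_single[OF ds(3) J_G[OF a(1)] _ u] by blast
  then show "u \<in> J ` G i" using a(1) by blast
qed (use J_G in auto)

text \<open>On brackets \<open>\<sigma> (br x y) = br (\<sigma> x) y\<close> lies in the ideal
  \<open>G i\<close>.\<close>

lemma \<sigma>_G: "x \<in> G i \<Longrightarrow> \<sigma> x \<in> G i"
proof -
  have "subspace {x \<in> \<gg>. \<sigma> x \<in> G i}"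
    using sub(2)[of i] lin_on_zero[OF \<sigma>_lin subspace_fixed] by (auto simp: subspace_def)
  moreover have "br x y \<in> {x \<in> \<gg>. \<sigma> x \<in> G i}" if "x \<in> G i" "y \<in> G i" for x y
    using that G_fixed G_ideal(1) by simp
  ultimately have "G i \<subseteq> {x \<in> \<gg>. \<sigma> x \<in> G i}"
    by (rule G_perfect)
  then show "x \<in> G i \<Longrightarrow> \<sigma> x \<in> G i" by blast
qed

lemma br_G: "x \<in> G i \<Longrightarrow> y \<in> G i \<Longrightarrow> br x y \<in> G i"
  by (rule G_ideal(1)[OF G_fixed])

lemma G_in_H: "x \<in> G i \<Longrightarrow> x \<in> H i"
  and J_in_H: "x \<in> G i \<Longrightarrow> J x \<in> H i"
  using sub(7,8) J_G by blast+

lemma s_fixed_in_G: "x \<in> H i \<Longrightarrow> s x = x \<Longrightarrow> x \<in> G i"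
proof (rule H_fixed)
  assume "x \<in> H i" "s x = x"
  then show "x \<in> \<gg>"
    using sub(4)[of i] unfolding fixed_part_def by blast
qed

text \<open>The assumption \<open>e * e = 1\<close> keeps this case out of
  \<open>sign_of_model\<close>. Here \<open>J\<close> maps into the dual factor of the model, which
  is abelian, so \<open>\<sigma>\<close> vanishes on brackets.\<close>

lemma \<sigma>_Null:
  assumes x: "x \<in> G Null" shows "\<sigma> x = 0"
proof -
  obtain \<psi> where "legendrian_isomorphism (H Null) br s \<Lambda>
       (G Null \<times> dual (G Null)) (bracket0 (G Null) br) invol0 form0 \<psi>"
    using std by (auto simp: standard_decomposition_def legendrian_isomorphic_def)
  then have \<psi>: "lin_on (H Null) \<psi>" "bij_betw \<psi> (H Null) (G Null \<times> dual (G Null))"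
    "\<And>x y. x \<in> H Null \<Longrightarrow> y \<in> H Null \<Longrightarrow> \<psi> (br x y) = bracket0 (G Null) br (\<psi> x) (\<psi> y)"
    "\<And>x. x \<in> H Null \<Longrightarrow> \<psi> (s x) = invol0 (\<psi> x)"
    by (auto simp: legendrian_isomorphism_def)
  have J: "\<exists>l. \<psi> (J x) = (0, l) \<and> lin_on (G Null) l" "J x \<in> H Null" if x: "x \<in> G Null" for x
  proof -
    show JH: "J x \<in> H Null"
      using J_G[OF x] sub(8) by blast
    have "\<psi> (J x) \<in> G Null \<times> dual (G Null)"
      using bij_betwE[OF \<psi>(2)] JH by blast
    then obtain a l where al: "\<psi> (J x) = (a, l)" "lin_on (G Null) l"
      by (auto simp: dual_def)
    have "invol0 (\<psi> (J x)) = - \<psi> (J x)"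
      using \<psi>(4)[OF JH] antiD(2)[OF J_anti[OF G_fixed[OF x]]] lin_on_uminus[OF \<psi>(1) JH] by simp
    then have "a = - a"
      by (simp add: al invol0_def)
    then have "2 *\<^sub>R a = 0"
      by (metis add.right_inverse scaleR_2)
    then show "\<exists>l. \<psi> (J x) = (0, l) \<and> lin_on (G Null) l"
      using al by simp
  qed
  have "\<sigma> (br x y) = 0" if xy: "x \<in> G Null" "y \<in> G Null" for x y
  proof -
    obtain l m where lm: "\<psi> (J x) = (0, l)" "\<psi> (J y) = (0, m)" "lin_on (G Null) l" "lin_on (G Null) m"
      using J(1) xy by blast
    have "coad (G Null) br 0 k = 0" if "lin_on (G Null) k" for k
      using lin_on_zero[OF that sub(2)] G_fixed by (auto simp: coad_def fun_eq_iff)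
    then have "\<psi> (br (J x) (J y)) = 0"
      using lm \<psi>(3)[OF J(2) J(2), OF xy] by (simp add: bracket0_def zero_prod_def)
    moreover have "br (J x) (J y) \<in> H Null"
      using H_ideal[OF J_in_carrier[OF G_fixed[OF xy(1)]] J(2)[OF xy(2)]] .
    ultimately have "br (J x) (J y) = 0"
      using bij_betw_imp_inj_on[OF \<psi>(2)] lin_on_zero[OF \<psi>(1) sub(1)] subspace_0[OF sub(1)]
      by (metis inj_onD)
    then show ?thesis
      using br_J_J xy G_fixed by metis
  qed
  then have "G Null \<subseteq> {x \<in> \<gg>. \<sigma> x = 0}"
    using G_fixed by (intro G_perfect lin_on_eq_subspace[OF subspace_fixed \<sigma>_lin]) (auto simp: lin_on_def simp del: \<sigma>_br)
  then show ?thesis using x by blast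
qed

text \<open>The eigenspaces of the swap are the diagonal and the antidiagonal; the bracket of
  \<open>(a, - a)\<close> and \<open>(b, - b)\<close> is the diagonal element of
  \<open>br a b\<close>, so \<open>e = 1\<close>.\<close>

lemma \<sigma>_Pos:
  assumes x: "x \<in> G Pos" shows "\<sigma> x = x"
proof -
  obtain C \<psi> where C: "invariant_inner_product (G Pos) br C" and
    \<psi>: "legendrian_isomorphism (H Pos) br s \<Lambda> (G Pos \<times> G Pos) (bracket_pos br) invol_pos (form_pos C) \<psi>"
    using std by (auto simp: standard_decomposition_def legendrian_isomorphic_def)
  have "\<sigma> x = 1 *\<^sub>R x"
  proof (rule sign_of_model[OF \<psi> sub(2,5) br_G G_perfect \<sigma>_G G_in_H J_in_H s_fixed_in_G,
        where C = C and \<iota>\<^sub>0 = "\<lambda>a. (a, a)" and \<iota>\<^sub>1 = "\<lambda>a. (a, - a)"])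
    fix a b assume ab: "a \<in> G Pos" "b \<in> G Pos"
    have "a \<in> V" "b \<in> V" using ab G_fixed by auto
    then show "bracket_pos br (a, a) (b, - b) = (br a b, - br a b)"
      "bracket_pos br (a, - a) (b, b) = (br a b, - br a b)"
      "bracket_pos br (a, - a) (b, - b) = (1 *\<^sub>R br a b, 1 *\<^sub>R br a b)"
      by (simp_all add: bracket_pos_def)
    have "C (- a) b = - C a b"
      using lin_on_uminus[OF bilin_on_left[of "G Pos" C b] ab(1)] C ab(2)
      by (simp add: invariant_inner_product_def)
    then show "form_pos C (a, - a) (b, b) = C a b"
      by (simp add: form_pos_def)
    show "C a b = C b a"
      using C ab by (simp add: invariant_inner_product_def)
  next
    show "linear (\<lambda>a :: 'a. (a, a))" "linear (\<lambda>a :: 'a. (a, - a))"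
      by (auto intro: linearI)
    show "inj (\<lambda>a :: 'a. (a, a))" "inj (\<lambda>a :: 'a. (a, - a))"
      by (auto simp: inj_def)
    show "bilin_on (G Pos) C"
      using C by (simp add: invariant_inner_product_def)
    fix a assume "a \<in> G Pos"
    then show "(a, a) \<in> G Pos \<times> G Pos" "invol_pos (a, a) = (a, a)"
      by (simp_all add: invol_pos_def)
  next
    fix z assume z: "z \<in> G Pos \<times> G Pos"
    show "\<exists>a\<in>G Pos. z = (a, a)" if "invol_pos z = z"
      using z that by (auto simp: invol_pos_def)
    show "\<exists>a\<in>G Pos. z = (a, - a)" if "invol_pos z = - z"
    proof -
      obtain p q where pq: "z = (p, q)" "p \<in> G Pos" using z by blast
      have "fst (invol_pos z) = fst (- z)" by (simp only: that)
      then have "q = - p" by (simp add: pq(1) invol_pos_def)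
      then show ?thesis using pq by blast
    qed
  qed (auto simp: bracket_pos_def x)
  then show ?thesis by simp
qed

text \<open>The eigenspaces of conjugation are the real and the imaginary elements; the bracket of
  two imaginary elements is minus the real \<open>br a b\<close>, so \<open>e = - 1\<close>.\<close>

lemma \<sigma>_Neg:
  assumes x: "x \<in> G Neg" shows "\<sigma> x = - x"
proof -
  obtain C \<psi> where C: "invariant_inner_product (G Neg) br C" and
    \<psi>: "legendrian_isomorphism (H Neg) br s \<Lambda> (G Neg \<times> G Neg) (bracket_neg br) invol_neg (form_neg C) \<psi>"
    using std by (auto simp: standard_decomposition_def legendrian_isomorphic_def)
  have zero: "a = 0" if "a = - a" for a :: 'a
  proof -
    have "2 *\<^sub>R a = 0" using that by (metis add.right_inverse scaleR_2)
    then show ?thesis by simp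
  qed
  have "\<sigma> x = (- 1) *\<^sub>R x"
  proof (rule sign_of_model[OF \<psi> sub(2,5) br_G G_perfect \<sigma>_G G_in_H J_in_H s_fixed_in_G,
        where C = C and \<iota>\<^sub>0 = "\<lambda>a. (a, 0)" and \<iota>\<^sub>1 = "\<lambda>a. (0, a)"])
    fix a b assume ab: "a \<in> G Neg" "b \<in> G Neg"
    have "a \<in> V" "b \<in> V" using ab G_fixed by auto
    then show "bracket_neg br (a, 0) (b, 0) = (br a b, 0)"
      "bracket_neg br (a, 0) (0, b) = (0, br a b)"
      "bracket_neg br (0, a) (b, 0) = (0, br a b)"
      "bracket_neg br (0, a) (0, b) = (- 1 *\<^sub>R br a b, 0)"
      by (simp_all add: bracket_neg_def)
    have "C 0 0 = 0"
      using lin_on_zero[OF bilin_on_right[of "G Neg" C 0] sub(2)] C subspace_0[OF sub(2)]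
      by (simp add: invariant_inner_product_def)
    then show "form_neg C (0, a) (b, 0) = C a b"
      by (simp add: form_neg_def complex_extension_def)
    show "C a b = C b a"
      using C ab by (simp add: invariant_inner_product_def)
  next
    show "linear (\<lambda>a :: 'a. (a, 0 :: 'a))" "linear (\<lambda>a :: 'a. (0 :: 'a, a))"
      by (auto intro: linearI)
    show "inj (\<lambda>a :: 'a. (a, 0 :: 'a))" "inj (\<lambda>a :: 'a. (0 :: 'a, a))"
      by (auto simp: inj_def)
    show "bilin_on (G Neg) C"
      using C by (simp add: invariant_inner_product_def)
    fix a assume "a \<in> G Neg"
    then show "(a, 0) \<in> G Neg \<times> G Neg" "invol_neg (a, 0) = (a, 0)"
      by (simp_all add: invol_neg_def subspace_0[OF sub(2)])
  next
    fix z assume z: "z \<in> G Neg \<times> G Neg"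
    show "\<exists>a\<in>G Neg. z = (a, 0)" if "invol_neg z = z"
    proof -
      obtain p q where pq: "z = (p, q)" "p \<in> G Neg" using z by blast
      have "snd (invol_neg z) = snd z" by (simp only: that)
      then have "q = 0" by (intro zero) (simp add: pq(1) invol_neg_def)
      then show ?thesis using pq by blast
    qed
    show "\<exists>a\<in>G Neg. z = (0, a)" if "invol_neg z = - z"
    proof -
      obtain p q where pq: "z = (p, q)" "q \<in> G Neg" using z by blast
      have "fst (invol_neg z) = fst (- z)" by (simp only: that)
      then have "p = 0" by (intro zero) (simp add: pq(1) invol_neg_def)
      then show ?thesis using pq by blast
    qed
  qed (auto simp: x)
  then show ?thesis by simp
qed

text \<open>Each \<open>G i\<close> lies in \<open>gpart i\<close>, and both families decompose
  \<open>\<gg>\<close> directly, so they agree summand by summand. \<open>P\<close> and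
  \<open>H\<close> follow, being generated from \<open>G\<close> through \<open>J\<close>.\<close>

theorem standard_decomposition_unique: "H = hpart" "G = gpart" "P = ppart"
proof -
  have le: "x \<in> gpart i" if "x \<in> G i" for x i
    using that \<sigma>_Null \<sigma>_Pos \<sigma>_Neg G_fixed unfolding gpart_def by (cases i) auto
  have G: "G i = gpart i" for i
  proof (intro equalityI subsetI)
    fix x assume x: "x \<in> gpart i"
    obtain a where a: "\<And>j. a j \<in> G j" "x = a Null + a Pos + a Neg"
      using direct_sum3_ex[OF ds(2) gpart_fixed[OF x]] by blast
    have "a i = x"
      using direct_sum3_single[OF gpart_decomposition le[OF a(1)] a(2) x] .
    then show "x \<in> G i" using a(1) by metis
  qed (rule le)
  have P: "P i = ppart i" for i
    using P_eq G by (simp add: ppart_def)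
  have "H i = hpart i" for i
  proof (intro equalityI subsetI)
    fix v assume "v \<in> H i"
    then obtain a b where ab: "a \<in> G i" "b \<in> P i" "v = a + b"
      by (rule H_cases)
    from ab(2) obtain y where "y \<in> gpart i" "b = J y"
      unfolding P ppart_def by blast
    then show "v \<in> hpart i"
      using hpartI[of a i y] ab(1,3) G[of i] by simp
  next
    fix v assume "v \<in> hpart i"
    then obtain x y where xy: "x \<in> gpart i" "y \<in> gpart i" "v = x + J y"
      by (rule hpartE)
    have "x \<in> H i" "J y \<in> H i"
      using G_in_H[of x i] J_in_H[of y i] G[of i] xy(1,2) by simp_all
    then show "v \<in> H i"
      using subspace_add[OF sub(1)] xy(3) by simp
  qed
  then show "H = hpart" "G = gpart" "P = ppart"
    using G P by auto
qed

end

end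

theorem theorem3:
  fixes \<hh> :: "'a::euclidean_space set"
    and br :: "'a \<Rightarrow> 'a \<Rightarrow> 'a"
    and s :: "'a \<Rightarrow> 'a"
    and \<Lambda> :: "'a \<Rightarrow> 'a \<Rightarrow> real"
  assumes "legendrian_lie_algebra \<hh> br s \<Lambda>"
    and "orthogonal_symmetric \<hh> br s"
    and "effective \<hh> br s"
  shows "(\<exists>H G P. standard_decomposition \<hh> br s \<Lambda> H G P) \<and>
    (\<forall>H G P H' G' P'.
       standard_decomposition \<hh> br s \<Lambda> H G P \<longrightarrow>
       standard_decomposition \<hh> br s \<Lambda> H' G' P' \<longrightarrow>
       (\<exists>\<phi>. legendrian_isomorphism \<hh> br s \<Lambda> \<hh> br s \<Lambda> \<phi> \<and>
         (\<forall>i. \<phi> ` H i = H' i \<and> \<phi> ` G i = G' i \<and> \<phi> ` P i = P' i)))"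
proof -
  interpret euclidean_legendrian \<hh> br s \<Lambda>
    by (simp add: euclidean_legendrian_def assms(1))
  interpret euclidean_lie_algebra \<hh> br
    by (simp add: euclidean_lie_algebra_def lie_algebra_axioms)
  have sub: "fixed_part \<hh> s \<subseteq> \<hh>"
    by (auto simp: fixed_part_def)
  obtain Q where Q: "inner_space \<hh> Q"
    "\<And>x y z. \<lbrakk>x \<in> fixed_part \<hh> s; y \<in> \<hh>; z \<in> \<hh>\<rbrakk> \<Longrightarrow> Q (br x y) z = - Q y (br x z)"
    using compactly_embedded_invariant_form[OF subspace_fixed sub] assms(2)
    unfolding orthogonal_symmetric_def by blast
  interpret Q: inner_space \<hh> Q by (rule Q(1))
  \<comment> \<open>Skewness of \<open>ad y\<close> together with antisymmetry of the bracket is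
    invariance in the associative form.\<close>
  have inv: "Q (br x y) z = Q x (br y z)"
    if "x \<in> fixed_part \<hh> s" "y \<in> fixed_part \<hh> s" "z \<in> fixed_part \<hh> s" for x y z
    using Q(2)[of y x z] br_anti[of x y] that sub by (simp add: subset_iff)
  obtain J where J: "framed_legendrian \<hh> br s \<Lambda> Q J"
    using framed_exists[OF Q.inner_space_subset[OF subspace_fixed sub] assms(3) inv] by blast
  obtain B J' \<sigma> where nf: "normal_form \<hh> br s \<Lambda> B J' \<sigma>"
    using framed_legendrian.normal_form_exists[OF J] by blast
  interpret normal_form \<hh> br s \<Lambda> B J' \<sigma> by (rule nf)
  have id: "legendrian_isomorphism \<hh> br s \<Lambda> \<hh> br s \<Lambda> id"
    using assms(1) by (simp add: legendrian_isomorphism_def lin_on_def)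
  show ?thesis
  proof (intro conjI allI impI)
    show "\<exists>H G P. standard_decomposition \<hh> br s \<Lambda> H G P"
      using standard_decomposition_exists by blast
    fix H G P H' G' P'
    assume "standard_decomposition \<hh> br s \<Lambda> H G P" "standard_decomposition \<hh> br s \<Lambda> H' G' P'"
    from this[THEN standard_decomposition_unique(1)] this[THEN standard_decomposition_unique(2)]
      this[THEN standard_decomposition_unique(3)]
    show "\<exists>\<phi>. legendrian_isomorphism \<hh> br s \<Lambda> \<hh> br s \<Lambda> \<phi> \<and>
        (\<forall>i. \<phi> ` H i = H' i \<and> \<phi> ` G i = G' i \<and> \<phi> ` P i = P' i)"
      using id by (intro exI[of _ id]) simp
  qed
qed

end
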